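(* Let $H$ be a semisimple Hopf algebra over a field $\Bbbk$ and let $B$ be a bialgebra in the braided category ${}_H^H\mathcal{YD}$. Let $B\#H$ be the Radford-Majid bosonization. Then, for each $n\in\mathbb{N}_0$, $$\mathrm{H}^n(B\#H,\Bbbk)\cong\mathrm{H}^n(B,\Bbbk)^H,$$ and the differential $\partial^n:\mathrm{Hom}_\Bbbk(B^{\otimes n},\Bbbk)\to\mathrm{Hom}_\Bbbk(B^{\otimes(n+1)},\Bbbk)$ of the usual Hochschild cohomology is $H$-bilinear.
   Context: ${}_H^H\mathcal{YD}$ is the category of left-left Yetter-Drinfeld modules over $H$ (left $H$-modules and left $H$-comodules $V$, coaction $v\mapsto v_{-1}\otimes v_0$, with $(h_1v)_{-1}h_2\otimes(h_1v)_0=h_1v_{-1}\otimes h_2v_0$), monoidal with diagonal action and codiagonal coaction and braided by $c_{V,W}(v\otimes w)=v_{-1}w\otimes v_0$. The Radford-Majid bosonization $B\#H$ is $B\otimes H$ with multiplication $(b\#h)(b'\#h')=b(h_1b')\#h_2h'$, unit $1_B\#1_H$, comultiplication $\Delta(b\#h)=\sum(b^{(1)}\#(b^{(2)})_{-1}h_1)\otimes((b^{(2)})_0\#h_2)$ and counit $\varepsilon_B\otimes\varepsilon_H$. For a $\Bbbk$-algebra $A$ and $A$-bimodule $M$, $\mathrm{H}^n(A,M)$ denotes ordinary Hochschild cohomology. $\Bbbk$ is a $B\#H$-bimodule via the counit $\varepsilon_B\otimes\varepsilon_H$ and a $B$-bimodule via $\varepsilon_B$. $\mathrm{Hom}_\Bbbk(B^{\otimes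 n},\Bbbk)$ is an $H$-bimodule with left action through $\varepsilon_H$ and right action $(fh)(z)=f(hz)$, $z\in B^{\otimes n}$ (diagonal action of $H$ on $B^{\otimes n}$). $\mathrm{H}^n(B,\Bbbk)$ is an $H$-bimodule with left action through $\varepsilon_H$ and right action $[f]h=[fh]$ for cocycles $f$. For an $H$-bimodule $X$, $X^H=\{x\in X\mid hx=xh\text{ for all }h\in H\}$. *)

theory Defs
  imports Complex_Main "HOL-Library.Poly_Mapping" "HOL-Library.Function_Algebras"
begin

section \<open>Vector spaces with a carrier, and quotients\<close>

record ('k, 'a) vspace =
  car :: "'a set"
  vadd :: "'a \<Rightarrow> 'a \<Rightarrow> 'a"
  vzero :: 'a
  vscale :: "'k \<Rightarrow> 'a \<Rightarrow> 'a"

record ('k, 'a) alg = "('k, 'a) vspace" +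
  amult :: "'a \<Rightarrow> 'a \<Rightarrow> 'a"
  aone :: 'a

definition whole :: "('k::field \<Rightarrow> 'a::ab_group_add \<Rightarrow> 'a) \<Rightarrow> ('k, 'a) vspace"
  where "whole s = \<lparr>car = UNIV, vadd = (+), vzero = 0, vscale = s\<rparr>"

definition whole_alg :: "('k::field \<Rightarrow> 'a::ring_1 \<Rightarrow> 'a) \<Rightarrow> ('k, 'a) alg"
  where "whole_alg s =
    \<lparr>car = UNIV, vadd = (+), vzero = 0, vscale = s, amult = (*), aone = 1\<rparr>"

definition linear_between ::
    "('k, 'a, 'm) vspace_scheme \<Rightarrow> ('k, 'b, 'n) vspace_scheme \<Rightarrow> ('a \<Rightarrow> 'b) \<Rightarrow> bool"
  where "linear_between V W f \<longleftrightarrow>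
    (\<forall>x\<in>car V. f x \<in> car W) \<and>
    (\<forall>x\<in>car V. \<forall>y\<in>car V. f (vadd V x y) = vadd W (f x) (f y)) \<and>
    (\<forall>c. \<forall>x\<in>car V. f (vscale V c x) = vscale W c (f x))"

definition isomorphic_spaces ::
    "('k, 'a, 'm) vspace_scheme \<Rightarrow> ('k, 'b, 'n) vspace_scheme \<Rightarrow> bool"
  where "isomorphic_spaces V W \<longleftrightarrow>
    (\<exists>f. linear_between V W f \<and> bij_betw f (car V) (car W))"

definition coset :: "'v::ab_group_add set \<Rightarrow> 'v \<Rightarrow> 'v set"
  where "coset N x = (+) x ` N"

text \<open>
  Maps induced on classes, without choosing representatives: if \<open>\<phi>\<close> respects the subspaces
  involved, the union below is over one and the same coset of \<open>N\<close>, the class of \<open>\<phi> x\<close> for any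
  \<open>x \<in> X\<close>.
\<close>

definition induced :: "'w::ab_group_add set \<Rightarrow> ('v \<Rightarrow> 'w) \<Rightarrow> 'v set \<Rightarrow> 'w set"
  where "induced N \<phi> X = (\<Union>x\<in>X. coset N (\<phi> x))"

definition induced2 ::
    "'w::ab_group_add set \<Rightarrow> ('u \<Rightarrow> 'v \<Rightarrow> 'w) \<Rightarrow> 'u set \<Rightarrow> 'v set \<Rightarrow> 'w set"
  where "induced2 N \<phi> X Y = (\<Union>x\<in>X. \<Union>y\<in>Y. coset N (\<phi> x y))"

text \<open>The quotient \<open>U / N\<close>, for subspaces \<open>N \<subseteq> U\<close> of an ambient space with scalar action \<open>s\<close>.\<close>

definition quotient_space ::
    "('k \<Rightarrow> 'v \<Rightarrow> 'v) \<Rightarrow> 'v::ab_group_add set \<Rightarrow> 'v set \<Rightarrow> ('k, 'v set) vspace"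
  where "quotient_space s U N =
    \<lparr>car = coset N ` U, vadd = induced2 N (+), vzero = N, vscale = (\<lambda>c. induced N (s c))\<rparr>"


section \<open>Tensor products\<close>

text \<open>The free vector space on \<open>'x\<close> is the type \<open>'x \<Rightarrow>\<^sub>0 'k\<close>, with basis \<open>gen x\<close>.\<close>

abbreviation gen :: "'x \<Rightarrow> 'x \<Rightarrow>\<^sub>0 'k::field"
  where "gen x \<equiv> Poly_Mapping.single x 1"

definition fscale :: "'k::field \<Rightarrow> ('x \<Rightarrow>\<^sub>0 'k) \<Rightarrow> ('x \<Rightarrow>\<^sub>0 'k)"
  where "fscale c = Poly_Mapping.map ((*) c)"

text \<open>The linear extension of \<open>F\<close> to the free space; \<open>s\<close> is the scalar action on the target.\<close>

definition flin ::
    "('k::field \<Rightarrow> 'v \<Rightarrow> 'v) \<Rightarrow> ('x \<Rightarrow> 'v) \<Rightarrow> ('x \<Rightarrow>\<^sub>0 'k) \<Rightarrow> 'v::ab_group_add"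
  where "flin s F r = (\<Sum>p\<in>Poly_Mapping.keys r. s (Poly_Mapping.lookup r p) (F p))"

definition bilinear_relations ::
    "('k::field, 'a, 'm) vspace_scheme \<Rightarrow> ('k, 'b, 'n) vspace_scheme \<Rightarrow> ('a \<times> 'b \<Rightarrow>\<^sub>0 'k) set"
  where "bilinear_relations V W =
    {gen (vadd V v v', w) - gen (v, w) - gen (v', w) | v v' w.
       v \<in> car V \<and> v' \<in> car V \<and> w \<in> car W} \<union>
    {gen (v, vadd W w w') - gen (v, w) - gen (v, w') | v w w'.
       v \<in> car V \<and> w \<in> car W \<and> w' \<in> car W} \<union>
    {gen (vscale V c v, w) - fscale c (gen (v, w)) | c v w. v \<in> car V \<and> w \<in> car W} \<union>
    {gen (v, vscale W c w) - fscale c (gen (v, w)) | c v w. v \<in> car V \<and> w \<in> car W}"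

definition tensor_rel ::
    "('k::field, 'a, 'm) vspace_scheme \<Rightarrow> ('k, 'b, 'n) vspace_scheme \<Rightarrow> ('a \<times> 'b \<Rightarrow>\<^sub>0 'k) set"
  where "tensor_rel V W = module.span fscale (bilinear_relations V W)"

definition tensor ::
    "('k::field, 'a, 'm) vspace_scheme \<Rightarrow> ('k, 'b, 'n) vspace_scheme
      \<Rightarrow> ('k, ('a \<times> 'b \<Rightarrow>\<^sub>0 'k) set) vspace"
  where "tensor V W =
    quotient_space fscale {r. Poly_Mapping.keys r \<subseteq> car V \<times> car W} (tensor_rel V W)"

definition tclass ::
    "('k::field, 'a, 'm) vspace_scheme \<Rightarrow> ('k, 'b, 'n) vspace_scheme
      \<Rightarrow> ('a \<times> 'b \<Rightarrow>\<^sub>0 'k) \<Rightarrow> ('a \<times> 'b \<Rightarrow>\<^sub>0 'k) set"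
  where "tclass V W = coset (tensor_rel V W)"

definition pure_tensor ::
    "('k::field, 'a, 'm) vspace_scheme \<Rightarrow> ('k, 'b, 'n) vspace_scheme
      \<Rightarrow> 'a \<Rightarrow> 'b \<Rightarrow> ('a \<times> 'b \<Rightarrow>\<^sub>0 'k) set"
  where "pure_tensor V W v w = tclass V W (gen (v, w))"

text \<open>
  Sweedler sums.  If \<open>X\<close> is the class of \<open>\<Sum>\<^sub>i v\<^sub>i \<otimes> w\<^sub>i\<close>, then \<open>sweedler s X \<beta>\<close> is
  \<open>\<Sum>\<^sub>i \<beta> v\<^sub>i w\<^sub>i\<close>, evaluated on a chosen representative of \<open>X\<close>; for bilinear \<open>\<beta>\<close> the choice does
  not matter.  In \<open>fsweedler\<close> the summands are formal sums that represent tensors: there \<open>\<beta>\<close> is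
  bilinear modulo the tensor relations only, so its values are always used under \<open>tclass\<close> or
  \<open>induced\<close>.
\<close>

definition sweedler ::
    "('k::field \<Rightarrow> 'c \<Rightarrow> 'c) \<Rightarrow> ('a \<times> 'b \<Rightarrow>\<^sub>0 'k) set \<Rightarrow> ('a \<Rightarrow> 'b \<Rightarrow> 'c) \<Rightarrow> 'c::ab_group_add"
  where "sweedler s X \<beta> = flin s (\<lambda>(v, w). \<beta> v w) (SOME r. r \<in> X)"

abbreviation fsweedler ::
    "('a \<times> 'b \<Rightarrow>\<^sub>0 'k::field) set \<Rightarrow> ('a \<Rightarrow> 'b \<Rightarrow> ('x \<Rightarrow>\<^sub>0 'k)) \<Rightarrow> 'x \<Rightarrow>\<^sub>0 'k"
  where "fsweedler \<equiv> sweedler fscale"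


section \<open>Hopf algebras\<close>

locale k_algebra = vector_space s
  for s :: "'k::field \<Rightarrow> 'a::ring_1 \<Rightarrow> 'a" +
  assumes scale_mult_left: "s c x * y = s c (x * y)"
    and scale_mult_right: "x * s c y = s c (x * y)"

locale k_coalgebra = vector_space s
  for s :: "'k::field \<Rightarrow> 'a::ab_group_add \<Rightarrow> 'a" +
  fixes \<Delta> :: "'a \<Rightarrow> ('a \<times> 'a \<Rightarrow>\<^sub>0 'k) set"
    and \<epsilon> :: "'a \<Rightarrow> 'k"
  assumes comult_linear: "linear_between (whole s) (tensor (whole s) (whole s)) \<Delta>"
    and counit_linear: "linear_between (whole s) (whole (*)) \<epsilon>"
    and coassoc:
      "tclass (tensor (whole s) (whole s)) (whole s)
         (fsweedler (\<Delta> x) (\<lambda>x1 x2. gen (\<Delta> x1, x2))) =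
       tclass (tensor (whole s) (whole s)) (whole s)
         (fsweedler (\<Delta> x) (\<lambda>x1 x2.
            fsweedler (\<Delta> x2) (\<lambda>x3 x4. gen (pure_tensor (whole s) (whole s) x1 x3, x4))))"
    and counit_left: "sweedler s (\<Delta> x) (\<lambda>x1 x2. s (\<epsilon> x1) x2) = x"
    and counit_right: "sweedler s (\<Delta> x) (\<lambda>x1 x2. s (\<epsilon> x2) x1) = x"

locale k_bialgebra = k_algebra s + k_coalgebra s \<Delta> \<epsilon>
  for s :: "'k::field \<Rightarrow> 'a::ring_1 \<Rightarrow> 'a" and \<Delta> \<epsilon> +
  assumes comult_one: "\<Delta> 1 = pure_tensor (whole s) (whole s) 1 1"
    and comult_mult:
      "\<Delta> (x * y) = tclass (whole s) (whole s)
         (fsweedler (\<Delta> x) (\<lambda>x1 x2. fsweedler (\<Delta> y) (\<lambda>y1 y2. gen (x1 * y1, x2 * y2))))"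
    and counit_one: "\<epsilon> 1 = 1"
    and counit_mult: "\<epsilon> (x * y) = \<epsilon> x * \<epsilon> y"

locale hopf_algebra = k_bialgebra s \<Delta> \<epsilon>
  for s :: "'k::field \<Rightarrow> 'a::ring_1 \<Rightarrow> 'a" and \<Delta> \<epsilon> +
  fixes S :: "'a \<Rightarrow> 'a"
  assumes antipode_linear: "linear_between (whole s) (whole s) S"
    and antipode_left: "sweedler s (\<Delta> x) (\<lambda>x1 x2. S x1 * x2) = s (\<epsilon> x) 1"
    and antipode_right: "sweedler s (\<Delta> x) (\<lambda>x1 x2. x1 * S x2) = s (\<epsilon> x) 1"

definition left_ideal :: "'a::ring_1 set \<Rightarrow> bool"
  where "left_ideal I \<longleftrightarrow>
    0 \<in> I \<and> (\<forall>x\<in>I. \<forall>y\<in>I. x + y \<in> I) \<and> (\<forall>a. \<forall>x\<in>I. a * x \<in> I)"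

text \<open>The regular left module is semisimple: each of its submodules is a direct summand.\<close>

definition semisimple_ring :: "'a::ring_1 itself \<Rightarrow> bool"
  where "semisimple_ring _ \<longleftrightarrow>
    (\<forall>I::'a set. left_ideal I \<longrightarrow>
       (\<exists>J. left_ideal J \<and> I \<inter> J = {0} \<and> (\<forall>x. \<exists>i\<in>I. \<exists>j\<in>J. x = i + j)))"


section \<open>Bialgebras in the category of Yetter-Drinfeld modules\<close>

locale yetter_drinfeld_module =
  H: hopf_algebra sH \<Delta>H \<epsilon>H SH + vector_space sV
  for sH :: "'k::field \<Rightarrow> 'h::ring_1 \<Rightarrow> 'h" and \<Delta>H \<epsilon>H SH
    and sV :: "'k \<Rightarrow> 'v::ab_group_add \<Rightarrow> 'v" +
  fixes act :: "'h \<Rightarrow> 'v \<Rightarrow> 'v"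
    and coact :: "'v \<Rightarrow> ('h \<times> 'v \<Rightarrow>\<^sub>0 'k) set"
  assumes act_linear_left: "linear_between (whole sH) (whole sV) (\<lambda>h. act h v)"
    and act_linear_right: "linear_between (whole sV) (whole sV) (act h)"
    and act_one: "act 1 v = v"
    and act_mult: "act (g * h) v = act g (act h v)"
    and coact_linear: "linear_between (whole sV) (tensor (whole sH) (whole sV)) coact"
    and coact_coassoc:
      "tclass (tensor (whole sH) (whole sH)) (whole sV)
         (fsweedler (coact v) (\<lambda>h w. gen (\<Delta>H h, w))) =
       tclass (tensor (whole sH) (whole sH)) (whole sV)
         (fsweedler (coact v) (\<lambda>h w.
            fsweedler (coact w) (\<lambda>g u. gen (pure_tensor (whole sH) (whole sH) h g, u))))"
    and coact_counit: "sweedler sV (coact v) (\<lambda>h w. sV (\<epsilon>H h) w) = v"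
    and yetter_drinfeld:
      "tclass (whole sH) (whole sV)
         (fsweedler (\<Delta>H h) (\<lambda>h1 h2.
            fsweedler (coact (act h1 v)) (\<lambda>g w. gen (g * h2, w)))) =
       tclass (whole sH) (whole sV)
         (fsweedler (\<Delta>H h) (\<lambda>h1 h2.
            fsweedler (coact v) (\<lambda>g w. gen (h1 * g, act h2 w))))"

text \<open>
  The first eight axioms say that multiplication, unit, comultiplication and counit are morphisms of
  Yetter-Drinfeld modules, for the diagonal action and codiagonal coaction on \<open>B \<otimes> B\<close> and the
  trivial ones on the base field.  The right-hand side of \<open>braided_comult_mult\<close> is the product
  \<open>(m \<otimes> m) (id \<otimes> c \<otimes> id)\<close> of \<open>B \<otimes> B\<close> for the braiding \<open>c (v \<otimes> w) = v\<^sub>-\<^sub>1 w \<otimes> v\<^sub>0\<close>.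
\<close>

locale yetter_drinfeld_bialgebra =
  yetter_drinfeld_module sH \<Delta>H \<epsilon>H SH sB act coact +
  B: k_algebra sB + B: k_coalgebra sB \<Delta>B \<epsilon>B
  for sH :: "'k::field \<Rightarrow> 'h::ring_1 \<Rightarrow> 'h" and \<Delta>H \<epsilon>H SH
    and sB :: "'k \<Rightarrow> 'b::ring_1 \<Rightarrow> 'b" and act coact \<Delta>B \<epsilon>B +
  assumes mult_act:
      "act h (x * y) = sweedler sB (\<Delta>H h) (\<lambda>h1 h2. act h1 x * act h2 y)"
    and one_act: "act h 1 = sB (\<epsilon>H h) 1"
    and mult_coact:
      "coact (x * y) = tclass (whole sH) (whole sB)
         (fsweedler (coact x) (\<lambda>g u. fsweedler (coact y) (\<lambda>h w. gen (g * h, u * w))))"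
    and one_coact: "coact 1 = pure_tensor (whole sH) (whole sB) 1 1"
    and comult_act:
      "\<Delta>B (act h x) = tclass (whole sB) (whole sB)
         (fsweedler (\<Delta>H h) (\<lambda>h1 h2.
            fsweedler (\<Delta>B x) (\<lambda>x1 x2. gen (act h1 x1, act h2 x2))))"
    and counit_act: "\<epsilon>B (act h x) = \<epsilon>H h * \<epsilon>B x"
    and comult_coact:
      "tclass (whole sH) (tensor (whole sB) (whole sB))
         (fsweedler (coact x) (\<lambda>h y. gen (h, \<Delta>B y))) =
       tclass (whole sH) (tensor (whole sB) (whole sB))
         (fsweedler (\<Delta>B x) (\<lambda>x1 x2.
            fsweedler (coact x1) (\<lambda>g u.
              fsweedler (coact x2) (\<lambda>h w.
                gen (g * h, pure_tensor (whole sB) (whole sB) u w)))))"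
    and counit_coact: "sweedler sH (coact x) (\<lambda>h y. sH (\<epsilon>B y) h) = sH (\<epsilon>B x) 1"
    and braided_comult_one: "\<Delta>B 1 = pure_tensor (whole sB) (whole sB) 1 1"
    and braided_comult_mult:
      "\<Delta>B (x * y) = tclass (whole sB) (whole sB)
         (fsweedler (\<Delta>B x) (\<lambda>x1 x2.
            fsweedler (\<Delta>B y) (\<lambda>y1 y2.
              fsweedler (coact x2) (\<lambda>h u. gen (x1 * act h y1, u * y2)))))"
    and braided_counit_one: "\<epsilon>B 1 = 1"
    and braided_counit_mult: "\<epsilon>B (x * y) = \<epsilon>B x * \<epsilon>B y"


section \<open>Bosonization\<close>

record (overloaded) ('k, 'a) bialg = "('k, 'a) alg" +
  acomult :: "'a \<Rightarrow> ('a \<times> 'a \<Rightarrow>\<^sub>0 'k) set"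
  acounit :: "'a \<Rightarrow> 'k"

definition bosonization ::
    "('k::field \<Rightarrow> 'h::ring_1 \<Rightarrow> 'h) \<Rightarrow> ('h \<Rightarrow> ('h \<times> 'h \<Rightarrow>\<^sub>0 'k) set) \<Rightarrow> ('h \<Rightarrow> 'k) \<Rightarrow>
     ('k \<Rightarrow> 'b::ring_1 \<Rightarrow> 'b) \<Rightarrow> ('h \<Rightarrow> 'b \<Rightarrow> 'b) \<Rightarrow> ('b \<Rightarrow> ('h \<times> 'b \<Rightarrow>\<^sub>0 'k) set) \<Rightarrow>
     ('b \<Rightarrow> ('b \<times> 'b \<Rightarrow>\<^sub>0 'k) set) \<Rightarrow> ('b \<Rightarrow> 'k) \<Rightarrow> ('k, ('b \<times> 'h \<Rightarrow>\<^sub>0 'k) set) bialg"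
  where "bosonization sH \<Delta>H \<epsilon>H sB act coact \<Delta>B \<epsilon>B =
    (let T = tensor (whole sB) (whole sH); N = tensor_rel (whole sB) (whole sH);
         p = pure_tensor (whole sB) (whole sH)
     in \<lparr>car = car T, vadd = vadd T, vzero = vzero T, vscale = vscale T,
         amult = induced2 N (\<lambda>X Y.
           flin fscale (\<lambda>(b, h).
             flin fscale (\<lambda>(b', h').
               fsweedler (\<Delta>H h) (\<lambda>h1 h2. gen (b * act h1 b', h2 * h'))) Y) X),
         aone = p 1 1,
         acomult = induced (tensor_rel T T)
           (flin fscale (\<lambda>(b, h).
             fsweedler (\<Delta>B b) (\<lambda>b1 b2.
               fsweedler (\<Delta>H h) (\<lambda>h1 h2.
                 fsweedler (coact b2) (\<lambda>g u. gen (p b1 (g * h1), p u h2)))))),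
         acounit = (\<lambda>X. sweedler (*) X (\<lambda>b h. \<epsilon>B b * \<epsilon>H h))\<rparr>)"


section \<open>Hochschild cohomology\<close>

text \<open>
  \<open>Hom(A\<^sup>\<otimes>\<^sup>n, M)\<close> is realised as the space of \<open>n\<close>-linear maps \<open>A\<^sup>n \<rightarrow> M\<close>, an element of \<open>A\<^sup>n\<close>
  being a list of length \<open>n\<close>.  Cochains are extended by \<open>0\<close> outside \<open>A\<^sup>n\<close>, so that two of them are
  equal as functions iff they agree on \<open>A\<^sup>n\<close>.  The vector space structure on functions is the
  pointwise one.
\<close>

definition tuples :: "('k, 'a, 'm) vspace_scheme \<Rightarrow> nat \<Rightarrow> 'a list set"
  where "tuples A n = {xs. length xs = n \<and> set xs \<subseteq> car A}"

definition cochains ::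
    "('k::field, 'a, 'm) vspace_scheme \<Rightarrow> ('k \<Rightarrow> 'v::ab_group_add \<Rightarrow> 'v) \<Rightarrow> nat \<Rightarrow> ('a list \<Rightarrow> 'v) set"
  where "cochains A sM n = {f.
    (\<forall>xs. xs \<notin> tuples A n \<longrightarrow> f xs = 0) \<and>
    (\<forall>xs\<in>tuples A n. \<forall>i<n. \<forall>x\<in>car A. \<forall>y\<in>car A.
       f (xs[i := vadd A x y]) = f (xs[i := x]) + f (xs[i := y])) \<and>
    (\<forall>xs\<in>tuples A n. \<forall>i<n. \<forall>c. \<forall>x\<in>car A.
       f (xs[i := vscale A c x]) = sM c (f (xs[i := x])))}"

definition cochain_scale :: "('k \<Rightarrow> 'v \<Rightarrow> 'v) \<Rightarrow> 'k \<Rightarrow> ('a list \<Rightarrow> 'v) \<Rightarrow> 'a list \<Rightarrow> 'v"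
  where "cochain_scale sM c f = (\<lambda>xs. sM c (f xs))"

definition cochain_space ::
    "('k::field, 'a, 'm) vspace_scheme \<Rightarrow> ('k \<Rightarrow> 'v::ab_group_add \<Rightarrow> 'v) \<Rightarrow> nat
      \<Rightarrow> ('k, 'a list \<Rightarrow> 'v) vspace"
  where "cochain_space A sM n =
    \<lparr>car = cochains A sM n, vadd = (+), vzero = 0, vscale = cochain_scale sM\<rparr>"

text \<open>Coefficients in an \<open>A\<close>-bimodule with left action \<open>l\<close> and right action \<open>r\<close>.\<close>

definition hochschild_diff ::
    "('k::field, 'a, 'm) alg_scheme \<Rightarrow> ('k \<Rightarrow> 'v::ab_group_add \<Rightarrow> 'v) \<Rightarrow> ('a \<Rightarrow> 'v \<Rightarrow> 'v) \<Rightarrow>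
     ('v \<Rightarrow> 'a \<Rightarrow> 'v) \<Rightarrow> nat \<Rightarrow> ('a list \<Rightarrow> 'v) \<Rightarrow> 'a list \<Rightarrow> 'v"
  where "hochschild_diff A sM l r n f xs =
    (if xs \<in> tuples A (Suc n) then
       l (hd xs) (f (tl xs)) +
       (\<Sum>i<n. sM ((-1) ^ Suc i)
          (f (take i xs @ amult A (xs ! i) (xs ! Suc i) # drop (Suc (Suc i)) xs))) +
       sM ((-1) ^ Suc n) (r (f (butlast xs)) (last xs))
     else 0)"

definition cocycles ::
    "('k::field, 'a, 'm) alg_scheme \<Rightarrow> ('k \<Rightarrow> 'v::ab_group_add \<Rightarrow> 'v) \<Rightarrow> ('a \<Rightarrow> 'v \<Rightarrow> 'v) \<Rightarrow>
     ('v \<Rightarrow> 'a \<Rightarrow> 'v) \<Rightarrow> nat \<Rightarrow> ('a list \<Rightarrow> 'v) set"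
  where "cocycles A sM l r n = {f \<in> cochains A sM n. hochschild_diff A sM l r n f = 0}"

definition coboundaries ::
    "('k::field, 'a, 'm) alg_scheme \<Rightarrow> ('k \<Rightarrow> 'v::ab_group_add \<Rightarrow> 'v) \<Rightarrow> ('a \<Rightarrow> 'v \<Rightarrow> 'v) \<Rightarrow>
     ('v \<Rightarrow> 'a \<Rightarrow> 'v) \<Rightarrow> nat \<Rightarrow> ('a list \<Rightarrow> 'v) set"
  where "coboundaries A sM l r n =
    (case n of 0 \<Rightarrow> {0} | Suc m \<Rightarrow> hochschild_diff A sM l r m ` cochains A sM m)"

definition hochschild_cohomology ::
    "('k::field, 'a, 'm) alg_scheme \<Rightarrow> ('k \<Rightarrow> 'v::ab_group_add \<Rightarrow> 'v) \<Rightarrow> ('a \<Rightarrow> 'v \<Rightarrow> 'v) \<Rightarrow>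
     ('v \<Rightarrow> 'a \<Rightarrow> 'v) \<Rightarrow> nat \<Rightarrow> ('k, ('a list \<Rightarrow> 'v) set) vspace"
  where "hochschild_cohomology A sM l r n =
    quotient_space (cochain_scale sM) (cocycles A sM l r n) (coboundaries A sM l r n)"

text \<open>The base field as a bimodule over \<open>A\<close> via an augmentation \<open>\<epsilon>\<close>.\<close>

definition trivial_diff ::
    "('k::field, 'a, 'm) alg_scheme \<Rightarrow> ('a \<Rightarrow> 'k) \<Rightarrow> nat \<Rightarrow> ('a list \<Rightarrow> 'k) \<Rightarrow> 'a list \<Rightarrow> 'k"
  where "trivial_diff A \<epsilon> = hochschild_diff A (*) (\<lambda>a x. \<epsilon> a * x) (\<lambda>x a. x * \<epsilon> a)"

definition trivial_coboundaries ::
    "('k::field, 'a, 'm) alg_scheme \<Rightarrow> ('a \<Rightarrow> 'k) \<Rightarrow> nat \<Rightarrow> ('a list \<Rightarrow> 'k) set"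
  where "trivial_coboundaries A \<epsilon> = coboundaries A (*) (\<lambda>a x. \<epsilon> a * x) (\<lambda>x a. x * \<epsilon> a)"

definition trivial_cohomology ::
    "('k::field, 'a, 'm) alg_scheme \<Rightarrow> ('a \<Rightarrow> 'k) \<Rightarrow> nat \<Rightarrow> ('k, ('a list \<Rightarrow> 'k) set) vspace"
  where "trivial_cohomology A \<epsilon> =
    hochschild_cohomology A (*) (\<lambda>a x. \<epsilon> a * x) (\<lambda>x a. x * \<epsilon> a)"


section \<open>The \<open>H\<close>-bimodule structures\<close>

text \<open>
  \<open>diag_act h [b\<^sub>1, \<dots>, b\<^sub>n]\<close> is a formal sum representing
  \<open>h (b\<^sub>1 \<otimes> \<dots> \<otimes> b\<^sub>n) = \<Sum> h\<^sub>1 b\<^sub>1 \<otimes> \<dots> \<otimes> h\<^sub>n b\<^sub>n\<close>; for \<open>n = 0\<close>, \<open>H\<close> acts on the base field through \<open>\<epsilon>\<close>.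
\<close>

primrec diag_act ::
    "('h \<Rightarrow> ('h \<times> 'h \<Rightarrow>\<^sub>0 'k::field) set) \<Rightarrow> ('h \<Rightarrow> 'k) \<Rightarrow> ('h \<Rightarrow> 'b \<Rightarrow> 'b) \<Rightarrow>
     'b list \<Rightarrow> 'h \<Rightarrow> ('b list \<Rightarrow>\<^sub>0 'k)"
  where
    "diag_act \<Delta> \<epsilon> act [] = (\<lambda>h. fscale (\<epsilon> h) (gen []))"
  | "diag_act \<Delta> \<epsilon> act (b # bs) = (\<lambda>h.
       fsweedler (\<Delta> h) (\<lambda>h1 h2.
         flin fscale (\<lambda>ys. gen (act h1 b # ys)) (diag_act \<Delta> \<epsilon> act bs h2)))"

definition cochain_left :: "('h \<Rightarrow> 'k::field) \<Rightarrow> 'h \<Rightarrow> ('b list \<Rightarrow> 'k) \<Rightarrow> 'b list \<Rightarrow> 'k"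
  where "cochain_left \<epsilon> h f = (\<lambda>bs. \<epsilon> h * f bs)"

definition cochain_right ::
    "('h \<Rightarrow> ('h \<times> 'h \<Rightarrow>\<^sub>0 'k::field) set) \<Rightarrow> ('h \<Rightarrow> 'k) \<Rightarrow> ('h \<Rightarrow> 'b \<Rightarrow> 'b) \<Rightarrow>
     ('b list \<Rightarrow> 'k) \<Rightarrow> 'h \<Rightarrow> 'b list \<Rightarrow> 'k"
  where "cochain_right \<Delta> \<epsilon> act f h = (\<lambda>bs. flin (*) f (diag_act \<Delta> \<epsilon> act bs h))"

text \<open>The induced actions \<open>h [f] = [\<epsilon>(h) f]\<close> and \<open>[f] h = [f h]\<close> on \<open>H\<^sup>n(B, k)\<close>.\<close>

definition cohomology_left ::
    "('k::field, 'b, 'm) alg_scheme \<Rightarrow> ('b \<Rightarrow> 'k) \<Rightarrow> nat \<Rightarrow> ('h \<Rightarrow> 'k) \<Rightarrow>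
     'h \<Rightarrow> ('b list \<Rightarrow> 'k) set \<Rightarrow> ('b list \<Rightarrow> 'k) set"
  where "cohomology_left B \<epsilon>B n \<epsilon>H h =
    induced (trivial_coboundaries B \<epsilon>B n) (cochain_left \<epsilon>H h)"

definition cohomology_right ::
    "('k::field, 'b, 'm) alg_scheme \<Rightarrow> ('b \<Rightarrow> 'k) \<Rightarrow> nat \<Rightarrow>
     ('h \<Rightarrow> ('h \<times> 'h \<Rightarrow>\<^sub>0 'k) set) \<Rightarrow> ('h \<Rightarrow> 'k) \<Rightarrow> ('h \<Rightarrow> 'b \<Rightarrow> 'b) \<Rightarrow>
     ('b list \<Rightarrow> 'k) set \<Rightarrow> 'h \<Rightarrow> ('b list \<Rightarrow> 'k) set"
  where "cohomology_right B \<epsilon>B n \<Delta>H \<epsilon>H act X h =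
    induced (trivial_coboundaries B \<epsilon>B n) (\<lambda>f. cochain_right \<Delta>H \<epsilon>H act f h) X"

definition invariants ::
    "('k, 'x) vspace \<Rightarrow> ('h \<Rightarrow> 'x \<Rightarrow> 'x) \<Rightarrow> ('x \<Rightarrow> 'h \<Rightarrow> 'x) \<Rightarrow> ('k, 'x) vspace"
  where "invariants X l r = X\<lparr>car := {x \<in> car X. \<forall>h. l h x = r x h}\<rparr>"

definition bimodule_hom ::
    "('k, 'x) vspace \<Rightarrow> ('h \<Rightarrow> 'x \<Rightarrow> 'x) \<Rightarrow> ('x \<Rightarrow> 'h \<Rightarrow> 'x) \<Rightarrow>
     ('k, 'y) vspace \<Rightarrow> ('h \<Rightarrow> 'y \<Rightarrow> 'y) \<Rightarrow> ('y \<Rightarrow> 'h \<Rightarrow> 'y) \<Rightarrow> ('x \<Rightarrow> 'y) \<Rightarrow> bool"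
  where "bimodule_hom X lX rX Y lY rY f \<longleftrightarrow>
    linear_between X Y f \<and>
    (\<forall>h. \<forall>x\<in>car X. f (lX h x) = lY h (f x) \<and> f (rX x h) = rY (f x) h)"

end

theory Submission
  imports Defs
begin

text \<open>
  Write \<open>A = B # H\<close>, and let \<open>\<Lambda>\<close> be a left integral of \<open>H\<close> with \<open>\<epsilon>(\<Lambda>) = 1\<close>; it exists because the
  kernel of the counit has a complementary left ideal (\<open>semisimple_integral\<close>).  Then
  \<open>e = \<Lambda>\<^sub>1 \<otimes> S \<Lambda>\<^sub>2\<close> is a separability idempotent: its product is \<open>1\<close>, and \<open>h e = e h\<close> for all \<open>h\<close> in
  \<open>H\<close> (\<open>integral_central\<close>).  Moreover \<open>t = S \<Lambda>\<close> is a right integral with \<open>\<epsilon>(t) = 1\<close>.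

  Inserting a copy of \<open>e\<close> behind each argument of a cochain of \<open>A\<close>, and \<open>t\<close> in front of the first,
  with the counit applied to what stands behind the last argument, is an endomorphism of the
  Hochschild complex of \<open>A\<close> that is homotopic to the identity (\<open>averaging_homotopy_Suc\<close>).  As \<open>e\<close>
  is central, its values are relative cochains: an \<open>h\<close> in \<open>H\<close> may be moved from one argument to the
  next, and it acts through the counit at both ends.  So every cocycle of \<open>A\<close> is cohomologous to a
  relative one (\<open>relative_cocycle\<close>).

  A relative cochain \<open>G\<close> is determined by its restriction to \<open>B\<close>, since
  \<open>G (b\<^sub>1 # h, b\<^sub>2 # k, \<dots>) = G (b\<^sub>1 # 1, h\<^sub>1 b\<^sub>2 # h\<^sub>2 k, \<dots>)\<close> allows all elements of \<open>H\<close> to be pushed to the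
  right.  Conversely this formula, read as a recursion, inflates cochains of \<open>B\<close> to \<open>A\<close>, and inflation
  commutes with the differential on invariant cochains (\<open>inflation_restriction\<close>, \<open>diff_inflation\<close>).
  Restriction therefore induces the isomorphism.  It is injective because a coboundary \<open>\<partial> g\<close> on \<open>B\<close>
  that is an invariant cochain is also \<open>\<partial> (g t)\<close>, and \<open>g t\<close> is invariant and can be inflated; it is
  surjective because an invariant class \<open>[f]\<close> is represented by the invariant cocycle \<open>f t\<close>.  Both
  facts use that \<open>\<partial>\<close> is \<open>H\<close>-linear (\<open>diff_ract\<close>), which holds because the multiplication and the
  augmentation of \<open>B\<close> are.

  Two devices keep the computations short.  Identities between tensors are tested on linear
  functionals, which separate points, so that all Sweedler sums are finite sums of scalars.  And the
  Hochschild differential is rewritten as a recursion on lists (\<open>inner_diff\<close>), so that all identities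
  between cochains are proved by induction on the list of arguments.
\<close>

section \<open>Linear functionals and Sweedler sums\<close>

abbreviation linear_functional :: "('k::field, 'a, 'm) vspace_scheme \<Rightarrow> ('a \<Rightarrow> 'k) \<Rightarrow> bool"
  where "linear_functional V \<equiv> linear_between V (whole (*))"

definition bilinear_form ::
    "('k::field, 'a, 'm) vspace_scheme \<Rightarrow> ('k, 'b, 'n) vspace_scheme \<Rightarrow> ('a \<Rightarrow> 'b \<Rightarrow> 'k) \<Rightarrow> bool"
  where "bilinear_form V W \<beta> \<longleftrightarrow>
    (\<forall>w\<in>car W. linear_functional V (\<lambda>v. \<beta> v w)) \<and> (\<forall>v\<in>car V. linear_functional W (\<beta> v))"

lemma whole_simps [simp]:
  "car (whole s) = UNIV" "vadd (whole s) = (+)" "vzero (whole s) = 0" "vscale (whole s) = s"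
  "car (whole_alg t) = UNIV" "vadd (whole_alg t) = (+)" "vzero (whole_alg t) = 0"
  "vscale (whole_alg t) = t" "amult (whole_alg t) = (*)" "aone (whole_alg t) = 1"
  by (simp_all add: whole_def whole_alg_def)

lemma linear_functional_iff:
  "linear_functional V \<phi> \<longleftrightarrow>
    (\<forall>x\<in>car V. \<forall>y\<in>car V. \<phi> (vadd V x y) = \<phi> x + \<phi> y) \<and>
    (\<forall>c. \<forall>x\<in>car V. \<phi> (vscale V c x) = c * \<phi> x)"
  by (simp add: linear_between_def)

lemma linear_functional_add:
  "linear_functional V \<phi> \<Longrightarrow> x \<in> car V \<Longrightarrow> y \<in> car V \<Longrightarrow> \<phi> (vadd V x y) = \<phi> x + \<phi> y"
  by (simp add: linear_functional_iff)

lemma linear_functional_scale: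
  "linear_functional V \<phi> \<Longrightarrow> x \<in> car V \<Longrightarrow> \<phi> (vscale V c x) = c * \<phi> x"
  by (simp add: linear_functional_iff)

lemma linear_functional_whole_alg: "linear_functional (whole_alg s) = linear_functional (whole s)"
  by (simp add: fun_eq_iff linear_functional_iff)

lemma bilinear_formI:
  "(\<And>w. w \<in> car W \<Longrightarrow> linear_functional V (\<lambda>v. \<beta> v w)) \<Longrightarrow>
   (\<And>v. v \<in> car V \<Longrightarrow> linear_functional W (\<lambda>w. \<beta> v w)) \<Longrightarrow> bilinear_form V W \<beta>"
  by (simp add: bilinear_form_def)

lemma bilinear_formD:
  assumes "bilinear_form V W \<beta>"
  shows "w \<in> car W \<Longrightarrow> linear_functional V (\<lambda>v. \<beta> v w)"
    and "v \<in> car V \<Longrightarrow> linear_functional W (\<lambda>w. \<beta> v w)"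
  using assms by (simp_all add: bilinear_form_def)

lemma linear_functional_sum:
  assumes "\<And>i. i \<in> I \<Longrightarrow> linear_functional V (\<phi> i)"
  shows "linear_functional V (\<lambda>x. \<Sum>i\<in>I. \<phi> i x)"
  using assms by (simp add: linear_functional_iff sum.distrib sum_distrib_left)

lemma linear_functional_diff:
  "linear_functional V \<phi> \<Longrightarrow> linear_functional V \<psi> \<Longrightarrow> linear_functional V (\<lambda>x. \<phi> x - \<psi> x)"
  by (simp add: linear_functional_iff algebra_simps)

lemma linear_functional_plus:
  "linear_functional V \<phi> \<Longrightarrow> linear_functional V \<psi> \<Longrightarrow> linear_functional V (\<lambda>x. \<phi> x + \<psi> x)"
  by (simp add: linear_functional_iff algebra_simps)

lemma linear_functional_cmult:
  "linear_functional V \<phi> \<Longrightarrow> linear_functional V (\<lambda>x. c * \<phi> x)"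
  by (simp add: linear_functional_iff algebra_simps)

lemma linear_functional_multc:
  "linear_functional V \<phi> \<Longrightarrow> linear_functional V (\<lambda>x. \<phi> x * c)"
  by (simp add: linear_functional_iff algebra_simps)

lemma linear_functional_comp:
  "linear_between V W f \<Longrightarrow> linear_functional W \<phi> \<Longrightarrow> linear_functional V (\<lambda>x. \<phi> (f x))"
  by (simp add: linear_between_def)

lemma vector_space_field: "vector_space ((*) :: 'k::field \<Rightarrow> 'k \<Rightarrow> 'k)"
  by unfold_locales (simp_all add: algebra_simps)

text \<open>
  Identities between elements of the algebras below are checked on all linear functionals; that
  this is enough is a consequence of the extension of a basis of a subspace to the whole space.
\<close>

lemma (in vector_space) separating_functional:
  assumes N: "subspace N" and v: "v \<notin> N"
  obtains \<phi> where "linear_functional (whole scale) \<phi>" "\<And>x. x \<in> N \<Longrightarrow> \<phi> x = 0" "\<phi> v = 1"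
proof -
  interpret k: vector_space "(*) :: 'a \<Rightarrow> 'a \<Rightarrow> 'a" by (rule vector_space_field)
  interpret p: vector_space_pair scale "(*) :: 'a \<Rightarrow> 'a \<Rightarrow> 'a" ..
  obtain B where B: "B \<subseteq> N" "independent B" "N \<subseteq> span B"
    using maximal_independent_subset by blast
  have "span B \<subseteq> N" using B(1) N by (rule span_minimal)
  hence "v \<notin> span B" using v by blast
  hence ind: "independent (insert v B)" using B(2) independent_insertI by blast
  obtain g where g: "Vector_Spaces.linear scale (*) g" "\<And>x. x \<in> insert v B \<Longrightarrow> g x = (if x = v then 1 else 0)"
    using p.linear_independent_extend[OF ind, of "\<lambda>x. if x = v then 1 else 0"] by blast
  interpret g: Vector_Spaces.linear scale "(*)" g by (rule g(1))
  have "g x = 0" if "x \<in> B" for x using g(2)[of x] that v B(1) by auto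
  hence "\<And>x. x \<in> span B \<Longrightarrow> g x = 0"
    using p.linear_eq_0_on_span[OF g(1), of B] by blast
  with B(3) have "\<And>x. x \<in> N \<Longrightarrow> g x = 0" by blast
  moreover have "linear_functional (whole scale) g"
    by (simp add: linear_functional_iff g.add g.scale)
  moreover have "g v = 1" using g(2)[of v] by simp
  ultimately show ?thesis using that by blast
qed

lemma (in vector_space) eq_by_functionals:
  assumes "\<And>\<phi>. linear_functional (whole scale) \<phi> \<Longrightarrow> \<phi> x = \<phi> y"
  shows "x = y"
proof (rule ccontr)
  assume "x \<noteq> y"
  then obtain \<phi> where \<phi>: "linear_functional (whole scale) \<phi>" "\<phi> (x - y) = 1"
    using separating_functional[of "{0}" "x - y"] by auto
  have "\<phi> (x - y + y) = \<phi> (x - y) + \<phi> y"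
    using linear_functional_add[OF \<phi>(1), of "x - y" y] by simp
  with \<phi> assms[OF \<phi>(1)] show False by simp
qed

lemma lookup_fscale [simp]: "Poly_Mapping.lookup (fscale c r) x = c * Poly_Mapping.lookup r x"
  by (simp add: fscale_def Poly_Mapping.map.rep_eq when_def)

interpretation free: vector_space "fscale :: 'k::field \<Rightarrow> ('x \<Rightarrow>\<^sub>0 'k) \<Rightarrow> ('x \<Rightarrow>\<^sub>0 'k)"
  by unfold_locales (rule poly_mapping_eqI; simp add: lookup_add algebra_simps)+

context vector_space
begin

lemma flin_superset:
  assumes "finite A" "Poly_Mapping.keys r \<subseteq> A"
  shows "flin scale F r = (\<Sum>p\<in>A. scale (Poly_Mapping.lookup r p) (F p))"
  unfolding flin_def
  by (rule sum.mono_neutral_left) (use assms in \<open>auto simp: in_keys_iff\<close>)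

lemma flin_add: "flin scale F (r + r') = flin scale F r + flin scale F r'"
proof -
  let ?A = "Poly_Mapping.keys r \<union> Poly_Mapping.keys r'"
  have "flin scale F (r + r') = (\<Sum>p\<in>?A. scale (Poly_Mapping.lookup (r + r') p) (F p))"
    by (rule flin_superset) (auto simp: Poly_Mapping.keys_add)
  also have "\<dots> = flin scale F r + flin scale F r'"
    by (subst (1 2) flin_superset[of ?A])
       (auto simp: lookup_add scale_left_distrib sum.distrib)
  finally show ?thesis .
qed

lemma flin_fscale: "flin scale F (fscale c r) = scale c (flin scale F r)"
proof -
  have "flin scale F (fscale c r) =
      (\<Sum>p\<in>Poly_Mapping.keys r. scale (Poly_Mapping.lookup (fscale c r) p) (F p))"
    by (rule flin_superset) (auto simp: in_keys_iff)
  also have "\<dots> = scale c (flin scale F r)"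
    by (simp add: flin_def scale_sum_right)
  finally show ?thesis .
qed

lemma flin_gen [simp]: "flin scale F (gen x) = F x"
  by (simp add: flin_def)

lemma flin_diff: "flin scale F (r - r') = flin scale F r - flin scale F r'"
  using flin_add[of F "r - r'" r'] by simp

end

lemmas flin_field =
  vector_space.flin_add[OF vector_space_field] vector_space.flin_diff[OF vector_space_field]
  vector_space.flin_fscale[OF vector_space_field]

declare vector_space.flin_gen[OF vector_space_field, simp]

lemma linear_functional_flin:
  "linear_functional (whole fscale) (flin (*) F)"
  by (simp add: linear_functional_iff flin_field)

lemma flin_fscale_gen: "flin fscale gen r = r"
proof (rule poly_mapping_eqI)
  fix x
  have "Poly_Mapping.lookup (flin fscale gen r) x =
      (\<Sum>p\<in>Poly_Mapping.keys r. if p = x then Poly_Mapping.lookup r p else 0)"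
    by (simp add: flin_def Poly_Mapping.lookup_sum lookup_single when_def if_distrib cong: if_cong)
  thus "Poly_Mapping.lookup (flin fscale gen r) x = Poly_Mapping.lookup r x"
    by (simp add: in_keys_iff)
qed

lemma functional_flin:
  assumes "vector_space s" and \<phi>: "linear_functional (whole s) \<phi>"
  shows "\<phi> (flin s F r) = flin (*) (\<lambda>p. \<phi> (F p)) r"
proof -
  interpret vector_space s by fact
  interpret l: Vector_Spaces.linear s "(*)" \<phi>
    by unfold_locales (use \<phi> in \<open>simp_all add: linear_functional_iff algebra_simps\<close>)
  show ?thesis by (simp add: flin_def l.sum l.scale)
qed

lemma functional_sweedler:
  assumes "vector_space s" "linear_functional (whole s) \<phi>"
  shows "\<phi> (sweedler s X \<beta>) = sweedler (*) X (\<lambda>x y. \<phi> (\<beta> x y))"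
  unfolding sweedler_def by (subst functional_flin[OF assms]) (simp add: case_prod_unfold)

lemma flin_flin:
  "flin (*) F (flin fscale G r) = flin (*) (\<lambda>p. flin (*) F (G p)) r"
  by (rule functional_flin[OF free.vector_space_axioms linear_functional_flin])

lemma flin_fsweedler:
  "flin (*) F (fsweedler X \<beta>) = sweedler (*) X (\<lambda>x y. flin (*) F (\<beta> x y))"
  by (rule functional_sweedler[OF free.vector_space_axioms linear_functional_flin])

text \<open>
  Scalar Sweedler sums are ordinary finite sums, so they commute with all finite sums without any
  linearity assumption.
\<close>

lemma sweedler_eq_sum:
  "sweedler (*) X \<beta> =
    (\<Sum>p\<in>Poly_Mapping.keys (SOME r. r \<in> X).
       Poly_Mapping.lookup (SOME r. r \<in> X) p * \<beta> (fst p) (snd p))"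
  by (simp add: sweedler_def flin_def case_prod_unfold)

lemma sweedler_add:
  "sweedler (*) X (\<lambda>x y. \<beta> x y + \<gamma> x y) = sweedler (*) X \<beta> + sweedler (*) X \<gamma>"
  by (simp add: sweedler_eq_sum distrib_left sum.distrib)

lemma sweedler_diff:
  "sweedler (*) X (\<lambda>x y. \<beta> x y - \<gamma> x y) = sweedler (*) X \<beta> - sweedler (*) X \<gamma>"
  by (simp add: sweedler_eq_sum right_diff_distrib sum_subtractf)

lemma sweedler_cmult: "sweedler (*) X (\<lambda>x y. c * \<beta> x y) = c * sweedler (*) X \<beta>"
  unfolding sweedler_eq_sum sum_distrib_left by (rule sum.cong) (simp_all only: mult.left_commute)

lemma sweedler_multc: "sweedler (*) X (\<lambda>x y. \<beta> x y * c) = sweedler (*) X \<beta> * c"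
  unfolding sweedler_eq_sum sum_distrib_right by (rule sum.cong) (simp_all only: mult.assoc)

lemma sweedler_sum:
  "sweedler (*) X (\<lambda>x y. \<Sum>i\<in>I. \<beta> i x y) = (\<Sum>i\<in>I. sweedler (*) X (\<beta> i))"
  unfolding sweedler_eq_sum sum_distrib_left by (rule sum.swap)

lemma sweedler_swap:
  "sweedler (*) X (\<lambda>x y. sweedler (*) Y (\<lambda>z w. \<beta> x y z w)) =
   sweedler (*) Y (\<lambda>z w. sweedler (*) X (\<lambda>x y. \<beta> x y z w))"
  by (simp only: sweedler_eq_sum[of Y] sweedler_sum sweedler_cmult)

lemma linear_functional_sweedler:
  assumes "\<And>x y. linear_functional V (\<phi> x y)"
  shows "linear_functional V (\<lambda>v. sweedler (*) X (\<lambda>x y. \<phi> x y v))"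
  unfolding sweedler_eq_sum
  by (intro linear_functional_sum linear_functional_cmult assms)

section \<open>Tensor products\<close>

lemma coset_self: "(0::'v::ab_group_add) \<in> N \<Longrightarrow> x \<in> coset N x"
  by (auto simp: coset_def image_iff intro: bexI[of _ 0])

lemma mem_coset: "y \<in> coset N x \<longleftrightarrow> y - x \<in> N"
  by (auto simp: coset_def image_iff algebra_simps intro: bexI[of _ "y - x"])

lemma (in module) coset_eq_iff:
  assumes "subspace N"
  shows "coset N x = coset N y \<longleftrightarrow> x - y \<in> N"
proof
  assume "coset N x = coset N y"
  with coset_self[OF subspace_0[OF assms], of x] have "x \<in> coset N y" by simp
  thus "x - y \<in> N" by (simp add: mem_coset)
next
  assume xy: "x - y \<in> N"
  have "z \<in> coset N x \<longleftrightarrow> z \<in> coset N y" for z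
  proof -
    have "z - y = (z - x) + (x - y)" "z - x = (z - y) - (x - y)" by (simp_all add: algebra_simps)
    thus ?thesis using xy subspace_add[OF assms] subspace_diff[OF assms]
      unfolding mem_coset by metis
  qed
  thus "coset N x = coset N y" by blast
qed

lemma (in module) induced_coset:
  assumes N: "subspace N" and x: "X = coset M x" "0 \<in> M"
    and \<phi>: "\<And>y. y \<in> X \<Longrightarrow> \<phi> y - \<phi> x \<in> N"
  shows "induced N \<phi> X = coset N (\<phi> x)"
proof -
  have "\<And>y. y \<in> X \<Longrightarrow> coset N (\<phi> y) = coset N (\<phi> x)"
    using \<phi> coset_eq_iff[OF N] by blast
  moreover have "x \<in> X" using x coset_self by blast
  ultimately show ?thesis unfolding induced_def by blast
qed

lemma (in module) induced2_coset:
  assumes N: "subspace N" and x: "X = coset M x" "0 \<in> M" and y: "Y = coset M' y" "0 \<in> M'"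
    and \<phi>: "\<And>x' y'. x' \<in> X \<Longrightarrow> y' \<in> Y \<Longrightarrow> \<phi> x' y' - \<phi> x y \<in> N"
  shows "induced2 N \<phi> X Y = coset N (\<phi> x y)"
proof -
  have "\<And>x' y'. x' \<in> X \<Longrightarrow> y' \<in> Y \<Longrightarrow> coset N (\<phi> x' y') = coset N (\<phi> x y)"
    using \<phi> coset_eq_iff[OF N] by blast
  moreover have "x \<in> X" "y \<in> Y" using x y coset_self by blast+
  ultimately show ?thesis unfolding induced2_def by blast
qed

lemma subspace_tensor_rel: "free.subspace (tensor_rel V W)"
  by (simp add: tensor_rel_def)

lemma zero_tensor_rel: "0 \<in> tensor_rel V W"
  by (rule free.subspace_0[OF subspace_tensor_rel])

lemma tclass_eq_iff: "tclass V W r = tclass V W r' \<longleftrightarrow> r - r' \<in> tensor_rel V W"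
  unfolding tclass_def by (rule free.coset_eq_iff[OF subspace_tensor_rel])

lemma bilinear_form_vanishes:
  assumes \<beta>: "bilinear_form V W \<beta>" and r: "r \<in> tensor_rel V W"
  shows "flin (*) (\<lambda>(v, w). \<beta> v w) r = 0"
proof -
  let ?L = "flin (*) (\<lambda>(v, w). \<beta> v w)"
  have "?L 0 = 0" by (simp add: flin_def)
  hence "free.subspace {r. ?L r = 0}"
    by (simp add: free.subspace_def flin_field)
  moreover have "bilinear_relations V W \<subseteq> {r. ?L r = 0}"
    using bilinear_formD[OF \<beta>]
    by (auto simp: bilinear_relations_def flin_field linear_functional_iff)
  ultimately have "tensor_rel V W \<subseteq> {r. ?L r = 0}"
    unfolding tensor_rel_def by (rule free.span_minimal[rotated])
  with r show ?thesis by blast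
qed

lemma sweedler_tclass:
  assumes \<beta>: "bilinear_form V W \<beta>"
  shows "sweedler (*) (tclass V W r) \<beta> = flin (*) (\<lambda>(v, w). \<beta> v w) r"
proof -
  let ?X = "tclass V W r"
  have "r \<in> ?X" unfolding tclass_def
    by (rule coset_self[OF zero_tensor_rel])
  hence "(SOME r. r \<in> ?X) \<in> ?X" by (rule someI)
  hence "(SOME r. r \<in> ?X) - r \<in> tensor_rel V W" by (simp add: tclass_def mem_coset)
  from bilinear_form_vanishes[OF \<beta> this] show ?thesis
    by (simp add: sweedler_def flin_field)
qed

lemma sweedler_pure_tensor:
  "bilinear_form V W \<beta> \<Longrightarrow> sweedler (*) (pure_tensor V W v w) \<beta> = \<beta> v w"
  by (simp add: pure_tensor_def sweedler_tclass)

lemma car_tensor: "X \<in> car (tensor V W) \<Longrightarrow> \<exists>r. X = tclass V W r"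
  by (auto simp: tensor_def quotient_space_def tclass_def)

lemma car_tensor_whole: "car (tensor (whole s) (whole t)) = range (tclass (whole s) (whole t))"
  by (auto simp: tensor_def quotient_space_def tclass_def)

lemma pure_tensor_in_car:
  "v \<in> car V \<Longrightarrow> w \<in> car W \<Longrightarrow> pure_tensor V W v w \<in> car (tensor V W)"
  by (auto simp: tensor_def quotient_space_def pure_tensor_def tclass_def)

lemma vadd_tclass: "vadd (tensor V W) (tclass V W r) (tclass V W r') = tclass V W (r + r')"
proof -
  have "induced2 (tensor_rel V W) (+) (tclass V W r) (tclass V W r') = tclass V W (r + r')"
    unfolding tclass_def
  proof (rule free.induced2_coset[OF subspace_tensor_rel refl zero_tensor_rel refl zero_tensor_rel])
    fix x y assume "x \<in> coset (tensor_rel V W) r" "y \<in> coset (tensor_rel V W) r'"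
    hence "(x - r) + (y - r') \<in> tensor_rel V W"
      unfolding mem_coset by (rule free.subspace_add[OF subspace_tensor_rel])
    thus "x + y - (r + r') \<in> tensor_rel V W" by (simp add: algebra_simps)
  qed
  thus ?thesis by (simp add: tensor_def quotient_space_def)
qed

lemma vscale_tclass: "vscale (tensor V W) c (tclass V W r) = tclass V W (fscale c r)"
proof -
  have "induced (tensor_rel V W) (fscale c) (tclass V W r) = tclass V W (fscale c r)"
    unfolding tclass_def
  proof (rule free.induced_coset[OF subspace_tensor_rel refl zero_tensor_rel])
    fix x assume "x \<in> coset (tensor_rel V W) r"
    hence "fscale c (x - r) \<in> tensor_rel V W"
      unfolding mem_coset by (rule free.subspace_scale[OF subspace_tensor_rel])
    thus "fscale c x - fscale c r \<in> tensor_rel V W" by (simp add: free.scale_right_diff_distrib)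
  qed
  thus ?thesis by (simp add: tensor_def quotient_space_def)
qed

lemma linear_functional_sweedler_tensor:
  assumes "bilinear_form V W \<beta>"
  shows "linear_functional (tensor V W) (\<lambda>X. sweedler (*) X \<beta>)"
  by (auto simp: linear_functional_iff dest!: car_tensor
      simp: vadd_tclass vscale_tclass sweedler_tclass[OF assms]
        flin_field)

lemma bilinear_form_pure_tensor:
  assumes "linear_functional (tensor V W) \<phi>"
  shows "bilinear_form V W (\<lambda>v w. \<phi> (pure_tensor V W v w))"
proof -
  let ?p = "pure_tensor V W"
  have rel: "r \<in> bilinear_relations V W \<Longrightarrow> r \<in> tensor_rel V W" for r
    unfolding tensor_rel_def by (rule free.span_base)
  have "?p (vadd V v v') w = vadd (tensor V W) (?p v w) (?p v' w)"
    if "v \<in> car V" "v' \<in> car V" "w \<in> car W" for v v' w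
    unfolding pure_tensor_def vadd_tclass tclass_eq_iff
    by (rule rel) (use that in \<open>force simp: bilinear_relations_def algebra_simps\<close>)
  moreover have "?p v (vadd W w w') = vadd (tensor V W) (?p v w) (?p v w')"
    if "v \<in> car V" "w \<in> car W" "w' \<in> car W" for v w w'
    unfolding pure_tensor_def vadd_tclass tclass_eq_iff
    by (rule rel) (use that in \<open>force simp: bilinear_relations_def algebra_simps\<close>)
  moreover have "?p (vscale V c v) w = vscale (tensor V W) c (?p v w)"
    if "v \<in> car V" "w \<in> car W" for c v w
    unfolding pure_tensor_def vscale_tclass tclass_eq_iff
    by (rule rel) (use that in \<open>force simp: bilinear_relations_def\<close>)
  moreover have "?p v (vscale W c w) = vscale (tensor V W) c (?p v w)"
    if "v \<in> car V" "w \<in> car W" for c v w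
    unfolding pure_tensor_def vscale_tclass tclass_eq_iff
    by (rule rel) (use that in \<open>force simp: bilinear_relations_def\<close>)
  ultimately show ?thesis
    using assms by (simp add: bilinear_form_def linear_functional_iff pure_tensor_in_car)
qed

text \<open>
  A tensor over two full vector spaces is a sum of pure tensors, so a functional is the Sweedler
  sum of its values on them.
\<close>

lemma functional_eq_sweedler:
  assumes \<phi>: "linear_functional (tensor (whole s) (whole t)) \<phi>"
    and X: "X \<in> car (tensor (whole s) (whole t))"
  shows "\<phi> X = sweedler (*) X (\<lambda>v w. \<phi> (pure_tensor (whole s) (whole t) v w))"
proof -
  let ?V = "whole s" and ?W = "whole t"
  obtain r where r: "X = tclass ?V ?W r" using X by (auto dest: car_tensor)
  have lin: "linear_functional (whole fscale) (\<lambda>r. \<phi> (tclass ?V ?W r))"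
    using \<phi> by (simp add: linear_functional_iff car_tensor_whole vadd_tclass[symmetric]
        vscale_tclass[symmetric])
  have "\<phi> X = \<phi> (tclass ?V ?W (flin fscale gen r))" by (simp add: r flin_fscale_gen)
  also have "\<dots> = flin (*) (\<lambda>p. \<phi> (tclass ?V ?W (gen p))) r"
    by (rule functional_flin[OF free.vector_space_axioms lin])
  also have "\<dots> = sweedler (*) X (\<lambda>v w. \<phi> (pure_tensor ?V ?W v w))"
    unfolding r sweedler_tclass[OF bilinear_form_pure_tensor[OF \<phi>]]
    by (simp add: pure_tensor_def case_prod_unfold)
  finally show ?thesis .
qed

lemma eq_by_tensor_functionals:
  assumes X: "X \<in> car (tensor (whole s) (whole t))" and Y: "Y \<in> car (tensor (whole s) (whole t))"
    and eq: "\<And>\<phi>. linear_functional (tensor (whole s) (whole t)) \<phi> \<Longrightarrow> \<phi> X = \<phi> Y"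
  shows "X = Y"
proof (rule ccontr)
  let ?V = "whole s" and ?W = "whole t"
  assume "X \<noteq> Y"
  obtain r r' where r: "X = tclass ?V ?W r" "Y = tclass ?V ?W r'"
    using X Y by (auto dest!: car_tensor)
  with \<open>X \<noteq> Y\<close> have "r - r' \<notin> tensor_rel ?V ?W" by (simp add: tclass_eq_iff)
  then obtain \<psi> where \<psi>: "linear_functional (whole fscale) \<psi>"
      "\<And>x. x \<in> tensor_rel ?V ?W \<Longrightarrow> \<psi> x = 0" "\<psi> (r - r') = 1"
    using free.separating_functional[OF subspace_tensor_rel] by metis
  define \<phi> where "\<phi> = (\<lambda>X. \<psi> (SOME r. r \<in> X))"
  have add: "\<psi> (x + y) = \<psi> x + \<psi> y" for x y
    using linear_functional_add[OF \<psi>(1)] by simp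
  have \<phi>: "\<phi> (tclass ?V ?W q) = \<psi> q" for q
  proof -
    let ?Q = "tclass ?V ?W q"
    have "q \<in> ?Q" unfolding tclass_def
      by (rule coset_self[OF zero_tensor_rel])
    hence "(SOME r. r \<in> ?Q) \<in> ?Q" by (rule someI)
    hence "(SOME r. r \<in> ?Q) - q \<in> tensor_rel ?V ?W" by (simp add: tclass_def mem_coset)
    hence "\<psi> ((SOME r. r \<in> ?Q) - q) = 0" by (rule \<psi>(2))
    with add[of "(SOME r. r \<in> ?Q) - q" q] show ?thesis by (simp add: \<phi>_def)
  qed
  have "linear_functional (tensor ?V ?W) \<phi>"
    using \<psi>(1) by (auto simp: linear_functional_iff car_tensor_whole vadd_tclass vscale_tclass \<phi>)
  from eq[OF this] have "\<psi> r = \<psi> r'" by (simp add: r \<phi>)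
  with add[of "r - r'" r'] \<psi>(3) show False by simp
qed

lemma functional_tclass:
  assumes \<phi>: "linear_functional (tensor (whole s) (whole t)) \<phi>"
  shows "\<phi> (tclass (whole s) (whole t) r) =
    flin (*) (\<lambda>(v, w). \<phi> (pure_tensor (whole s) (whole t) v w)) r"
  using functional_eq_sweedler[OF \<phi>, of "tclass (whole s) (whole t) r"]
  by (simp add: car_tensor_whole sweedler_tclass[OF bilinear_form_pure_tensor[OF \<phi>]])

lemma tensor_relI:
  assumes "\<And>\<beta>. bilinear_form (whole s) (whole t) \<beta> \<Longrightarrow> flin (*) (\<lambda>(v, w). \<beta> v w) r = 0"
  shows "r \<in> tensor_rel (whole s) (whole t)"
proof -
  have "tclass (whole s) (whole t) r = tclass (whole s) (whole t) 0"
    by (rule eq_by_tensor_functionals[where s = s and t = t])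
       (simp_all add: car_tensor_whole functional_tclass assms bilinear_form_pure_tensor flin_def[of _ _ 0])
  thus ?thesis by (simp add: tclass_eq_iff)
qed

lemma functional_ext:
  assumes "linear_functional (tensor (whole s) (whole t)) \<phi>"
    and "linear_functional (tensor (whole s) (whole t)) \<psi>"
    and "\<And>v w. \<phi> (pure_tensor (whole s) (whole t) v w) = \<psi> (pure_tensor (whole s) (whole t) v w)"
    and "X \<in> car (tensor (whole s) (whole t))"
  shows "\<phi> X = \<psi> X"
  using assms(4) by (auto simp: car_tensor_whole functional_tclass assms(1-3))

section \<open>Separability of a semisimple Hopf algebra\<close>

context k_coalgebra
begin

text \<open>
  The axioms are equalities of classes of formal sums.  Applying a multilinear form to both sides
  turns them into the identities between scalar Sweedler sums used from here on.
\<close>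

lemma comult_functional:
  "bilinear_form (whole s) (whole s) \<beta> \<Longrightarrow> linear_functional (whole s) (\<lambda>x. sweedler (*) (\<Delta> x) \<beta>)"
  by (rule linear_functional_comp[OF comult_linear linear_functional_sweedler_tensor])

lemma coassoc_functional:
  assumes 1: "\<And>y z. linear_functional (whole s) (\<lambda>x. \<gamma> x y z)"
    and 2: "\<And>x z. linear_functional (whole s) (\<lambda>y. \<gamma> x y z)"
    and 3: "\<And>x y. linear_functional (whole s) (\<lambda>z. \<gamma> x y z)"
  shows "sweedler (*) (\<Delta> x) (\<lambda>x1 x2. sweedler (*) (\<Delta> x1) (\<lambda>a b. \<gamma> a b x2)) =
    sweedler (*) (\<Delta> x) (\<lambda>x1 x2. sweedler (*) (\<Delta> x2) (\<lambda>a b. \<gamma> x1 a b))"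
proof -
  let ?H = "whole s" and ?HH = "tensor (whole s) (whole s)"
  let ?G = "\<lambda>X z. sweedler (*) X (\<lambda>a b. \<gamma> a b z)"
  have \<gamma>: "bilinear_form ?H ?H (\<lambda>a b. \<gamma> a b z)" for z
    by (intro bilinear_formI 1 2)
  have G: "bilinear_form ?HH ?H ?G"
    by (intro bilinear_formI linear_functional_sweedler_tensor \<gamma> linear_functional_sweedler 3)
  from coassoc[of x, THEN arg_cong[of _ _ "\<lambda>X. sweedler (*) X ?G"]]
  show ?thesis
    by (simp add: sweedler_tclass[OF G] flin_fsweedler sweedler_pure_tensor[OF \<gamma>])
qed

lemma counit_left_functional:
  assumes "linear_functional (whole s) \<phi>"
  shows "sweedler (*) (\<Delta> x) (\<lambda>x1 x2. \<epsilon> x1 * \<phi> x2) = \<phi> x"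
proof -
  have "\<phi> (sweedler s (\<Delta> x) (\<lambda>x1 x2. s (\<epsilon> x1) x2)) = \<phi> x" by (simp only: counit_left)
  thus ?thesis
    using assms by (simp add: functional_sweedler[OF vector_space_axioms] linear_functional_iff)
qed

lemma counit_right_functional:
  assumes "linear_functional (whole s) \<phi>"
  shows "sweedler (*) (\<Delta> x) (\<lambda>x1 x2. \<epsilon> x2 * \<phi> x1) = \<phi> x"
proof -
  have "\<phi> (sweedler s (\<Delta> x) (\<lambda>x1 x2. s (\<epsilon> x2) x1)) = \<phi> x" by (simp only: counit_right)
  thus ?thesis
    using assms by (simp add: functional_sweedler[OF vector_space_axioms] linear_functional_iff)
qed

lemma counit_add: "\<epsilon> (x + y) = \<epsilon> x + \<epsilon> y" and counit_scale: "\<epsilon> (s c x) = c * \<epsilon> x"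
  using counit_linear by (simp_all add: linear_functional_iff)

lemma counit_diff: "\<epsilon> (x - y) = \<epsilon> x - \<epsilon> y"
  using counit_add[of "x - y" y] by simp

end

context k_algebra
begin

lemma functional_mult_left: "linear_functional (whole s) \<phi> \<Longrightarrow> linear_functional (whole s) (\<lambda>x. \<phi> (a * x))"
  by (simp add: linear_functional_iff distrib_left scale_mult_right)

lemma functional_mult_right: "linear_functional (whole s) \<phi> \<Longrightarrow> linear_functional (whole s) (\<lambda>x. \<phi> (x * a))"
  by (simp add: linear_functional_iff distrib_right scale_mult_left)

end

context k_bialgebra
begin

lemma comult_mult_functional:
  assumes "bilinear_form (whole s) (whole s) \<beta>"
  shows "sweedler (*) (\<Delta> (x * y)) \<beta> =
    sweedler (*) (\<Delta> x) (\<lambda>x1 x2. sweedler (*) (\<Delta> y) (\<lambda>y1 y2. \<beta> (x1 * y1) (x2 * y2)))"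
  by (simp add: comult_mult sweedler_tclass[OF assms] flin_fsweedler)

lemma comult_one_functional:
  "bilinear_form (whole s) (whole s) \<beta> \<Longrightarrow> sweedler (*) (\<Delta> 1) \<beta> = \<beta> 1 1"
  by (simp add: comult_one sweedler_pure_tensor)

end

context hopf_algebra
begin

lemma antipode_add: "S (x + y) = S x + S y" and antipode_scale: "S (s c x) = s c (S x)"
  using antipode_linear by (simp_all add: linear_between_def)

lemma functional_antipode:
  "linear_functional (whole s) \<phi> \<Longrightarrow> linear_functional (whole s) (\<lambda>x. \<phi> (S x))"
  by (rule linear_functional_comp[OF antipode_linear])

lemma antipode_left_functional:
  assumes "linear_functional (whole s) \<phi>"
  shows "sweedler (*) (\<Delta> x) (\<lambda>x1 x2. \<phi> (S x1 * x2)) = \<epsilon> x * \<phi> 1"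
proof -
  have "\<phi> (sweedler s (\<Delta> x) (\<lambda>x1 x2. S x1 * x2)) = \<phi> (s (\<epsilon> x) 1)" by (simp only: antipode_left)
  thus ?thesis
    using assms by (simp add: functional_sweedler[OF vector_space_axioms] linear_functional_iff)
qed

lemma antipode_right_functional:
  assumes "linear_functional (whole s) \<phi>"
  shows "sweedler (*) (\<Delta> x) (\<lambda>x1 x2. \<phi> (x1 * S x2)) = \<epsilon> x * \<phi> 1"
proof -
  have "\<phi> (sweedler s (\<Delta> x) (\<lambda>x1 x2. x1 * S x2)) = \<phi> (s (\<epsilon> x) 1)" by (simp only: antipode_right)
  thus ?thesis
    using assms by (simp add: functional_sweedler[OF vector_space_axioms] linear_functional_iff)
qed

lemmas algebra_linear_simps =
  linear_functional_iff distrib_left distrib_right scale_mult_left scale_mult_right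
  antipode_add antipode_scale counit_add counit_scale sweedler_add sweedler_cmult

text \<open>
  Both \<open>x \<otimes> y \<mapsto> S y * S x\<close> and \<open>x \<otimes> y \<mapsto> S (x * y)\<close> are convolution inverses of the
  multiplication, hence equal: \<open>T\<close> below is the integrand of the triple convolution of the first, the
  multiplication and the second, which is bracketed in both ways.
\<close>

lemma antipode_antimult: "S (x * y) = S y * S x"
proof (rule eq_by_functionals)
  fix \<phi> assume \<phi>: "linear_functional (whole s) \<phi>"
  have lin: "linear_functional (whole s) (\<lambda>u. \<phi> (S (u * w)))"
    "linear_functional (whole s) (\<lambda>u. \<phi> (S (w * u)))"
    "linear_functional (whole s) (\<lambda>u. \<phi> (S u * S w))"
    "linear_functional (whole s) (\<lambda>u. \<phi> (S w * S u))" for w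
    using \<phi> by (simp_all add: algebra_linear_simps)
  let ?T = "\<lambda>x1 x2 x3 y1 y2 y3. \<phi> (S y1 * S x1 * (x2 * y2) * S (x3 * y3))"
  have lT: "linear_functional (whole s) (\<lambda>u. ?T u b c d e f)"
    "linear_functional (whole s) (\<lambda>u. ?T a u c d e f)"
    "linear_functional (whole s) (\<lambda>u. ?T a b u d e f)"
    "linear_functional (whole s) (\<lambda>u. ?T a b c u e f)"
    "linear_functional (whole s) (\<lambda>u. ?T a b c d u f)"
    "linear_functional (whole s) (\<lambda>u. ?T a b c d e u)" for a b c d e f
    using \<phi> by (simp_all add: algebra_linear_simps)
  have inner: "sweedler (*) (\<Delta> x1) (\<lambda>a b. sweedler (*) (\<Delta> y1) (\<lambda>c d. ?T a b x2 c d y2))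
      = \<epsilon> x1 * (\<epsilon> y1 * \<phi> (S (x2 * y2)))" for x1 x2 y1 y2
  proof -
    have "sweedler (*) (\<Delta> x1) (\<lambda>a b. sweedler (*) (\<Delta> y1) (\<lambda>c d. ?T a b x2 c d y2)) =
      sweedler (*) (\<Delta> y1) (\<lambda>c d. sweedler (*) (\<Delta> x1) (\<lambda>a b. \<phi> (S c * (S a * b) * d * S (x2 * y2))))"
      by (subst sweedler_swap) (simp add: mult.assoc)
    also have "\<dots> = sweedler (*) (\<Delta> y1) (\<lambda>c d. \<epsilon> x1 * \<phi> (S c * 1 * d * S (x2 * y2)))"
      by (subst antipode_left_functional[where \<phi> = "\<lambda>u. \<phi> (S _ * u * _ * S (x2 * y2))"])
         (use \<phi> in \<open>simp_all add: algebra_linear_simps\<close>)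
    also have "\<dots> = \<epsilon> x1 * sweedler (*) (\<Delta> y1) (\<lambda>c d. \<phi> ((S c * d) * S (x2 * y2)))"
      by (simp add: sweedler_cmult)
    also have "\<dots> = \<epsilon> x1 * (\<epsilon> y1 * \<phi> (1 * S (x2 * y2)))"
      by (subst antipode_left_functional[where \<phi> = "\<lambda>u. \<phi> (u * S (x2 * y2))"])
         (use \<phi> in \<open>simp_all add: algebra_linear_simps\<close>)
    finally show ?thesis by simp
  qed
  have inner': "sweedler (*) (\<Delta> x2) (\<lambda>b c. sweedler (*) (\<Delta> y2) (\<lambda>e f. ?T x1 b c y1 e f))
      = \<epsilon> x2 * (\<epsilon> y2 * \<phi> (S y1 * S x1))" for x1 x2 y1 y2
  proof -
    have "sweedler (*) (\<Delta> x2) (\<lambda>b c. sweedler (*) (\<Delta> y2) (\<lambda>e f. ?T x1 b c y1 e f)) =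
      sweedler (*) (\<Delta> (x2 * y2)) (\<lambda>u v. \<phi> (S y1 * S x1 * u * S v))"
      by (rule comult_mult_functional[symmetric])
         (use \<phi> in \<open>simp add: bilinear_form_def algebra_linear_simps\<close>)
    also have "\<dots> = \<epsilon> (x2 * y2) * \<phi> (S y1 * S x1 * 1)"
      using antipode_right_functional[OF functional_mult_left[OF \<phi>, of "S y1 * S x1"], of "x2 * y2"]
      by (simp add: mult.assoc)
    finally show ?thesis by (simp add: counit_mult)
  qed
  let ?X = "\<lambda>\<beta>. sweedler (*) (\<Delta> x) \<beta>" and ?Y = "\<lambda>\<beta>. sweedler (*) (\<Delta> y) \<beta>"
  have "\<phi> (S (x * y)) = ?X (\<lambda>x1 x2. \<epsilon> x1 * ?Y (\<lambda>y1 y2. \<epsilon> y1 * \<phi> (S (x2 * y2))))"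
    by (simp add: counit_left_functional lin)
  also have "\<dots> = ?X (\<lambda>x1 x2. ?Y (\<lambda>y1 y2. sweedler (*) (\<Delta> x1) (\<lambda>a b.
      sweedler (*) (\<Delta> y1) (\<lambda>c d. ?T a b x2 c d y2))))"
    by (simp only: inner sweedler_cmult)
  also have "\<dots> = ?X (\<lambda>x1 x2. sweedler (*) (\<Delta> x1) (\<lambda>a b. ?Y (\<lambda>y1 y2.
      sweedler (*) (\<Delta> y1) (\<lambda>c d. ?T a b x2 c d y2))))"
    by (simp only: sweedler_swap[of "\<Delta> y"])
  also have "\<dots> = ?X (\<lambda>x1 x2. sweedler (*) (\<Delta> x2) (\<lambda>b c. ?Y (\<lambda>y1 y2.
      sweedler (*) (\<Delta> y1) (\<lambda>d e. ?T x1 b c d e y2))))"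
    by (rule coassoc_functional; intro linear_functional_sweedler lT)
  also have "\<dots> = ?X (\<lambda>x1 x2. sweedler (*) (\<Delta> x2) (\<lambda>b c. ?Y (\<lambda>y1 y2.
      sweedler (*) (\<Delta> y2) (\<lambda>e f. ?T x1 b c y1 e f))))"
    by (subst coassoc_functional) (rule lT refl)+
  also have "\<dots> = ?X (\<lambda>x1 x2. ?Y (\<lambda>y1 y2. sweedler (*) (\<Delta> x2) (\<lambda>b c.
      sweedler (*) (\<Delta> y2) (\<lambda>e f. ?T x1 b c y1 e f))))"
    by (simp only: sweedler_swap[of "\<Delta> y"])
  also have "\<dots> = ?X (\<lambda>x1 x2. \<epsilon> x2 * ?Y (\<lambda>y1 y2. \<epsilon> y2 * \<phi> (S y1 * S x1)))"
    by (simp only: inner' sweedler_cmult)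
  also have "\<dots> = \<phi> (S y * S x)"
    by (simp add: counit_right_functional lin)
  finally show "\<phi> (S (x * y)) = \<phi> (S y * S x)" .
qed

lemma counit_antipode: "\<epsilon> (S x) = \<epsilon> x"
proof -
  have "\<epsilon> x = sweedler (*) (\<Delta> x) (\<lambda>x1 x2. \<epsilon> (S x1 * x2))"
    by (simp add: antipode_left_functional[OF counit_linear] counit_one)
  also have "\<dots> = sweedler (*) (\<Delta> x) (\<lambda>x1 x2. \<epsilon> x2 * \<epsilon> (S x1))"
    by (simp add: counit_mult mult.commute)
  also have "\<dots> = \<epsilon> (S x)"
    by (rule counit_right_functional[OF functional_antipode[OF counit_linear]])
  finally show ?thesis by simp
qed

text \<open>
  Maschke's argument: a left ideal \<open>J\<close> complementary to the kernel of the counit consists of integrals,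
  as \<open>h x - \<epsilon>(h) x\<close> lies in both for \<open>x \<in> J\<close>.
\<close>

lemma semisimple_integral:
  assumes "semisimple_ring TYPE('a)"
  obtains \<Lambda> where "\<And>h. h * \<Lambda> = s (\<epsilon> h) \<Lambda>" "\<epsilon> \<Lambda> = 1"
proof -
  let ?I = "{x. \<epsilon> x = 0}"
  have \<epsilon>0: "\<epsilon> 0 = 0" using counit_scale[of 0 0] by simp
  hence "left_ideal ?I" by (simp add: left_ideal_def counit_add counit_mult)
  from assms[unfolded semisimple_ring_def, rule_format, OF this] obtain J where J: "left_ideal J" "?I \<inter> J = {0}"
      "\<And>x. \<exists>i\<in>?I. \<exists>j\<in>J. x = i + j"
    by metis
  from J(3)[of 1] obtain i \<Lambda> where \<Lambda>: "\<epsilon> i = 0" "\<Lambda> \<in> J" "1 = i + \<Lambda>" by blast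
  have \<epsilon>\<Lambda>: "\<epsilon> \<Lambda> = 1" using counit_add[of i \<Lambda>] \<Lambda> counit_one by simp
  have "h * \<Lambda> = s (\<epsilon> h) \<Lambda>" for h
  proof -
    have "s (\<epsilon> h) \<Lambda> = s (\<epsilon> h) 1 * \<Lambda>" by (simp add: scale_mult_left)
    hence *: "h * \<Lambda> - s (\<epsilon> h) \<Lambda> = (h - s (\<epsilon> h) 1) * \<Lambda>" by (simp add: left_diff_distrib)
    hence "h * \<Lambda> - s (\<epsilon> h) \<Lambda> \<in> J" using J(1) \<Lambda>(2) by (simp add: left_ideal_def)
    moreover have "\<epsilon> (h * \<Lambda> - s (\<epsilon> h) \<Lambda>) = 0"
      by (simp add: counit_diff counit_mult counit_scale \<epsilon>\<Lambda>)
    ultimately have "h * \<Lambda> - s (\<epsilon> h) \<Lambda> \<in> ?I \<inter> J" by simp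
    thus ?thesis using J(2) by simp
  qed
  with \<epsilon>\<Lambda> show ?thesis using that by blast
qed

text \<open>
  In tensors, the computation is
  \<open>\<Lambda>\<^sub>1 \<otimes> S \<Lambda>\<^sub>2 h = (h\<^sub>1 \<Lambda>)\<^sub>1 \<otimes> S ((h\<^sub>1 \<Lambda>)\<^sub>2) h\<^sub>2 = h\<^sub>1 \<Lambda>\<^sub>1 \<otimes> S \<Lambda>\<^sub>2 S h\<^sub>2 h\<^sub>3 = h \<Lambda>\<^sub>1 \<otimes> S \<Lambda>\<^sub>2\<close>.
\<close>

lemma integral_central:
  assumes \<Lambda>: "\<And>h. h * \<Lambda> = s (\<epsilon> h) \<Lambda>" and \<beta>: "bilinear_form (whole s) (whole s) \<beta>"
  shows "sweedler (*) (\<Delta> \<Lambda>) (\<lambda>x y. \<beta> (h * x) (S y)) =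
    sweedler (*) (\<Delta> \<Lambda>) (\<lambda>x y. \<beta> x (S y * h))"
proof -
  let ?L = "\<lambda>\<beta>. sweedler (*) (\<Delta> \<Lambda>) \<beta>"
  have "?L (\<lambda>x y. \<beta> x (S y * h)) =
      sweedler (*) (\<Delta> h) (\<lambda>h1 h2. \<epsilon> h1 * ?L (\<lambda>x y. \<beta> x (S y * h2)))"
    by (rule counit_left_functional[symmetric])
       (use \<beta> in \<open>simp add: bilinear_form_def algebra_linear_simps\<close>)
  also have "\<dots> = sweedler (*) (\<Delta> h) (\<lambda>h1 h2. sweedler (*) (\<Delta> (h1 * \<Lambda>)) (\<lambda>x y. \<beta> x (S y * h2)))"
  proof -
    have "linear_functional (whole s) (\<lambda>z. sweedler (*) (\<Delta> z) (\<lambda>x y. \<beta> x (S y * h2)))" for h2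
      by (rule comult_functional)
         (use \<beta> in \<open>simp add: bilinear_form_def algebra_linear_simps\<close>)
    thus ?thesis by (simp add: \<Lambda> linear_functional_iff)
  qed
  also have "\<dots> = sweedler (*) (\<Delta> h) (\<lambda>h1 h2.
      sweedler (*) (\<Delta> h1) (\<lambda>a b. ?L (\<lambda>x y. \<beta> (a * x) (S y * S b * h2))))"
    by (subst comult_mult_functional)
       (use \<beta> in \<open>simp_all add: bilinear_form_def algebra_linear_simps antipode_antimult\<close>)
  also have "\<dots> = sweedler (*) (\<Delta> h) (\<lambda>h1 h2.
      sweedler (*) (\<Delta> h2) (\<lambda>a b. ?L (\<lambda>x y. \<beta> (h1 * x) (S y * S a * b))))"
    by (rule coassoc_functional)
       (use \<beta> in \<open>simp_all add: bilinear_form_def algebra_linear_simps\<close>)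
  also have "\<dots> = sweedler (*) (\<Delta> h) (\<lambda>h1 h2. \<epsilon> h2 * ?L (\<lambda>x y. \<beta> (h1 * x) (S y)))"
  proof -
    have "sweedler (*) (\<Delta> k) (\<lambda>a b. ?L (\<lambda>x y. \<beta> (g * x) (S y * S a * b))) =
        \<epsilon> k * ?L (\<lambda>x y. \<beta> (g * x) (S y))" for g k
      using antipode_left_functional[of "\<lambda>u. ?L (\<lambda>x y. \<beta> (g * x) (S y * u))" k] \<beta>
      by (simp add: bilinear_form_def algebra_linear_simps mult.assoc)
    thus ?thesis by simp
  qed
  also have "\<dots> = ?L (\<lambda>x y. \<beta> (h * x) (S y))"
    by (rule counit_right_functional)
       (use \<beta> in \<open>simp add: bilinear_form_def algebra_linear_simps\<close>)
  finally show ?thesis by simp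
qed

text \<open>
  This follows from the centrality of \<open>\<Lambda>\<^sub>1 \<otimes> S \<Lambda>\<^sub>2\<close> by applying the counit to the first factor.
\<close>

lemma antipode_integral_right:
  assumes "\<And>h. h * \<Lambda> = s (\<epsilon> h) \<Lambda>" "linear_functional (whole s) \<phi>"
  shows "\<phi> (S \<Lambda> * h) = \<epsilon> h * \<phi> (S \<Lambda>)"
proof -
  have "\<phi> (S \<Lambda> * h) = sweedler (*) (\<Delta> \<Lambda>) (\<lambda>x y. \<epsilon> x * \<phi> (S y * h))"
    by (rule counit_left_functional[where \<phi> = "\<lambda>y. \<phi> (S y * h)", symmetric])
       (use assms(2) in \<open>simp add: algebra_linear_simps\<close>)
  also have "\<dots> = sweedler (*) (\<Delta> \<Lambda>) (\<lambda>x y. \<epsilon> (h * x) * \<phi> (S y))"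
    using integral_central[OF assms(1), where \<beta> = "\<lambda>x y. \<epsilon> x * \<phi> y" and h = h]
      bilinear_formI[OF linear_functional_multc[OF counit_linear] linear_functional_cmult[OF assms(2)]]
    by metis
  also have "\<dots> = \<epsilon> h * sweedler (*) (\<Delta> \<Lambda>) (\<lambda>x y. \<epsilon> x * \<phi> (S y))"
    by (simp only: counit_mult mult.assoc sweedler_cmult)
  also have "\<dots> = \<epsilon> h * \<phi> (S \<Lambda>)"
    by (simp only: counit_left_functional[OF functional_antipode[OF assms(2)]])
  finally show ?thesis .
qed

end

section \<open>Multilinear functions of lists\<close>

lemma tuples_0 [simp]: "tuples V 0 = {[]}"
  by (auto simp: tuples_def)

lemma Nil_tuples [simp]: "[] \<in> tuples V n \<longleftrightarrow> n = 0"
  by (auto simp: tuples_def)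

lemma Cons_tuples [simp]: "x # xs \<in> tuples V (Suc n) \<longleftrightarrow> x \<in> car V \<and> xs \<in> tuples V n"
  by (auto simp: tuples_def)

lemma tuples_Suc_cases:
  assumes "xs \<in> tuples V (Suc n)"
  obtains y ys where "xs = y # ys" "y \<in> car V" "ys \<in> tuples V n"
  using assms by (cases xs) (auto simp: tuples_def)

lemma tuples_Cons_cases:
  assumes "x # xs \<in> tuples V n"
  obtains m where "n = Suc m" "x \<in> car V" "xs \<in> tuples V m"
  using assms by (cases n) (auto simp: tuples_def)

text \<open>
  Multilinearity by recursion on the number of entries: unlike the conditions on list updates in
  \<open>cochains\<close>, this form is suited to inductions that split off the first entry.
\<close>

primrec multilinear ::
    "('k::field, 'a, 'm) vspace_scheme \<Rightarrow> nat \<Rightarrow> ('a list \<Rightarrow> 'k) \<Rightarrow> bool"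
  where
    "multilinear V 0 f \<longleftrightarrow> True"
  | "multilinear V (Suc n) f \<longleftrightarrow>
      (\<forall>x\<in>car V. multilinear V n (\<lambda>xs. f (x # xs))) \<and>
      (\<forall>xs\<in>tuples V n. linear_functional V (\<lambda>x. f (x # xs)))"

lemma multilinear_iff_update:
  "multilinear V n f \<longleftrightarrow> (\<forall>xs\<in>tuples V n. \<forall>i<n. linear_functional V (\<lambda>x. f (xs[i := x])))"
proof (induction n arbitrary: f)
  case 0
  show ?case by simp
next
  case (Suc n)
  have "linear_functional V (\<lambda>x. f (x # xs))"
    if "\<forall>xs\<in>tuples V (Suc n). \<forall>i<Suc n. linear_functional V (\<lambda>x. f (xs[i := x]))"
      "xs \<in> tuples V n" for xs
  proof (cases "car V = {}")
    case True
    thus ?thesis by (simp add: linear_functional_iff)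
  next
    case False
    then obtain a where "a \<in> car V" by blast
    with that have "linear_functional V (\<lambda>x. f ((a # xs)[0 := x]))" by (metis Cons_tuples zero_less_Suc)
    thus ?thesis by simp
  qed
  moreover have "linear_functional V (\<lambda>y. f (x # xs[i := y]))"
    if "\<forall>xs\<in>tuples V (Suc n). \<forall>i<Suc n. linear_functional V (\<lambda>x. f (xs[i := x]))"
      "xs \<in> tuples V n" "x \<in> car V" "i < n" for x xs i
  proof -
    have "linear_functional V (\<lambda>y. f ((x # xs)[Suc i := y]))" using that by (metis Cons_tuples Suc_less_eq)
    thus ?thesis by simp
  qed
  moreover have "linear_functional V (\<lambda>x. f (xs[i := x]))"
    if "multilinear V (Suc n) f" "xs \<in> tuples V (Suc n)" "i < Suc n" for xs i
    using that(2)
  proof (cases rule: tuples_Suc_cases)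
    case (1 y ys)
    with that Suc.IH show ?thesis by (cases i) auto
  qed
  ultimately show ?case by (auto simp: Suc.IH)
qed

lemma cochains_iff:
  "f \<in> cochains V (*) n \<longleftrightarrow> multilinear V n f \<and> (\<forall>xs. xs \<notin> tuples V n \<longrightarrow> f xs = 0)"
  by (auto simp: cochains_def multilinear_iff_update linear_functional_iff)

text \<open>
  The operators on cochains below are defined by recursion on the list at which their value is taken.
  A single condition says that such a value depends linearly on the cochain and only on its values at
  tuples of length \<open>n\<close>; it is proved by one induction per operator.
\<close>

definition tuple_linear ::
    "('k::field, 'a, 'm) vspace_scheme \<Rightarrow> nat \<Rightarrow> (('a list \<Rightarrow> 'k) \<Rightarrow> 'k) \<Rightarrow> bool"
  where "tuple_linear V n L \<longleftrightarrow>
    (\<forall>F G H c. (\<forall>xs\<in>tuples V n. H xs = F xs + c * G xs) \<longrightarrow> L H = L F + c * L G)"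

lemma tuple_linearI:
  "(\<And>F G H c. (\<And>xs. xs \<in> tuples V n \<Longrightarrow> H xs = F xs + c * G xs) \<Longrightarrow> L H = L F + c * L G) \<Longrightarrow>
   tuple_linear V n L"
  by (simp add: tuple_linear_def)

context
  fixes V :: "('k::field, 'a, 'm) vspace_scheme" and n :: nat and L
  assumes L: "tuple_linear V n L"
begin

lemma tuple_linear_plus_cmult:
  "(\<And>xs. xs \<in> tuples V n \<Longrightarrow> H xs = F xs + c * G xs) \<Longrightarrow> L H = L F + c * L G"
  using L by (simp add: tuple_linear_def)

lemma tuple_linear_cong: "(\<And>xs. xs \<in> tuples V n \<Longrightarrow> F xs = G xs) \<Longrightarrow> L F = L G"
  using tuple_linear_plus_cmult[of F G 0 G] by simp

lemma tuple_linear_zero: "(\<And>xs. xs \<in> tuples V n \<Longrightarrow> F xs = 0) \<Longrightarrow> L F = 0"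
  \<comment> \<open>if \<open>F\<close> vanishes on the tuples, then \<open>F = F + 1 F\<close> there\<close>
  using tuple_linear_plus_cmult[of F F 1 F] by (simp only: mult_1 add_cancel_right_right)

lemma tuple_linear_add: "L (\<lambda>xs. F xs + G xs) = L F + L G"
  using tuple_linear_plus_cmult[of _ F 1 G] by simp

lemma tuple_linear_diff: "L (\<lambda>xs. F xs - G xs) = L F - L G"
  using tuple_linear_plus_cmult[of _ F "- 1" G] by simp

lemma tuple_linear_cmult: "L (\<lambda>xs. c * F xs) = c * L F"
  using tuple_linear_plus_cmult[of _ "\<lambda>xs. 0" c F] by (simp add: tuple_linear_zero)

lemma tuple_linear_sum: "L (\<lambda>xs. \<Sum>i\<in>I. F i xs) = (\<Sum>i\<in>I. L (F i))"
  by (induction I rule: infinite_finite_induct) (simp_all add: tuple_linear_zero tuple_linear_add)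

lemma tuple_linear_sweedler:
  "L (\<lambda>xs. sweedler (*) X (\<lambda>x y. F x y xs)) = sweedler (*) X (\<lambda>x y. L (F x y))"
  by (simp add: sweedler_eq_sum tuple_linear_sum tuple_linear_cmult)

lemma linear_functional_operator:
  assumes "\<And>xs. xs \<in> tuples V n \<Longrightarrow> linear_functional W (\<lambda>w. F w xs)"
  shows "linear_functional W (\<lambda>w. L (F w))"
proof -
  note lin = linear_functional_add[OF assms] linear_functional_scale[OF assms]
  show ?thesis
    unfolding linear_functional_iff tuple_linear_add[symmetric] tuple_linear_cmult[symmetric]
    by (intro conjI ballI allI tuple_linear_cong) (simp_all add: lin)
qed

lemma linear_functional_slice:
  "multilinear V (Suc n) f \<Longrightarrow> linear_functional V (\<lambda>x. L (\<lambda>xs. f (x # xs)))"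
  by (rule linear_functional_operator) simp

end

lemma tuple_linear_diffI:
  fixes V :: "('k::field, 'a, 'm) vspace_scheme"
  assumes "tuple_linear V n L" "tuple_linear V n M"
  shows "tuple_linear V n (\<lambda>F. L F - M F)"
proof (rule tuple_linearI)
  fix F G H :: "'a list \<Rightarrow> 'k" and c assume "\<And>xs. xs \<in> tuples V n \<Longrightarrow> H xs = F xs + c * G xs"
  from tuple_linear_plus_cmult[OF assms(1) this] tuple_linear_plus_cmult[OF assms(2) this]
  show "L H - M H = L F - M F + c * (L G - M G)" by (simp add: algebra_simps)
qed

lemma tuple_linear_cmultI:
  fixes V :: "('k::field, 'a, 'm) vspace_scheme"
  assumes "tuple_linear V n L"
  shows "tuple_linear V n (\<lambda>F. a * L F)"
proof (rule tuple_linearI)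
  fix F G H :: "'a list \<Rightarrow> 'k" and c assume "\<And>xs. xs \<in> tuples V n \<Longrightarrow> H xs = F xs + c * G xs"
  from tuple_linear_plus_cmult[OF assms this]
  show "a * L H = a * L F + c * (a * L G)" by (simp add: algebra_simps)
qed

lemma tuple_linear_sumI:
  fixes V :: "('k::field, 'a, 'm) vspace_scheme"
  assumes "\<And>i. i \<in> I \<Longrightarrow> tuple_linear V n (L i)"
  shows "tuple_linear V n (\<lambda>F. \<Sum>i\<in>I. L i F)"
proof (rule tuple_linearI)
  fix F G H :: "'a list \<Rightarrow> 'k" and c assume "\<And>xs. xs \<in> tuples V n \<Longrightarrow> H xs = F xs + c * G xs"
  from tuple_linear_plus_cmult[OF assms this]
  show "(\<Sum>i\<in>I. L i H) = (\<Sum>i\<in>I. L i F) + c * (\<Sum>i\<in>I. L i G)"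
    by (simp add: sum.distrib[symmetric] sum_distrib_left)
qed

lemma tuple_linear_sweedlerI:
  "(\<And>x y. tuple_linear V n (L x y)) \<Longrightarrow> tuple_linear V n (\<lambda>F. sweedler (*) X (\<lambda>x y. L x y F))"
  unfolding sweedler_eq_sum by (intro tuple_linear_sumI tuple_linear_cmultI)

lemma tuple_linear_eval: "xs \<in> tuples V n \<Longrightarrow> tuple_linear V n (\<lambda>F. F xs)"
  by (simp add: tuple_linear_def)

lemma tuple_linear_operatorI:
  fixes V :: "('k::field, 'a, 'm) vspace_scheme" and W :: "('k, 'b, 'n) vspace_scheme"
  assumes L: "tuple_linear V n L"
    and Q: "\<And>xs. xs \<in> tuples V n \<Longrightarrow> tuple_linear W m (\<lambda>F. Q F xs)"
  shows "tuple_linear W m (\<lambda>F. L (Q F))"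
proof (rule tuple_linearI)
  fix F G H :: "'b list \<Rightarrow> 'k" and c
  assume "\<And>xs. xs \<in> tuples W m \<Longrightarrow> H xs = F xs + c * G xs"
  thus "L (Q H) = L (Q F) + c * L (Q G)"
    by (intro tuple_linear_plus_cmult[OF L] tuple_linear_plus_cmult[OF Q])
qed

lemma tuple_linear_ConsI:
  "tuple_linear V n L \<Longrightarrow> x \<in> car V \<Longrightarrow> tuple_linear V (Suc n) (\<lambda>F. L (\<lambda>xs. F (x # xs)))"
  by (rule tuple_linearI, rule tuple_linear_plus_cmult) auto

locale closed_carrier =
  fixes V :: "('k::field, 'a, 'm) vspace_scheme"
  assumes add_closed: "x \<in> car V \<Longrightarrow> y \<in> car V \<Longrightarrow> vadd V x y \<in> car V"
    and scale_closed: "x \<in> car V \<Longrightarrow> vscale V c x \<in> car V"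
begin

lemma multilinear_cong:
  assumes "multilinear V n f" "\<And>xs. xs \<in> tuples V n \<Longrightarrow> g xs = f xs"
  shows "multilinear V n g"
  using assms
proof (induction n arbitrary: f g)
  case (Suc n)
  have "multilinear V n (\<lambda>xs. g (x # xs))" if "x \<in> car V" for x
    by (rule Suc.IH[of "\<lambda>xs. f (x # xs)"]) (use Suc.prems that in auto)
  moreover have "linear_functional V (\<lambda>x. g (x # xs))" if "xs \<in> tuples V n" for xs
  proof -
    have "linear_functional V (\<lambda>x. f (x # xs))" using Suc.prems that by simp
    thus ?thesis
      using Suc.prems(2) that by (simp add: linear_functional_iff add_closed scale_closed)
  qed
  ultimately show ?case by simp
qed simp

end

lemma multilinear_diff:
  "multilinear V n f \<Longrightarrow> multilinear V n g \<Longrightarrow> multilinear V n (\<lambda>xs. f xs - g xs)"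
  by (induction n arbitrary: f g) (auto intro: linear_functional_diff)

lemma multilinear_plus:
  "multilinear V n f \<Longrightarrow> multilinear V n g \<Longrightarrow> multilinear V n (\<lambda>xs. f xs + g xs)"
  by (induction n arbitrary: f g) (auto intro: linear_functional_plus)

lemma multilinear_cmult: "multilinear V n f \<Longrightarrow> multilinear V n (\<lambda>xs. c * f xs)"
  by (induction n arbitrary: f) (auto intro: linear_functional_cmult)

lemma multilinear_sum:
  "(\<And>i. i \<in> I \<Longrightarrow> multilinear V n (f i)) \<Longrightarrow> multilinear V n (\<lambda>xs. \<Sum>i\<in>I. f i xs)"
  by (induction n arbitrary: f) (auto intro: linear_functional_sum)

lemma multilinear_sweedler:
  "(\<And>x y. multilinear V n (f x y)) \<Longrightarrow> multilinear V n (\<lambda>xs. sweedler (*) X (\<lambda>x y. f x y xs))"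
  unfolding sweedler_eq_sum by (intro multilinear_sum multilinear_cmult)

section \<open>The Hochschild complex of an augmented algebra\<close>

locale augmented_algebra = closed_carrier A
  for A :: "('k::field, 'a, 'm) alg_scheme" +
  fixes \<epsilon> :: "'a \<Rightarrow> 'k"
  assumes mult_closed: "x \<in> car A \<Longrightarrow> y \<in> car A \<Longrightarrow> amult A x y \<in> car A"
    and one_closed: "aone A \<in> car A"
    and mult_linear_right: "x \<in> car A \<Longrightarrow> linear_between A A (\<lambda>y. amult A x y)"
    and mult_linear_left: "y \<in> car A \<Longrightarrow> linear_between A A (\<lambda>x. amult A x y)"
    and mult_assoc: "x \<in> car A \<Longrightarrow> y \<in> car A \<Longrightarrow> z \<in> car A \<Longrightarrow>
      amult A (amult A x y) z = amult A x (amult A y z)"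
    and mult_one: "x \<in> car A \<Longrightarrow> amult A x (aone A) = x"
    and augmentation_linear: "linear_functional A \<epsilon>"
    and augmentation_mult: "x \<in> car A \<Longrightarrow> y \<in> car A \<Longrightarrow> \<epsilon> (amult A x y) = \<epsilon> x * \<epsilon> y"
    and augmentation_one: "\<epsilon> (aone A) = 1"
begin

abbreviation mult (infixl "\<cdot>" 70) where "x \<cdot> y \<equiv> amult A x y"

abbreviation diff where "diff \<equiv> trivial_diff A \<epsilon>"

text \<open>
  The part of the Hochschild differential in which the first argument \<open>x\<close> does not act on the
  coefficients, with the opposite sign:
  \<open>F (x a\<^sub>1, a\<^sub>2, \<dots>) - F (x, a\<^sub>1 a\<^sub>2, \<dots>) + \<dots> \<plusminus> F (x, a\<^sub>1, \<dots>) \<epsilon> (a\<^sub>n)\<close>.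
  Its recursion replaces index computations with alternating signs by inductions on lists.
\<close>

primrec inner_diff :: "('a list \<Rightarrow> 'k) \<Rightarrow> 'a \<Rightarrow> 'a list \<Rightarrow> 'k" where
  "inner_diff F x [] = \<epsilon> x * F []"
| "inner_diff F x (a # as) = F (x \<cdot> a # as) - inner_diff (\<lambda>bs. F (x # bs)) a as"

lemma inner_diff_eq_sum:
  "length as = n \<Longrightarrow> inner_diff F x as =
    - (\<Sum>i<n. (-1) ^ Suc i *
        F (take i (x # as) @ (x # as) ! i \<cdot> (x # as) ! Suc i # drop (Suc (Suc i)) (x # as)))
    - (-1) ^ Suc n * (F (butlast (x # as)) * \<epsilon> (last (x # as)))"
proof (induction as arbitrary: F x n)
  case (Cons a as)
  then obtain m where m: "n = Suc m" "length as = m" by auto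
  show ?case
    by (simp add: m(1) Cons.IH[OF m(2)] sum.lessThan_Suc_shift sum_negf del: sum.lessThan_Suc)
qed simp

lemma diff_Cons:
  assumes "x \<in> car A" "as \<in> tuples A n"
  shows "diff n F (x # as) = \<epsilon> x * F as - inner_diff F x as"
proof -
  have "length as = n" using assms by (simp add: tuples_def)
  thus ?thesis
    using assms by (simp add: trivial_diff_def hochschild_diff_def inner_diff_eq_sum)
qed

lemma diff_outside: "xs \<notin> tuples A (Suc n) \<Longrightarrow> diff n F xs = 0"
  by (simp add: trivial_diff_def hochschild_diff_def)

lemma inner_diff_tuple_linear:
  "x \<in> car A \<Longrightarrow> as \<in> tuples A n \<Longrightarrow> tuple_linear A n (\<lambda>F. inner_diff F x as)"
proof (induction as arbitrary: x n)
  case Nil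
  thus ?case by (simp add: tuple_linear_cmultI tuple_linear_eval)
next
  case (Cons a as)
  then obtain m where "n = Suc m" "a \<in> car A" "as \<in> tuples A m" by (auto elim: tuples_Cons_cases)
  with Cons show ?case
    by (simp, intro tuple_linear_diffI tuple_linear_eval tuple_linear_ConsI)
       (simp_all add: mult_closed)
qed

lemma inner_diff_linear:
  "multilinear A n F \<Longrightarrow> as \<in> tuples A n \<Longrightarrow> linear_functional A (\<lambda>x. inner_diff F x as)"
proof (cases as)
  case Nil
  thus ?thesis by (auto intro: linear_functional_multc augmentation_linear)
next
  case (Cons a bs)
  assume "multilinear A n F" "as \<in> tuples A n"
  moreover from this Cons obtain m where m: "n = Suc m" "a \<in> car A" "bs \<in> tuples A m"
    by (auto elim: tuples_Cons_cases)
  ultimately show ?thesis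
    using linear_functional_slice[OF inner_diff_tuple_linear[OF m(2,3)], of F]
      linear_functional_comp[OF mult_linear_left[OF m(2)], of "\<lambda>x. F (x # bs)"]
    by (simp add: Cons linear_functional_diff)
qed

lemma inner_diff_multilinear:
  "multilinear A n F \<Longrightarrow> x \<in> car A \<Longrightarrow> multilinear A n (inner_diff F x)"
proof (induction n arbitrary: F x)
  case (Suc n)
  have "linear_functional A (\<lambda>a. F (x \<cdot> a # as))" if "as \<in> tuples A n" for as
    using linear_functional_comp[OF mult_linear_right[OF Suc.prems(2)], of "\<lambda>x. F (x # as)"]
      Suc.prems(1) that by simp
  with Suc show ?case
    by (auto intro!: multilinear_diff linear_functional_diff inner_diff_linear[of n] simp: mult_closed)
qed simp

lemma diff_multilinear: "multilinear A n F \<Longrightarrow> multilinear A (Suc n) (diff n F)"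
  by (rule multilinear_cong[of _ "\<lambda>xs. \<epsilon> (hd xs) * F (tl xs) - inner_diff F (hd xs) (tl xs)"])
     (auto simp: diff_Cons elim!: tuples_Suc_cases intro!: multilinear_diff multilinear_cmult
       inner_diff_multilinear linear_functional_diff linear_functional_multc inner_diff_linear
       augmentation_linear)

lemma diff_cochain: "F \<in> cochains A (*) n \<Longrightarrow> diff n F \<in> cochains A (*) (Suc n)"
  by (simp add: cochains_iff diff_multilinear diff_outside del: multilinear.simps)

lemma diff_tuple_linear: "xs \<in> tuples A (Suc n) \<Longrightarrow> tuple_linear A n (\<lambda>F. diff n F xs)"
  by (erule tuples_Suc_cases)
     (simp add: diff_Cons tuple_linear_diffI tuple_linear_cmultI tuple_linear_eval
       inner_diff_tuple_linear)

text \<open>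
  The part of \<open>\<partial> \<partial> = 0\<close> in which the coefficients are not acted on from the left.
\<close>

lemma inner_diff_inner_diff:
  "x \<in> car A \<Longrightarrow> y \<in> car A \<Longrightarrow> as \<in> tuples A n \<Longrightarrow>
    inner_diff (inner_diff F x) y as = inner_diff F (x \<cdot> y) as"
proof (induction as arbitrary: F x y n)
  case Nil
  thus ?case by (simp add: augmentation_mult)
next
  case (Cons a as)
  then obtain m where m: "n = Suc m" "a \<in> car A" "as \<in> tuples A m" by (auto elim: tuples_Cons_cases)
  show ?case
    using Cons.prems m Cons.IH[of y a m "\<lambda>bs. F (x # bs)"]
    by (simp add: tuple_linear_diff[OF inner_diff_tuple_linear] mult_assoc)
qed

lemma diff_diff:
  "diff (Suc n) (diff n F) = (\<lambda>xs. 0)"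
proof
  fix xs
  show "diff (Suc n) (diff n F) xs = 0"
  proof (cases "xs \<in> tuples A (Suc (Suc n))")
    case True
    then obtain x y as where xs: "xs = x # y # as" "x \<in> car A" "y \<in> car A" "as \<in> tuples A n"
      by (metis tuples_Suc_cases)
    have "inner_diff (\<lambda>bs. diff n F (x # bs)) y as =
        inner_diff (\<lambda>bs. \<epsilon> x * F bs - inner_diff F x bs) y as"
      using xs by (intro tuple_linear_cong[OF inner_diff_tuple_linear]) (auto simp: diff_Cons)
    also have "\<dots> = \<epsilon> x * inner_diff F y as - inner_diff F (x \<cdot> y) as"
      using xs by (simp add: tuple_linear_diff[OF inner_diff_tuple_linear]
          tuple_linear_cmult[OF inner_diff_tuple_linear] inner_diff_inner_diff)
    finally show ?thesis
      using xs by (simp add: diff_Cons mult_closed augmentation_mult algebra_simps)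
  qed (simp add: diff_outside)
qed

end

section \<open>Cochains relative to a separable subalgebra\<close>

text \<open>
  A decomposition \<open>1 = \<Sum> e\<^sub>i e'\<^sub>i\<close>, together with its image \<open>t = \<Sum> \<epsilon>(e\<^sub>i) e'\<^sub>i\<close> under the augmentation of
  the first factors.  Stating both equations through functionals avoids sums in the carrier.
\<close>

locale resolved_unit = augmented_algebra A \<epsilon>
  for A :: "('k::field, 'a, 'm) alg_scheme" and \<epsilon> :: "'a \<Rightarrow> 'k" +
  fixes I :: "'i set" and e e' :: "'i \<Rightarrow> 'a" and t :: 'a
  assumes e_closed: "e i \<in> car A" and e'_closed: "e' i \<in> car A" and t_closed: "t \<in> car A"
    and resolution: "linear_functional A \<phi> \<Longrightarrow> (\<Sum>i\<in>I. \<phi> (amult A (e i) (e' i))) = \<phi> (aone A)"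
    and augmented_left: "linear_functional A \<phi> \<Longrightarrow> (\<Sum>i\<in>I. \<epsilon> (e i) * \<phi> (e' i)) = \<phi> t"
begin

text \<open>
  For \<open>u = t\<close>, \<open>averaging\<close> is the endomorphism
  \<open>F (t a\<^sub>1 e, e' a\<^sub>2 f, f' a\<^sub>3 g, \<dots>)\<close> of the complex, with a new copy of the decomposition of \<open>1\<close>
  behind each argument and the augmentation applied to the last second factor, and \<open>contraction\<close> is
  the alternating sum of the cochains
  \<open>F (t a\<^sub>1 e, \<dots>, f' a\<^sub>i g, g', a\<^sub>i\<^sub>+\<^sub>1, \<dots>, a\<^sub>n)\<close> which is the simplicial homotopy to the identity.  The
  parameter \<open>u\<close> is the factor still to be multiplied to the next argument; it makes both recursive.
\<close>

primrec contraction :: "('a list \<Rightarrow> 'k) \<Rightarrow> 'a \<Rightarrow> 'a list \<Rightarrow> 'k" where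
  "contraction F u [] = F [u]"
| "contraction F u (a # as) = F (u # a # as) -
    (\<Sum>i\<in>I. contraction (\<lambda>bs. F (u \<cdot> a \<cdot> e i # bs)) (e' i) as)"

primrec averaging :: "('a list \<Rightarrow> 'k) \<Rightarrow> 'a \<Rightarrow> 'a list \<Rightarrow> 'k" where
  "averaging F u [] = \<epsilon> u * F []"
| "averaging F u (a # as) = (\<Sum>i\<in>I. averaging (\<lambda>bs. F (u \<cdot> a \<cdot> e i # bs)) (e' i) as)"

text \<open>
  The sum of \<open>averaging\<close> and of the faces of the differential of \<open>contraction\<close> other than the one in
  which the first argument acts on the coefficients.
\<close>

primrec defect :: "('a list \<Rightarrow> 'k) \<Rightarrow> 'a \<Rightarrow> 'a list \<Rightarrow> 'k" where
  "defect F u [] = \<epsilon> u * F []"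
| "defect F u (a # as) = averaging F u (a # as) - inner_diff (contraction F u) a as"

lemma contraction_tuple_linear:
  "u \<in> car A \<Longrightarrow> as \<in> tuples A n \<Longrightarrow> tuple_linear A (Suc n) (\<lambda>F. contraction F u as)"
proof (induction as arbitrary: u n)
  case Nil
  thus ?case by (simp add: tuple_linear_eval)
next
  case (Cons a as)
  then obtain m where m: "n = Suc m" "a \<in> car A" "as \<in> tuples A m" by (auto elim: tuples_Cons_cases)
  have "tuple_linear A (Suc n) (\<lambda>F. contraction (\<lambda>bs. F (u \<cdot> a \<cdot> e i # bs)) (e' i) as)" for i
    unfolding m(1) using Cons.prems(1) m
    by (intro tuple_linear_ConsI Cons.IH) (simp_all add: mult_closed e_closed e'_closed)
  thus ?case
    using Cons.prems m
    by (simp, intro tuple_linear_diffI tuple_linear_eval tuple_linear_sumI) simp_all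
qed

lemma averaging_tuple_linear:
  "u \<in> car A \<Longrightarrow> as \<in> tuples A n \<Longrightarrow> tuple_linear A n (\<lambda>F. averaging F u as)"
proof (induction as arbitrary: u n)
  case Nil
  thus ?case by (simp add: tuple_linear_eval tuple_linear_cmultI)
next
  case (Cons a as)
  then obtain m where m: "n = Suc m" "a \<in> car A" "as \<in> tuples A m" by (auto elim: tuples_Cons_cases)
  have "tuple_linear A n (\<lambda>F. averaging (\<lambda>bs. F (u \<cdot> a \<cdot> e i # bs)) (e' i) as)" for i
    unfolding m(1) using Cons.prems(1) m
    by (intro tuple_linear_ConsI Cons.IH) (simp_all add: mult_closed e_closed e'_closed)
  thus ?case by (simp add: tuple_linear_sumI)
qed

lemma functional_mult_right: "linear_functional A \<phi> \<Longrightarrow> x \<in> car A \<Longrightarrow> linear_functional A (\<lambda>y. \<phi> (y \<cdot> x))"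
  by (rule linear_functional_comp[OF mult_linear_left])

lemma functional_mult_left: "linear_functional A \<phi> \<Longrightarrow> x \<in> car A \<Longrightarrow> linear_functional A (\<lambda>y. \<phi> (x \<cdot> y))"
  by (rule linear_functional_comp[OF mult_linear_right])

lemma contraction_linear:
  assumes F: "multilinear A (Suc n) F" and "as \<in> tuples A n"
  shows "linear_functional A (\<lambda>u. contraction F u as)"
proof (cases as)
  case Nil
  thus ?thesis using assms by simp
next
  case (Cons a bs)
  with assms obtain m where m: "n = Suc m" "a \<in> car A" "bs \<in> tuples A m"
    by (auto elim: tuples_Cons_cases)
  have "linear_functional A (\<lambda>v. contraction (\<lambda>bs. F (v # bs)) (e' i) bs)" for i
    using F m
    by (intro linear_functional_slice[OF contraction_tuple_linear[of _ _ m]])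
       (simp_all add: e'_closed)
  from this[THEN functional_mult_right, OF e_closed, THEN functional_mult_right, OF m(2)]
  show ?thesis
    using F assms(2) Cons by (auto intro!: linear_functional_diff linear_functional_sum)
qed

lemma averaging_linear:
  assumes F: "multilinear A n F" and "as \<in> tuples A n"
  shows "linear_functional A (\<lambda>u. averaging F u as)"
proof (cases as)
  case Nil
  thus ?thesis using assms by (simp add: linear_functional_multc augmentation_linear)
next
  case (Cons a bs)
  with assms obtain m where m: "n = Suc m" "a \<in> car A" "bs \<in> tuples A m"
    by (auto elim: tuples_Cons_cases)
  have "linear_functional A (\<lambda>v. averaging (\<lambda>bs. F (v # bs)) (e' i) bs)" for i
    using F m
    by (intro linear_functional_slice[OF averaging_tuple_linear[of _ _ m]])
       (simp_all add: e'_closed)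
  from this[THEN functional_mult_right, OF e_closed, THEN functional_mult_right, OF m(2)]
  show ?thesis
    using Cons by (auto intro!: linear_functional_sum)
qed

lemma contraction_multilinear:
  "multilinear A (Suc n) F \<Longrightarrow> u \<in> car A \<Longrightarrow> multilinear A n (contraction F u)"
proof (induction n arbitrary: F u)
  case (Suc n)
  have "linear_functional A (\<lambda>a. contraction (\<lambda>bs. F (u \<cdot> a \<cdot> e i # bs)) (e' i) as)"
    if "as \<in> tuples A n" for i as
  proof -
    have "linear_functional A (\<lambda>v. contraction (\<lambda>bs. F (v # bs)) (e' i) as)"
      using Suc.prems(1) that
      by (intro linear_functional_slice[OF contraction_tuple_linear[of _ _ n]])
         (simp_all add: e'_closed)
    from functional_mult_left[OF functional_mult_right[OF this e_closed] Suc.prems(2)]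
    show ?thesis .
  qed
  moreover have "multilinear A n (contraction (\<lambda>bs. F (u \<cdot> a \<cdot> e i # bs)) (e' i))"
    if "a \<in> car A" for i a
    using Suc.prems that by (intro Suc.IH) (simp_all add: mult_closed e_closed e'_closed)
  ultimately show ?case
    using Suc.prems
    by (auto intro!: multilinear_diff multilinear_sum linear_functional_diff linear_functional_sum)
qed simp

lemma averaging_multilinear:
  "multilinear A n F \<Longrightarrow> u \<in> car A \<Longrightarrow> multilinear A n (averaging F u)"
proof (induction n arbitrary: F u)
  case (Suc n)
  have "linear_functional A (\<lambda>a. averaging (\<lambda>bs. F (u \<cdot> a \<cdot> e i # bs)) (e' i) as)"
    if "as \<in> tuples A n" for i as
  proof -
    have "linear_functional A (\<lambda>v. averaging (\<lambda>bs. F (v # bs)) (e' i) as)"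
      using Suc.prems(1) that
      by (intro linear_functional_slice[OF averaging_tuple_linear[of _ _ n]])
         (simp_all add: e'_closed)
    from functional_mult_left[OF functional_mult_right[OF this e_closed] Suc.prems(2)]
    show ?thesis .
  qed
  moreover have "multilinear A n (averaging (\<lambda>bs. F (u \<cdot> a \<cdot> e i # bs)) (e' i))"
    if "a \<in> car A" for i a
    using Suc.prems that by (intro Suc.IH) (simp_all add: mult_closed e_closed e'_closed)
  ultimately show ?case
    by (auto intro!: multilinear_sum linear_functional_sum)
qed simp

text \<open>
  This is the recursion of \<open>defect\<close> in its list, which its definition through \<open>averaging\<close> and
  \<open>contraction\<close> hides.  It matches the recursion met in \<open>contraction_inner_diff\<close>.
\<close>

lemma defect_Cons:
  assumes "u \<in> car A" "a \<in> car A" "as \<in> tuples A n"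
  shows "defect F u (a # as) =
    F (u \<cdot> a # as) - inner_diff (\<lambda>bs. F (u # bs)) a as - contraction F (u \<cdot> a) as +
    (\<Sum>i\<in>I. defect (\<lambda>bs. F (u \<cdot> a \<cdot> e i # bs)) (e' i) as)"
proof (cases as)
  case Nil
  thus ?thesis by simp
next
  case (Cons b bs)
  with assms obtain m where m: "n = Suc m" "b \<in> car A" "bs \<in> tuples A m"
    by (auto elim: tuples_Cons_cases)
  have "inner_diff (\<lambda>bs. contraction F u (a # bs)) b bs = inner_diff (\<lambda>bs. F (u # a # bs)) b bs -
      (\<Sum>i\<in>I. inner_diff (contraction (\<lambda>bs. F (u \<cdot> a \<cdot> e i # bs)) (e' i)) b bs)"
    by (simp add: tuple_linear_diff[OF inner_diff_tuple_linear[OF m(2,3)]]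
        tuple_linear_sum[OF inner_diff_tuple_linear[OF m(2,3)]])
  thus ?thesis
    using assms m by (simp add: Cons mult_assoc mult_closed e_closed sum_subtractf)
qed

text \<open>
  In the induction step, the values of the contraction of \<open>F (x, -)\<close> at \<open>u a e e'\<close> occur.  Summed over
  the decomposition of \<open>1\<close> they give its value at \<open>u a\<close>, a term of \<open>defect_Cons\<close>.
\<close>

lemma contraction_inner_diff:
  "multilinear A (Suc n) F \<Longrightarrow> x \<in> car A \<Longrightarrow> u \<in> car A \<Longrightarrow> as \<in> tuples A n \<Longrightarrow>
    contraction (inner_diff F x) u as = contraction F (x \<cdot> u) as - defect (\<lambda>bs. F (x # bs)) u as"
proof (induction as arbitrary: F x u n)
  case Nil
  thus ?case by simp
next
  case (Cons a as)
  then obtain m where m: "n = Suc m" "a \<in> car A" "as \<in> tuples A m" by (auto elim: tuples_Cons_cases)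
  let ?G = "\<lambda>bs. F (x # bs)"
  have G: "multilinear A (Suc m) ?G" using Cons.prems m by simp
  have uae: "u \<cdot> a \<cdot> e i \<in> car A" for i
    using Cons.prems m by (simp add: mult_closed e_closed)
  have "contraction (\<lambda>bs. inner_diff F x (u \<cdot> a \<cdot> e i # bs)) (e' i) as =
      contraction (\<lambda>bs. F (x \<cdot> (u \<cdot> a \<cdot> e i) # bs)) (e' i) as -
      contraction ?G (u \<cdot> a \<cdot> e i \<cdot> e' i) as +
      defect (\<lambda>bs. ?G (u \<cdot> a \<cdot> e i # bs)) (e' i) as" for i
    using Cons.IH[OF G uae e'_closed m(3), of i i]
    by (simp add: tuple_linear_diff[OF contraction_tuple_linear[OF e'_closed m(3)]])
  moreover have "(\<Sum>i\<in>I. contraction ?G (u \<cdot> a \<cdot> e i \<cdot> e' i) as) = contraction ?G (u \<cdot> a) as"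
  proof -
    have "linear_functional A (\<lambda>v. contraction ?G (u \<cdot> a \<cdot> v) as)"
      using functional_mult_left[OF contraction_linear[OF G m(3)]] Cons.prems m
      by (simp add: mult_closed)
    from resolution[OF this] show ?thesis
      using Cons.prems m by (simp add: mult_assoc mult_closed e_closed e'_closed mult_one one_closed)
  qed
  ultimately show ?case
    using Cons.prems m
    by (simp add: sum.distrib sum_subtractf defect_Cons[OF _ _ m(3)] mult_assoc mult_closed e_closed
        del: defect.simps)
qed

lemma augmentation_t: "\<epsilon> t = 1"
  using augmented_left[OF augmentation_linear] resolution[OF augmentation_linear]
  by (simp add: augmentation_mult e_closed e'_closed augmentation_one)

lemma averaging_homotopy_0: "F \<in> cochains A (*) 0 \<Longrightarrow> averaging F t [] = F []"
  by (simp add: augmentation_t)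

text \<open>
  The face of \<open>contraction (diff F)\<close> in which the first argument acts on the coefficients produces
  \<open>\<Sum> \<epsilon>(e) contraction F e'\<close>, that is, \<open>contraction F t\<close>: this is the reason for starting with \<open>t\<close>.
\<close>

lemma averaging_homotopy_Suc:
  assumes F: "multilinear A (Suc n) F" and "xs \<in> tuples A (Suc n)"
  shows "F xs - averaging F t xs =
    contraction (diff (Suc n) F) t xs + diff n (contraction F t) xs"
proof -
  obtain a as where xs: "xs = a # as" and a: "a \<in> car A" and as: "as \<in> tuples A n"
    using assms(2) by (rule tuples_Suc_cases)
  note cl = mult_closed e_closed e'_closed t_closed
  have *: "contraction (\<lambda>bs. diff (Suc n) F (t \<cdot> a \<cdot> e i # bs)) (e' i) as =
      \<epsilon> (t \<cdot> a \<cdot> e i) * contraction F (e' i) as -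
      contraction F (t \<cdot> a \<cdot> e i \<cdot> e' i) as + defect (\<lambda>bs. F (t \<cdot> a \<cdot> e i # bs)) (e' i) as" for i
  proof -
    note lin = contraction_tuple_linear[OF e'_closed as, of i]
    have "contraction (\<lambda>bs. diff (Suc n) F (t \<cdot> a \<cdot> e i # bs)) (e' i) as =
      contraction (\<lambda>bs. \<epsilon> (t \<cdot> a \<cdot> e i) * F bs - inner_diff F (t \<cdot> a \<cdot> e i) bs) (e' i) as"
      using a by (intro tuple_linear_cong[OF lin]) (simp add: diff_Cons cl)
    thus ?thesis
      using a as F contraction_inner_diff[OF F _ e'_closed as, of "t \<cdot> a \<cdot> e i" i]
      by (simp add: tuple_linear_diff[OF lin] tuple_linear_cmult[OF lin] cl)
  qed
  have "(\<Sum>i\<in>I. \<epsilon> (t \<cdot> a \<cdot> e i) * contraction F (e' i) as) = \<epsilon> a * contraction F t as"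
    using augmented_left[OF contraction_linear[OF F as]] a
    by (simp add: augmentation_mult cl augmentation_t sum_distrib_left[symmetric] mult.assoc)
  moreover have "(\<Sum>i\<in>I. contraction F (t \<cdot> a \<cdot> e i \<cdot> e' i) as) = contraction F (t \<cdot> a) as"
  proof -
    have "linear_functional A (\<lambda>v. contraction F (t \<cdot> a \<cdot> v) as)"
      using functional_mult_left[OF contraction_linear[OF F as]] a by (simp add: cl)
    from resolution[OF this] show ?thesis
      using a by (simp add: mult_assoc cl mult_one one_closed)
  qed
  moreover have "averaging F t (a # as) = defect F t (a # as) + inner_diff (contraction F t) a as"
    by simp
  ultimately show ?thesis
    using a as t_closed
    by (simp add: xs * diff_Cons sum.distrib sum_subtractf defect_Cons[OF _ _ as] augmentation_t
        del: defect.simps averaging.simps)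
qed

end

context augmented_algebra
begin

text \<open>
  A function without arguments is an element of the coefficients, where \<open>h\<close> acts by the augmentation.
\<close>

primrec act_first :: "'a \<Rightarrow> ('a list \<Rightarrow> 'k) \<Rightarrow> 'a list \<Rightarrow> 'k" where
  "act_first h F [] = \<epsilon> h * F []"
| "act_first h F (a # as) = F (h \<cdot> a # as)"

text \<open>
  A multilinear function is balanced if it factors through the tensor product over \<open>R\<close>, where \<open>R\<close> acts
  through the augmentation behind the last argument.
\<close>

primrec balanced :: "'a set \<Rightarrow> nat \<Rightarrow> ('a list \<Rightarrow> 'k) \<Rightarrow> bool" where
  "balanced R 0 F \<longleftrightarrow> True"
| "balanced R (Suc n) F \<longleftrightarrow>
    (\<forall>a\<in>car A. balanced R n (\<lambda>as. F (a # as))) \<and>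
    (\<forall>a\<in>car A. \<forall>h\<in>R. \<forall>as\<in>tuples A n. F (a \<cdot> h # as) = act_first h (\<lambda>bs. F (a # bs)) as)"

lemma act_first_sum: "act_first h (\<lambda>bs. \<Sum>i\<in>I. F i bs) as = (\<Sum>i\<in>I. act_first h (F i) as)"
  by (cases as) (simp_all add: sum_distrib_left)

lemma act_first_cong:
  assumes "h \<in> car A" "as \<in> tuples A n" "\<And>xs. xs \<in> tuples A n \<Longrightarrow> F xs = G xs"
  shows "act_first h F as = act_first h G as"
  using assms by (cases n; cases as) (auto simp: mult_closed elim: tuples_Cons_cases)

lemma balanced_sum:
  "(\<And>i. i \<in> I \<Longrightarrow> balanced R n (F i)) \<Longrightarrow> balanced R n (\<lambda>as. \<Sum>i\<in>I. F i as)"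
  by (induction n arbitrary: F) (simp_all add: act_first_sum)

lemma balanced_cong:
  assumes "R \<subseteq> car A" "balanced R n F" "\<And>xs. xs \<in> tuples A n \<Longrightarrow> G xs = F xs"
  shows "balanced R n G"
  using assms
proof (induction n arbitrary: F G)
  case (Suc n)
  have "balanced R n (\<lambda>xs. G (x # xs))" if "x \<in> car A" for x
    by (rule Suc.IH[of "\<lambda>xs. F (x # xs)"]) (use Suc.prems that in auto)
  moreover have "G (a \<cdot> h # as) = act_first h (\<lambda>bs. G (a # bs)) as"
    if "a \<in> car A" "h \<in> R" "as \<in> tuples A n" for a h as
    using Suc.prems that mult_closed[of a h]
      act_first_cong[of h as n "\<lambda>bs. F (a # bs)" "\<lambda>bs. G (a # bs)"] by auto
  ultimately show ?case by simp
qed simp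

lemma trivial_coboundaries_eq:
  "trivial_coboundaries A \<epsilon> n = (case n of 0 \<Rightarrow> {0} | Suc m \<Rightarrow> diff m ` cochains A (*) m)"
  by (simp add: trivial_coboundaries_def coboundaries_def trivial_diff_def split: nat.split)

lemma diff_plus: "diff n (F + G) = diff n F + diff n G"
proof
  fix xs
  show "diff n (F + G) xs = (diff n F + diff n G) xs"
    using tuple_linear_add[OF diff_tuple_linear, of xs n F G]
    by (cases "xs \<in> tuples A (Suc n)") (simp_all add: diff_outside plus_fun_def)
qed

lemma diff_minus: "diff n (F - G) = diff n F - diff n G"
proof
  fix xs
  show "diff n (F - G) xs = (diff n F - diff n G) xs"
    using tuple_linear_diff[OF diff_tuple_linear, of xs n F G]
    by (cases "xs \<in> tuples A (Suc n)") (simp_all add: diff_outside fun_diff_def)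
qed

lemma diff_scale: "diff n (cochain_scale (*) c F) = cochain_scale (*) c (diff n F)"
proof
  fix xs
  show "diff n (cochain_scale (*) c F) xs = cochain_scale (*) c (diff n F) xs"
    using tuple_linear_cmult[OF diff_tuple_linear, of xs n c F]
    by (cases "xs \<in> tuples A (Suc n)") (simp_all add: diff_outside cochain_scale_def)
qed

text \<open>Cochains are required to vanish outside the tuples of the right length.\<close>

definition restrict_tuples :: "nat \<Rightarrow> ('a list \<Rightarrow> 'k) \<Rightarrow> 'a list \<Rightarrow> 'k"
  where "restrict_tuples n F = (\<lambda>xs. if xs \<in> tuples A n then F xs else 0)"

lemma restrict_tuples_cochain: "multilinear A n F \<Longrightarrow> restrict_tuples n F \<in> cochains A (*) n"
  by (auto simp: cochains_iff restrict_tuples_def intro: multilinear_cong)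

lemma diff_restrict_tuples: "diff n (restrict_tuples n F) = diff n F"
proof
  fix xs
  show "diff n (restrict_tuples n F) xs = diff n F xs"
  proof (cases "xs \<in> tuples A (Suc n)")
    case True
    thus ?thesis
      by (rule tuple_linear_cong[OF diff_tuple_linear]) (simp add: restrict_tuples_def)
  qed (simp add: diff_outside)
qed

end

text \<open>
  The decomposition of \<open>1\<close> is now central over \<open>R\<close>, hence a separability idempotent if its factors are
  taken from \<open>R\<close>.
\<close>

locale separable_subalgebra = resolved_unit A \<epsilon> I e e' t
  for A :: "('k::field, 'a, 'm) alg_scheme" and \<epsilon> :: "'a \<Rightarrow> 'k" and I :: "'i set" and e e' t +
  fixes R :: "'a set"
  assumes R_subset: "R \<subseteq> car A"
    and central: "h \<in> R \<Longrightarrow> bilinear_form A A \<beta> \<Longrightarrow>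
      (\<Sum>i\<in>I. \<beta> (amult A h (e i)) (e' i)) = (\<Sum>i\<in>I. \<beta> (e i) (amult A (e' i) h))"
begin

lemma averaging_mult_right:
  assumes "u \<in> car A" "h \<in> R" "as \<in> tuples A n"
  shows "averaging F (u \<cdot> h) as = act_first h (averaging F u) as"
proof -
  have h: "h \<in> car A" using assms R_subset by blast
  show ?thesis
    using assms h
    by (cases as; cases n) (auto simp: augmentation_mult mult_assoc elim!: tuples_Cons_cases)
qed

text \<open>
  Centrality moves \<open>h\<close> from \<open>a h e \<otimes> e'\<close> to \<open>a e \<otimes> e' h\<close>, that is, into the following argument.
\<close>

lemma averaging_balanced:
  "multilinear A n F \<Longrightarrow> u \<in> car A \<Longrightarrow> balanced R n (averaging F u)"
proof (induction n arbitrary: F u)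
  case (Suc n)
  note cl = mult_closed e_closed e'_closed
  have "balanced R n (averaging (\<lambda>bs. F (u \<cdot> a \<cdot> e i # bs)) (e' i))" if "a \<in> car A" for a i
    using Suc.prems that by (intro Suc.IH) (simp_all add: cl)
  hence "balanced R n (\<lambda>as. averaging F u (a # as))" if "a \<in> car A" for a
    using that by (simp add: balanced_sum)
  moreover have "averaging F u (a \<cdot> h # as) = act_first h (\<lambda>bs. averaging F u (a # bs)) as"
    if a: "a \<in> car A" and h: "h \<in> R" and as: "as \<in> tuples A n" for a h as
  proof -
    have hA: "h \<in> car A" using h R_subset by blast
    have slice: "linear_functional A (\<lambda>v. averaging (\<lambda>bs. F (v # bs)) w as)" if "w \<in> car A" for w
      using Suc.prems(1) as that
      by (intro linear_functional_slice[OF averaging_tuple_linear[of _ _ n]]) simp_all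
    have "bilinear_form A A (\<lambda>v w. averaging (\<lambda>bs. F (u \<cdot> a \<cdot> v # bs)) w as)"
    proof (rule bilinear_formI)
      show "linear_functional A (\<lambda>v. averaging (\<lambda>bs. F (u \<cdot> a \<cdot> v # bs)) w as)"
        if "w \<in> car A" for w
        using functional_mult_left[OF slice[OF that]] Suc.prems(2) a by (simp add: mult_closed)
      show "linear_functional A (\<lambda>w. averaging (\<lambda>bs. F (u \<cdot> a \<cdot> v # bs)) w as)"
        if "v \<in> car A" for v
        by (rule averaging_linear[OF _ as]) (use Suc.prems a that in \<open>simp add: mult_closed\<close>)
    qed
    from central[OF h this] show ?thesis
      using Suc.prems(2) a hA
      by (simp add: act_first_sum mult_assoc cl averaging_mult_right[OF e'_closed h as])
  qed
  ultimately show ?case by simp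
qed simp

text \<open>
  By centrality \<open>t h = \<Sum> \<epsilon>(e) e' h = \<Sum> \<epsilon>(h e) e' = \<epsilon>(h) t\<close>.
\<close>

lemma averaging_invariant:
  assumes F: "multilinear A n F" and h: "h \<in> R" and as: "as \<in> tuples A n"
  shows "act_first h (averaging F t) as = \<epsilon> h * averaging F t as"
proof -
  have hA: "h \<in> car A" using h R_subset by blast
  have lin: "linear_functional A (\<lambda>u. averaging F u as)"
    by (rule averaging_linear[OF F as])
  have \<beta>: "bilinear_form A A (\<lambda>v w. \<epsilon> v * averaging F w as)"
    by (intro bilinear_formI linear_functional_multc linear_functional_cmult augmentation_linear lin)
  have "averaging F (t \<cdot> h) as = (\<Sum>i\<in>I. \<epsilon> (e i) * averaging F (e' i \<cdot> h) as)"
    by (rule augmented_left[symmetric]) (rule functional_mult_right[OF lin hA])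
  also have "\<dots> = (\<Sum>i\<in>I. \<epsilon> (h \<cdot> e i) * averaging F (e' i) as)"
    by (rule central[OF h \<beta>, symmetric])
  also have "\<dots> = \<epsilon> h * averaging F t as"
    by (simp add: augmented_left[OF lin, symmetric] augmentation_mult hA e_closed
        sum_distrib_left mult.assoc)
  finally show ?thesis by (simp add: averaging_mult_right[OF t_closed h as])
qed

theorem relative_cocycle:
  assumes F: "F \<in> cochains A (*) n" "diff n F = 0"
  obtains G where "G \<in> cochains A (*) n" "diff n G = 0" "balanced R n G"
    and "\<And>h as. h \<in> R \<Longrightarrow> as \<in> tuples A n \<Longrightarrow> act_first h G as = \<epsilon> h * G as"
    and "F - G \<in> trivial_coboundaries A \<epsilon> n"
proof -
  define G where "G = restrict_tuples n (averaging F t)"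
  have ml: "multilinear A n F" and out: "\<And>xs. xs \<notin> tuples A n \<Longrightarrow> F xs = 0"
    using F(1) by (simp_all add: cochains_iff)
  have G: "G \<in> cochains A (*) n"
    unfolding G_def by (intro restrict_tuples_cochain averaging_multilinear ml t_closed)
  have eq: "xs \<in> tuples A n \<Longrightarrow> G xs = averaging F t xs" for xs
    by (simp add: G_def restrict_tuples_def)
  have "balanced R n G"
    by (rule balanced_cong[OF R_subset averaging_balanced[OF ml t_closed]]) (rule eq)
  moreover have "act_first h G as = \<epsilon> h * G as" if "h \<in> R" "as \<in> tuples A n" for h as
    using averaging_invariant[OF ml that] act_first_cong[of h as n, OF _ that(2) eq] that R_subset eq
    by auto
  moreover have "F - G \<in> trivial_coboundaries A \<epsilon> n \<and> diff n G = 0"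
  proof (cases n)
    case 0
    have "F = G"
    proof
      fix xs show "F xs = G xs"
        using out[of xs] averaging_homotopy_0 F(1) by (cases xs) (auto simp: G_def restrict_tuples_def 0)
    qed
    thus ?thesis using F(2) by (simp add: trivial_coboundaries_eq 0)
  next
    case (Suc m)
    define K where "K = restrict_tuples m (contraction F t)"
    have K: "K \<in> cochains A (*) m"
      unfolding K_def
      by (intro restrict_tuples_cochain contraction_multilinear t_closed) (use ml Suc in simp)
    have FG: "F - G = diff m K"
    proof
      fix xs
      show "(F - G) xs = diff m K xs"
      proof (cases "xs \<in> tuples A (Suc m)")
        case True
        have "contraction (diff (Suc m) F) t xs = 0"
          by (rule tuple_linear_zero[OF contraction_tuple_linear[OF t_closed True]])
             (use F(2) Suc in simp)
        with averaging_homotopy_Suc[of m F xs] True ml Suc eq[of xs] show ?thesis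
          by (simp add: K_def diff_restrict_tuples)
      next
        case False
        thus ?thesis using out[of xs] by (simp add: Suc diff_outside G_def restrict_tuples_def)
      qed
    qed
    have "diff n F - diff n G = 0"
      unfolding diff_minus[symmetric] FG Suc by (simp add: diff_diff zero_fun_def)
    with F(2) have "diff n G = 0" by simp
    moreover have "F - G \<in> trivial_coboundaries A \<epsilon> n"
      unfolding FG using K by (simp add: trivial_coboundaries_eq Suc)
    ultimately show ?thesis by blast
  qed
  ultimately show ?thesis using G that by blast
qed

end

section \<open>Module algebras and the action on cochains\<close>

locale augmented_module_algebra =
  H: hopf_algebra sH \<Delta>H \<epsilon>H SH + B: k_algebra sB
  for sH :: "'k::field \<Rightarrow> 'h::ring_1 \<Rightarrow> 'h" and \<Delta>H \<epsilon>H SH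
    and sB :: "'k \<Rightarrow> 'b::ring_1 \<Rightarrow> 'b" +
  fixes act :: "'h \<Rightarrow> 'b \<Rightarrow> 'b" and \<epsilon>B :: "'b \<Rightarrow> 'k"
  assumes act_linear_left: "linear_between (whole sH) (whole sB) (\<lambda>h. act h v)"
    and act_linear_right: "linear_between (whole sB) (whole sB) (act h)"
    and act_one: "act 1 v = v"
    and act_mult: "act (g * h) v = act g (act h v)"
    and mult_act: "act h (x * y) = sweedler sB (\<Delta>H h) (\<lambda>h1 h2. act h1 x * act h2 y)"
    and one_act: "act h 1 = sB (\<epsilon>H h) 1"
    and augmentation_linear: "linear_functional (whole sB) \<epsilon>B"
    and augmentation_act: "\<epsilon>B (act h x) = \<epsilon>H h * \<epsilon>B x"
    and augmentation_one: "\<epsilon>B 1 = 1"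
    and augmentation_mult: "\<epsilon>B (x * y) = \<epsilon>B x * \<epsilon>B y"
begin

sublocale BA: augmented_algebra "whole_alg sB" \<epsilon>B
  by unfold_locales
    (simp_all add: linear_between_def distrib_left distrib_right B.scale_mult_left
      B.scale_mult_right mult.assoc augmentation_mult augmentation_one
      linear_functional_whole_alg augmentation_linear[unfolded linear_functional_iff, simplified])

abbreviation HV where "HV \<equiv> whole sH"
abbreviation BV where "BV \<equiv> whole sB"
abbreviation BAlg where "BAlg \<equiv> whole_alg sB"
abbreviation sw where "sw h \<equiv> sweedler (*) (\<Delta>H h)"
abbreviation ract where "ract f h \<equiv> cochain_right \<Delta>H \<epsilon>H act f h"

lemma functional_act_left: "linear_functional BV \<phi> \<Longrightarrow> linear_functional HV (\<lambda>h. \<phi> (act h v))"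
  by (rule linear_functional_comp[OF act_linear_left])

lemma functional_act_right: "linear_functional BV \<phi> \<Longrightarrow> linear_functional BV (\<lambda>v. \<phi> (act h v))"
  by (rule linear_functional_comp[OF act_linear_right])

lemma mult_act_functional:
  "linear_functional BV \<phi> \<Longrightarrow> \<phi> (act h (x * y)) = sw h (\<lambda>h1 h2. \<phi> (act h1 x * act h2 y))"
  by (simp only: mult_act functional_sweedler[OF B.vector_space_axioms])

lemma functional_scale_B: "linear_functional BV \<phi> \<Longrightarrow> \<phi> (sB c x) = c * \<phi> x"
  by (simp add: linear_functional_iff)

lemma ract_Nil [simp]: "ract f h [] = \<epsilon>H h * f []"
proof -
  have "flin (*) f (fscale (\<epsilon>H h) (gen [])) = \<epsilon>H h * f []"
    by (simp add: flin_field)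
  thus ?thesis by (simp add: cochain_right_def)
qed

lemma ract_Cons [simp]:
  "ract f h (b # bs) = sw h (\<lambda>h1 h2. ract (\<lambda>ys. f (act h1 b # ys)) h2 bs)"
  by (simp add: cochain_right_def flin_fsweedler flin_flin)

lemma ract_tuple_linear:
  "bs \<in> tuples BAlg n \<Longrightarrow> tuple_linear BAlg n (\<lambda>f. ract f h bs)"
proof (induction bs arbitrary: h n)
  case Nil
  thus ?case by (simp add: tuple_linear_cmultI tuple_linear_eval)
next
  case (Cons b bs)
  then obtain m where "n = Suc m" "bs \<in> tuples BAlg m" by (auto elim: tuples_Cons_cases)
  with Cons.IH show ?case
    by (auto intro!: tuple_linear_sweedlerI tuple_linear_ConsI)
qed

lemma ract_slice:
  assumes "multilinear BAlg (Suc n) f" "bs \<in> tuples BAlg n"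
  shows "linear_functional BV (\<lambda>b. ract (\<lambda>ys. f (b # ys)) h bs)"
  using linear_functional_slice[OF ract_tuple_linear[OF assms(2)] assms(1)]
  by (simp add: linear_functional_whole_alg)

lemma ract_linear:
  "multilinear BAlg n f \<Longrightarrow> bs \<in> tuples BAlg n \<Longrightarrow> linear_functional HV (\<lambda>h. ract f h bs)"
proof (induction bs arbitrary: f n)
  case Nil
  thus ?case by (simp add: linear_functional_multc H.counit_linear)
next
  case (Cons b bs)
  then obtain m where m: "n = Suc m" "bs \<in> tuples BAlg m" by (auto elim: tuples_Cons_cases)
  have "multilinear BAlg m (\<lambda>ys. f (c # ys))" for c using Cons.prems m by simp
  thus ?case
    unfolding ract_Cons
    by (intro H.comult_functional bilinear_formI functional_act_left ract_slice Cons.IH)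
       (use Cons.prems m in simp_all)
qed

lemma ract_bilinear:
  assumes "multilinear BAlg (Suc n) f" "bs \<in> tuples BAlg n"
  shows "bilinear_form HV HV (\<lambda>h1 h2. ract (\<lambda>ys. f (act h1 b # ys)) h2 bs)"
  using assms by (intro bilinear_formI functional_act_left ract_slice ract_linear) simp_all

lemma ract_multilinear: "multilinear BAlg n f \<Longrightarrow> multilinear BAlg n (ract f h)"
proof (induction n arbitrary: f h)
  case (Suc n)
  have "linear_functional BV (\<lambda>b. ract (\<lambda>ys. f (act h1 b # ys)) h2 bs)"
    if "bs \<in> tuples BAlg n" for bs h1 h2
    using functional_act_right[OF ract_slice[OF Suc.prems that]] .
  with Suc show ?case
    by (auto simp: linear_functional_whole_alg intro!: multilinear_sweedler linear_functional_sweedler)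
qed simp

lemma ract_ract:
  "multilinear BAlg n f \<Longrightarrow> bs \<in> tuples BAlg n \<Longrightarrow> ract (ract f g) h bs = ract f (g * h) bs"
proof (induction bs arbitrary: f g h n)
  case Nil
  thus ?case by (simp add: H.counit_mult)
next
  case (Cons b bs)
  then obtain m where m: "n = Suc m" "bs \<in> tuples BAlg m" by (auto elim: tuples_Cons_cases)
  note f = Cons.prems(1)[unfolded m(1)]
  have ml: "multilinear BAlg m (\<lambda>ys. f (c # ys))" for c using f by simp
  have "ract (ract f g) h (b # bs) =
      sw h (\<lambda>h1 h2. sw g (\<lambda>g1 g2. ract (ract (\<lambda>ys. f (act g1 (act h1 b) # ys)) g2) h2 bs))"
    by (simp add: tuple_linear_sweedler[OF ract_tuple_linear[OF m(2)]])
  also have "\<dots> = sw g (\<lambda>g1 g2. sw h (\<lambda>h1 h2. ract (\<lambda>ys. f (act (g1 * h1) b # ys)) (g2 * h2) bs))"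
    by (simp add: Cons.IH[OF ml m(2)] act_mult sweedler_swap[of "\<Delta>H h"])
  also have "\<dots> = ract f (g * h) (b # bs)"
    by (simp add: H.comult_mult_functional[OF ract_bilinear[OF f m(2)]])
  finally show ?case .
qed

lemma ract_one: "multilinear BAlg n f \<Longrightarrow> bs \<in> tuples BAlg n \<Longrightarrow> ract f 1 bs = f bs"
proof (induction bs arbitrary: f n)
  case Nil
  thus ?case by (simp add: H.counit_one)
next
  case (Cons b bs)
  then obtain m where m: "n = Suc m" "bs \<in> tuples BAlg m" by (auto elim: tuples_Cons_cases)
  show ?case
    using Cons.prems m
    by (simp add: H.comult_one_functional[OF ract_bilinear[of m]] act_one Cons.IH[of m])
qed

lemma ract_cochain:
  assumes "f \<in> cochains BAlg (*) n"
  shows "ract f h \<in> cochains BAlg (*) n"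
proof -
  have "ract f h bs = 0" if "bs \<notin> tuples BAlg n" for bs
  proof (rule tuple_linear_zero[OF ract_tuple_linear])
    show "bs \<in> tuples BAlg (length bs)" by (simp add: tuples_def)
    show "f xs = 0" if "xs \<in> tuples BAlg (length bs)" for xs
      using assms that \<open>bs \<notin> tuples BAlg n\<close> by (simp add: cochains_iff tuples_def)
  qed
  thus ?thesis using assms by (simp add: cochains_iff ract_multilinear)
qed

text \<open>
  The multiplication of a module algebra being equivariant, moving \<open>h\<close> past the differential only
  re-brackets its iterated coproduct.
\<close>

lemma inner_diff_ract:
  "multilinear BAlg n f \<Longrightarrow> bs \<in> tuples BAlg n \<Longrightarrow>
    BA.inner_diff (ract f h) b bs = sw h (\<lambda>h1 h2. ract (BA.inner_diff f (act h1 b)) h2 bs)"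
proof (induction bs arbitrary: f b h n)
  case Nil
  have "sw h (\<lambda>h1 h2. \<epsilon>H h1 * \<epsilon>H h2) = \<epsilon>H h"
    by (rule H.counit_left_functional[OF H.counit_linear])
  moreover have "sw h (\<lambda>h1 h2. \<epsilon>H h2 * (\<epsilon>H h1 * \<epsilon>B b * f [])) =
      sw h (\<lambda>h1 h2. \<epsilon>H h1 * \<epsilon>H h2) * (\<epsilon>B b * f [])"
    unfolding sweedler_multc[symmetric] by (simp add: mult_ac)
  ultimately show ?case by (simp add: augmentation_act)
next
  case (Cons c bs)
  then obtain m where m: "n = Suc m" "bs \<in> tuples BAlg m" by (auto elim: tuples_Cons_cases)
  note f = Cons.prems(1)[unfolded m(1)]
  have ml: "multilinear BAlg m (\<lambda>ys. f (c # ys))" for c using f by simp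
  note [simp] = tuple_linear_diff[OF ract_tuple_linear[OF m(2)]]
    tuple_linear_sweedler[OF BA.inner_diff_tuple_linear[OF _ m(2)]]
  note slice = ract_slice[OF f m(2)]
  have "sw h (\<lambda>h1 h2. ract (\<lambda>ys. f (act h1 (b * c) # ys)) h2 bs) =
      sw h (\<lambda>h1 h2. sw h1 (\<lambda>k l. ract (\<lambda>ys. f (act k b * act l c # ys)) h2 bs))"
    by (subst mult_act_functional[OF slice]) (rule refl)
  also have "\<dots> = sw h (\<lambda>h1 h2. sw h2 (\<lambda>k l. ract (\<lambda>ys. f (act h1 b * act k c # ys)) l bs))"
    by (rule H.coassoc_functional;
        intro ract_linear[OF ml m(2)] functional_act_left[of "\<lambda>v. ract (\<lambda>ys. f (v * _ # ys)) _ bs"]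
          functional_act_left[of "\<lambda>v. ract (\<lambda>ys. f (_ * v # ys)) _ bs"]
          B.functional_mult_left[OF slice] B.functional_mult_right[OF slice])
  finally show ?case
    by (simp add: Cons.IH[OF ml m(2)] sweedler_diff)
qed

text \<open>The one face not covered by \<open>inner_diff_ract\<close> is equivariant because \<open>\<epsilon>B\<close> is.\<close>

lemma diff_ract:
  assumes f: "f \<in> cochains BAlg (*) n"
  shows "BA.diff n (ract f h) = ract (BA.diff n f) h"
proof
  fix xs
  have ml: "multilinear BAlg n f" using f by (simp add: cochains_iff)
  show "BA.diff n (ract f h) xs = ract (BA.diff n f) h xs"
  proof (cases "xs \<in> tuples BAlg (Suc n)")
    case True
    then obtain b bs where xs: "xs = b # bs" and bs: "bs \<in> tuples BAlg n"
      by (auto elim: tuples_Suc_cases)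
    note lin = ract_tuple_linear[OF bs]
    have "ract (\<lambda>ys. BA.diff n f (act h1 b # ys)) h2 bs =
        \<epsilon>H h1 * ract f h2 bs * \<epsilon>B b - ract (BA.inner_diff f (act h1 b)) h2 bs" for h1 h2
    proof -
      have "ract (\<lambda>ys. BA.diff n f (act h1 b # ys)) h2 bs =
          ract (\<lambda>ys. \<epsilon>H h1 * \<epsilon>B b * f ys - BA.inner_diff f (act h1 b) ys) h2 bs"
        by (rule tuple_linear_cong[OF lin]) (simp add: BA.diff_Cons augmentation_act)
      thus ?thesis by (simp add: tuple_linear_diff[OF lin] tuple_linear_cmult[OF lin] mult_ac)
    qed
    moreover have "sw h (\<lambda>h1 h2. \<epsilon>H h1 * ract f h2 bs) = ract f h bs"
      by (rule H.counit_left_functional[OF ract_linear[OF ml bs]])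
    ultimately show ?thesis
      using bs by (simp add: xs BA.diff_Cons inner_diff_ract[OF ml bs] sweedler_diff sweedler_multc
          mult.commute[of "\<epsilon>B b"])
  next
    case False
    hence "ract (BA.diff n f) h xs = 0"
      using ract_cochain[OF BA.diff_cochain[OF f]] by (simp add: cochains_iff)
    thus ?thesis using False by (simp add: BA.diff_outside)
  qed
qed

end

section \<open>The smash product\<close>

locale smash_product =
  augmented_module_algebra sH \<Delta>H \<epsilon>H SH sB act \<epsilon>B
  for sH :: "'k::field \<Rightarrow> 'h::ring_1 \<Rightarrow> 'h" and \<Delta>H \<epsilon>H SH
    and sB :: "'k \<Rightarrow> 'b::ring_1 \<Rightarrow> 'b" and act \<epsilon>B +
  fixes coact :: "'b \<Rightarrow> ('h \<times> 'b \<Rightarrow>\<^sub>0 'k) set" and \<Delta>B :: "'b \<Rightarrow> ('b \<times> 'b \<Rightarrow>\<^sub>0 'k) set"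
begin

text \<open>
  The smash product is the algebra underlying the bosonization.
\<close>

definition A where "A = bosonization sH \<Delta>H \<epsilon>H sB act coact \<Delta>B \<epsilon>B"

abbreviation T where "T \<equiv> tensor BV HV"
abbreviation p where "p \<equiv> pure_tensor BV HV"
abbreviation mult (infixl "\<cdot>" 70) where "X \<cdot> Y \<equiv> amult A X Y"

lemma A_simps:
  "car A = car T" "vadd A = vadd T" "vzero A = vzero T" "vscale A = vscale T" "aone A = p 1 1"
  "acounit A = (\<lambda>X. sweedler (*) X (\<lambda>b h. \<epsilon>B b * \<epsilon>H h))"
  by (simp_all add: A_def bosonization_def Let_def)

lemma functional_A: "linear_functional A = linear_functional T"
  by (simp add: fun_eq_iff linear_functional_iff A_simps)

lemma p_closed [simp]: "p b h \<in> car A"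
  by (simp add: A_simps pure_tensor_in_car)

lemma bilinear_p: "linear_functional A \<phi> \<Longrightarrow> bilinear_form BV HV (\<lambda>b h. \<phi> (p b h))"
  unfolding functional_A by (rule bilinear_form_pure_tensor)

lemma functional_p:
  assumes "linear_functional A \<phi>"
  shows "linear_functional BV (\<lambda>b. \<phi> (p b h))" "linear_functional HV (\<lambda>h. \<phi> (p b h))"
  using bilinear_formD[OF bilinear_p[OF assms]] by simp_all

lemma functional_eq_on_p:
  assumes "linear_functional A \<phi>" "linear_functional A \<psi>" "\<And>b h. \<phi> (p b h) = \<psi> (p b h)"
    and "X \<in> car A"
  shows "\<phi> X = \<psi> X"
  using functional_ext[of sB sH \<phi> \<psi>] assms by (simp add: functional_A A_simps)

lemma A_eqI:
  "X \<in> car A \<Longrightarrow> Y \<in> car A \<Longrightarrow> (\<And>\<phi>. linear_functional A \<phi> \<Longrightarrow> \<phi> X = \<phi> Y) \<Longrightarrow> X = Y"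
  unfolding functional_A by (rule eq_by_tensor_functionals[of X sB sH]) (simp_all add: A_simps)

text \<open>The values of a bilinear form \<open>\<beta>\<close> on the formal product \<open>(b h\<^sub>1 b') \<otimes> (h\<^sub>2 h')\<close>.\<close>

abbreviation product_form :: "('b \<Rightarrow> 'h \<Rightarrow> 'k) \<Rightarrow> 'b \<Rightarrow> 'h \<Rightarrow> 'b \<Rightarrow> 'h \<Rightarrow> 'k"
  where "product_form \<beta> b h b' h' \<equiv> sw h (\<lambda>h1 h2. \<beta> (b * act h1 b') (h2 * h'))"

lemma product_form_bilinear:
  assumes \<beta>: "bilinear_form BV HV \<beta>"
  shows "bilinear_form HV HV (\<lambda>h1 h2. \<beta> (b * act h1 b') (h2 * h'))"
    and "bilinear_form BV HV (\<lambda>b h. product_form \<beta> b h b' h')"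
    and "bilinear_form BV HV (\<lambda>b' h'. product_form \<beta> b h b' h')"
proof -
  have \<beta>B: "linear_functional BV (\<lambda>b. \<beta> b h)" and \<beta>H: "linear_functional HV (\<lambda>h. \<beta> b h)" for b h
    using bilinear_formD[OF \<beta>] by simp_all
  show 1: "bilinear_form HV HV (\<lambda>h1 h2. \<beta> (b * act h1 b') (h2 * h'))" for b b' h'
    by (intro bilinear_formI functional_act_left[of "\<lambda>v. \<beta> (b * v) _"]
        B.functional_mult_left[OF \<beta>B] H.functional_mult_right[OF \<beta>H])
  show "bilinear_form BV HV (\<lambda>b h. product_form \<beta> b h b' h')"
    by (intro bilinear_formI linear_functional_sweedler H.comult_functional 1
        B.functional_mult_right[OF \<beta>B])
  show "bilinear_form BV HV (\<lambda>b' h'. product_form \<beta> b h b' h')"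
    by (intro bilinear_formI linear_functional_sweedler functional_act_right[of "\<lambda>v. \<beta> (b * v) _"]
        B.functional_mult_left[OF \<beta>B] H.functional_mult_left[OF \<beta>H])
qed

text \<open>
  The product formula respects the tensor relations: on each bilinear form it takes the values of
  \<open>product_form\<close>, which is bilinear in both pairs of arguments.
\<close>

lemma mult_tclass:
  "tclass BV HV r \<cdot> tclass BV HV q = tclass BV HV (flin fscale (\<lambda>(b, h).
     flin fscale (\<lambda>(b', h'). fsweedler (\<Delta>H h) (\<lambda>h1 h2. gen (b * act h1 b', h2 * h'))) q) r)"
  (is "_ = tclass BV HV (?\<mu> r q)")
proof -
  let ?N = "tensor_rel BV HV"
  have val: "flin (*) (\<lambda>(b, h). \<beta> b h) (?\<mu> x y) =
      flin (*) (\<lambda>(b, h). flin (*) (\<lambda>(b', h'). product_form \<beta> b h b' h') y) x" for \<beta> x y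
    by (simp add: flin_flin flin_fsweedler case_prod_unfold)
  have rel: "?\<mu> x y - ?\<mu> r q \<in> ?N" if x: "x - r \<in> ?N" and y: "y - q \<in> ?N" for x y
  proof (rule tensor_relI)
    fix \<beta> assume \<beta>: "bilinear_form BV HV \<beta>"
    let ?\<gamma> = "\<lambda>y b h. flin (*) (\<lambda>(b', h'). product_form \<beta> b h b' h') y"
    have "?\<gamma> y b h = ?\<gamma> q b h" for b h
      using bilinear_form_vanishes[OF product_form_bilinear(3)[OF \<beta>] y] by (simp add: flin_field)
    moreover have "bilinear_form BV HV (?\<gamma> q)"
      unfolding flin_def case_prod_unfold
      by (intro bilinear_formI linear_functional_sum linear_functional_cmult
          bilinear_formD[OF product_form_bilinear(2)[OF \<beta>]]) simp_all
    from bilinear_form_vanishes[OF this x]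
    have "flin (*) (\<lambda>(b, h). ?\<gamma> q b h) x = flin (*) (\<lambda>(b, h). ?\<gamma> q b h) r" by (simp add: flin_field)
    ultimately show "flin (*) (\<lambda>(b, h). \<beta> b h) (?\<mu> x y - ?\<mu> r q) = 0"
      by (simp only: flin_field val diff_self)
  qed
  have "induced2 ?N (\<lambda>X Y. ?\<mu> X Y) (tclass BV HV r) (tclass BV HV q) = coset ?N (?\<mu> r q)"
    unfolding tclass_def
    by (rule free.induced2_coset[OF subspace_tensor_rel refl zero_tensor_rel refl zero_tensor_rel])
       (rule rel; simp add: mem_coset)
  thus ?thesis by (simp add: A_def bosonization_def Let_def tclass_def)
qed

lemma A_cases: "X \<in> car A \<Longrightarrow> \<exists>r. X = tclass BV HV r"
  by (simp add: A_simps car_tensor)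

lemma mult_functional:
  assumes "linear_functional A \<phi>" "X \<in> car A" "Y \<in> car A"
  shows "\<phi> (X \<cdot> Y) = sweedler (*) X (\<lambda>b h. sweedler (*) Y (\<lambda>b' h'. product_form (\<lambda>b h. \<phi> (p b h)) b h b' h'))"
proof -
  obtain r q where r: "X = tclass BV HV r" "Y = tclass BV HV q"
    using A_cases assms by metis
  note \<beta> = bilinear_p[OF assms(1)]
  let ?\<gamma> = "\<lambda>b h. flin (*) (\<lambda>(b', h'). product_form (\<lambda>b h. \<phi> (p b h)) b h b' h') q"
  have "bilinear_form BV HV ?\<gamma>"
    unfolding flin_def case_prod_unfold
    by (intro bilinear_formI linear_functional_sum linear_functional_cmult
        bilinear_formD[OF product_form_bilinear(2)[OF \<beta>]]) simp_all
  from sweedler_tclass[OF this, of r] show ?thesis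
    using assms(1)
    by (simp add: r mult_tclass functional_tclass functional_A sweedler_tclass[OF product_form_bilinear(3)[OF \<beta>]]
        flin_flin flin_fsweedler case_prod_unfold)
qed

lemma mult_closed: "X \<in> car A \<Longrightarrow> Y \<in> car A \<Longrightarrow> X \<cdot> Y \<in> car A"
  by (auto dest!: A_cases simp: mult_tclass A_simps car_tensor_whole)

lemma add_closed: "X \<in> car A \<Longrightarrow> Y \<in> car A \<Longrightarrow> vadd A X Y \<in> car A"
  and scale_closed: "X \<in> car A \<Longrightarrow> vscale A c X \<in> car A"
  by (auto dest!: A_cases simp: A_simps car_tensor_whole vadd_tclass vscale_tclass)

lemma mult_functional_left:
  assumes \<phi>: "linear_functional A \<phi>" and Y: "Y \<in> car A"
  shows "linear_functional A (\<lambda>X. \<phi> (X \<cdot> Y))"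
proof -
  have "bilinear_form BV HV (\<lambda>b h. sweedler (*) Y (\<lambda>b' h'. product_form (\<lambda>b h. \<phi> (p b h)) b h b' h'))"
    by (intro bilinear_formI linear_functional_sweedler
        bilinear_formD[OF product_form_bilinear(2)[OF bilinear_p[OF \<phi>]]]) simp_all
  from linear_functional_sweedler_tensor[OF this]
  have "linear_functional A (\<lambda>X. sweedler (*) X (\<lambda>b h. sweedler (*) Y
      (\<lambda>b' h'. product_form (\<lambda>b h. \<phi> (p b h)) b h b' h')))" by (simp add: functional_A)
  thus ?thesis
    using Y mult_functional[OF \<phi> _ Y] by (simp add: linear_functional_iff add_closed scale_closed)
qed

lemma mult_functional_right:
  assumes \<phi>: "linear_functional A \<phi>" and X: "X \<in> car A"
  shows "linear_functional A (\<lambda>Y. \<phi> (X \<cdot> Y))"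
proof -
  have "linear_functional A (\<lambda>Y. sweedler (*) X (\<lambda>b h. sweedler (*) Y
      (\<lambda>b' h'. product_form (\<lambda>b h. \<phi> (p b h)) b h b' h')))"
    unfolding functional_A
    by (intro linear_functional_sweedler linear_functional_sweedler_tensor
        product_form_bilinear(3)[OF bilinear_p[OF \<phi>]])
  thus ?thesis
    using X mult_functional[OF \<phi> X] by (simp add: linear_functional_iff add_closed scale_closed)
qed

lemma functional_mult_p:
  assumes "linear_functional A \<phi>"
  shows "\<phi> (p b h \<cdot> p b' h') = sw h (\<lambda>h1 h2. \<phi> (p (b * act h1 b') (h2 * h')))"
  using product_form_bilinear(2,3)[OF bilinear_p[OF assms]]
  by (simp add: mult_functional[OF assms] sweedler_pure_tensor)

lemma p_one_mult_p: "p b 1 \<cdot> p b' h' = p (b * b') h'"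
proof (rule A_eqI)
  fix \<phi> assume "linear_functional A \<phi>"
  thus "\<phi> (p b 1 \<cdot> p b' h') = \<phi> (p (b * b') h')"
    using H.comult_one_functional[OF product_form_bilinear(1)[OF bilinear_p]]
    by (simp add: functional_mult_p act_one)
qed (simp_all add: mult_closed)

lemma p_mult_one_p: "p b h \<cdot> p 1 k = p b (h * k)"
proof (rule A_eqI)
  fix \<phi> assume \<phi>: "linear_functional A \<phi>"
  have "sw h (\<lambda>h1 h2. \<epsilon>H h1 * \<phi> (p b (h2 * k))) = \<phi> (p b (h * k))"
    by (rule H.counit_left_functional[OF H.functional_mult_right[OF functional_p(2)[OF \<phi>]]])
  thus "\<phi> (p b h \<cdot> p 1 k) = \<phi> (p b (h * k))"
    by (simp add: functional_mult_p[OF \<phi>] one_act B.scale_mult_right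
        functional_scale_B[OF functional_p(1)[OF \<phi>]])
qed (simp_all add: mult_closed)

text \<open>
  Both sides are \<open>b (h\<^sub>1 b') (h\<^sub>2 h'\<^sub>1 b'') \<otimes> h\<^sub>3 h'\<^sub>2 h''\<close>, with the threefold coproduct of \<open>h\<close> bracketed
  differently.
\<close>

lemma p_assoc: "p b h \<cdot> p b' h' \<cdot> p b'' h'' = p b h \<cdot> (p b' h' \<cdot> p b'' h'')"
proof (rule A_eqI)
  fix \<phi> assume \<phi>: "linear_functional A \<phi>"
  note \<beta> = bilinear_p[OF \<phi>] and left = mult_functional_left[OF \<phi> p_closed]
    and right = mult_functional_right[OF \<phi> p_closed]
  let ?F = "\<lambda>x y z h2 c'. \<phi> (p (b * (act x b' * act y (act z b''))) (h2 * (c' * h'')))"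
  have lin: "linear_functional HV (\<lambda>x. ?F x y z w v)" "linear_functional HV (\<lambda>y. ?F x y z w v)"
    "linear_functional HV (\<lambda>w. ?F x y z w v)" for x y z w v
    by (intro functional_act_left[of "\<lambda>u. \<phi> (p (b * (u * _)) _)"]
        functional_act_left[of "\<lambda>u. \<phi> (p (b * (_ * u)) _)"]
        B.functional_mult_left[of "\<lambda>u. \<phi> (p (b * u) _)"]
        B.functional_mult_right[of "\<lambda>u. \<phi> (p (b * u) _)"] B.functional_mult_left
        H.functional_mult_right[OF functional_p(2)[OF \<phi>]] functional_p(1)[OF \<phi>])+
  have "\<phi> (p b h \<cdot> p b' h' \<cdot> p b'' h'') =
      sw h (\<lambda>h1 h2. sw h2 (\<lambda>a c. sw h' (\<lambda>a' c'. ?F h1 a a' c c')))"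
    unfolding functional_mult_p[OF left] functional_mult_p[OF \<phi>]
      H.comult_mult_functional[OF product_form_bilinear(1)[OF \<beta>]]
    by (simp only: act_mult mult.assoc)
  also have "\<dots> = sw h (\<lambda>h1 h2. sw h1 (\<lambda>a c. sw h' (\<lambda>a' c'. ?F a c a' h2 c')))"
    by (rule H.coassoc_functional[symmetric]; intro linear_functional_sweedler lin)
  also have "\<dots> = sw h (\<lambda>h1 h2. sw h' (\<lambda>a' c'. \<phi> (p (b * act h1 (b' * act a' b'')) (h2 * (c' * h'')))))"
    by (simp add: mult_act_functional[OF B.functional_mult_left[OF functional_p(1)[OF \<phi>]]]
        sweedler_swap[of "\<Delta>H h'"])
  also have "\<dots> = \<phi> (p b h \<cdot> (p b' h' \<cdot> p b'' h''))"
    by (simp add: functional_mult_p[OF right] functional_mult_p[OF \<phi>] sweedler_swap[of "\<Delta>H h'"])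
  finally show "\<phi> (p b h \<cdot> p b' h' \<cdot> p b'' h'') = \<phi> (p b h \<cdot> (p b' h' \<cdot> p b'' h''))" .
qed (simp_all add: mult_closed)

lemma acounit_linear: "linear_functional A (acounit A)"
proof -
  have "bilinear_form BV HV (\<lambda>b h. \<epsilon>B b * \<epsilon>H h)"
    by (intro bilinear_formI linear_functional_multc linear_functional_cmult
        augmentation_linear H.counit_linear)
  from linear_functional_sweedler_tensor[OF this] show ?thesis
    by (simp add: functional_A A_simps)
qed

lemma acounit_p [simp]: "acounit A (p b h) = \<epsilon>B b * \<epsilon>H h"
proof -
  have "bilinear_form BV HV (\<lambda>b h. \<epsilon>B b * \<epsilon>H h)"
    by (intro bilinear_formI linear_functional_multc linear_functional_cmult
        augmentation_linear H.counit_linear)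
  thus ?thesis by (simp add: A_simps sweedler_pure_tensor)
qed

lemma acounit_mult_p: "acounit A (p b h \<cdot> p b' h') = \<epsilon>B b * \<epsilon>H h * (\<epsilon>B b' * \<epsilon>H h')"
proof -
  have "acounit A (p b h \<cdot> p b' h') =
      sw h (\<lambda>h1 h2. \<epsilon>H h1 * \<epsilon>H h2 * (\<epsilon>B b * \<epsilon>B b' * \<epsilon>H h'))"
    by (simp add: functional_mult_p[OF acounit_linear] augmentation_mult augmentation_act
        H.counit_mult mult_ac)
  also have "\<dots> = \<epsilon>H h * (\<epsilon>B b * \<epsilon>B b' * \<epsilon>H h')"
    by (simp only: sweedler_multc H.counit_left_functional[OF H.counit_linear])
  finally show ?thesis by (simp add: mult_ac)
qed

sublocale AA: augmented_algebra A "acounit A"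
proof
  note left = mult_functional_left and right = mult_functional_right
  fix X Y assume XY: "X \<in> car A" "Y \<in> car A"
  show "vadd A X Y \<in> car A" "X \<cdot> Y \<in> car A"
    using XY by (simp_all add: add_closed mult_closed)
  fix Z assume Z: "Z \<in> car A"
  show "X \<cdot> Y \<cdot> Z = X \<cdot> (Y \<cdot> Z)"
  proof (rule A_eqI)
    fix \<phi> assume \<phi>: "linear_functional A \<phi>"
    have "\<phi> (p b h \<cdot> p b' h' \<cdot> Z) = \<phi> (p b h \<cdot> (p b' h' \<cdot> Z))" for b h b' h'
      by (rule functional_eq_on_p[OF right[OF \<phi> mult_closed[OF p_closed p_closed]]
            right[OF right[OF \<phi> p_closed] p_closed] _ Z]) (simp only: p_assoc)
    hence "\<phi> (p b h \<cdot> Y \<cdot> Z) = \<phi> (p b h \<cdot> (Y \<cdot> Z))" for b h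
      by (rule functional_eq_on_p[OF right[OF left[OF \<phi> Z] p_closed]
            left[OF right[OF \<phi> p_closed] Z] _ XY(2)])
    thus "\<phi> (X \<cdot> Y \<cdot> Z) = \<phi> (X \<cdot> (Y \<cdot> Z))"
      by (rule functional_eq_on_p[OF left[OF left[OF \<phi> Z] XY(2)]
            left[OF \<phi> mult_closed[OF XY(2) Z]] _ XY(1)])
  qed (use XY Z in \<open>simp_all add: mult_closed\<close>)
next
  fix X assume X: "X \<in> car A"
  show "vscale A c X \<in> car A" for c
    using X by (rule scale_closed)
  show "linear_between A A (\<lambda>Y. X \<cdot> Y)"
    unfolding linear_between_def
    by (intro conjI ballI allI A_eqI)
       (use X mult_functional_right in \<open>simp_all add: mult_closed add_closed scale_closed
         linear_functional_iff\<close>)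
  show "linear_between A A (\<lambda>Y. Y \<cdot> X)"
    unfolding linear_between_def
    by (intro conjI ballI allI A_eqI)
       (use X mult_functional_left in \<open>simp_all add: mult_closed add_closed scale_closed
         linear_functional_iff\<close>)
  show "X \<cdot> aone A = X"
    by (rule A_eqI, simp_all add: A_simps(5) X mult_closed, rule functional_eq_on_p[OF _ _ _ X])
       (simp_all add: mult_functional_left p_mult_one_p)
next
  fix X Y assume XY: "X \<in> car A" "Y \<in> car A"
  have "acounit A (p b h \<cdot> Y) = acounit A (p b h) * acounit A Y" for b h
    by (rule functional_eq_on_p[OF mult_functional_right[OF acounit_linear p_closed]
          linear_functional_cmult[OF acounit_linear] _ XY(2)]) (simp only: acounit_mult_p acounit_p)
  thus "acounit A (X \<cdot> Y) = acounit A X * acounit A Y"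
    by (rule functional_eq_on_p[OF mult_functional_left[OF acounit_linear XY(2)]
          linear_functional_multc[OF acounit_linear] _ XY(1)])
qed (simp_all add: A_simps(5) acounit_linear augmentation_one H.counit_one)

end

context smash_product
begin

text \<open>
  The index set runs over a formal sum representing \<open>\<Lambda>\<^sub>1 \<otimes> \<Lambda>\<^sub>2\<close>; its coefficients are absorbed into the
  first factors.
\<close>

lemma integral_separable:
  assumes \<Lambda>: "\<And>h. h * \<Lambda> = sH (\<epsilon>H h) \<Lambda>" "\<epsilon>H \<Lambda> = 1"
  shows "separable_subalgebra A (acounit A)
    (Poly_Mapping.keys (SOME r. r \<in> \<Delta>H \<Lambda>))
    (\<lambda>i. p 1 (sH (Poly_Mapping.lookup (SOME r. r \<in> \<Delta>H \<Lambda>) i) (fst i)))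
    (\<lambda>i. p 1 (SH (snd i))) (p 1 (SH \<Lambda>)) (range (p 1))"
    (is "separable_subalgebra _ _ ?I ?e ?e' _ _")
proof -
  have sum: "(\<Sum>i\<in>?I. \<beta> (?e i) (?e' i)) = sw \<Lambda> (\<lambda>x y. \<beta> (p 1 x) (p 1 (SH y)))"
    if \<beta>: "bilinear_form A A \<beta>" for \<beta>
    unfolding sweedler_eq_sum
    by (rule sum.cong[OF refl], rule linear_functional_scale[OF functional_p(2), simplified])
       (use bilinear_formD(1)[OF \<beta>] in simp)
  have mult_form: "bilinear_form A A (\<lambda>v w. \<phi> (v \<cdot> w))" if "linear_functional A \<phi>" for \<phi>
    using that by (intro bilinear_formI mult_functional_left mult_functional_right)
  have counit_form: "bilinear_form A A (\<lambda>v w. acounit A v * \<phi> w)" if "linear_functional A \<phi>" for \<phi>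
    using that by (intro bilinear_formI linear_functional_multc linear_functional_cmult acounit_linear)
  show ?thesis
  proof
    fix \<phi> assume \<phi>: "linear_functional A \<phi>"
    have "sw \<Lambda> (\<lambda>x y. \<phi> (p 1 (x * SH y))) = \<epsilon>H \<Lambda> * \<phi> (p 1 1)"
      by (rule H.antipode_right_functional[OF functional_p(2)[OF \<phi>]])
    thus "(\<Sum>i\<in>?I. \<phi> (?e i \<cdot> ?e' i)) = \<phi> (aone A)"
      unfolding sum[OF mult_form[OF \<phi>]] by (simp add: p_mult_one_p \<Lambda>(2) A_simps(5))
    have "sw \<Lambda> (\<lambda>x y. \<epsilon>H x * \<phi> (p 1 (SH y))) = \<phi> (p 1 (SH \<Lambda>))"
      by (rule H.counit_left_functional[OF H.functional_antipode[OF functional_p(2)[OF \<phi>]]])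
    thus "(\<Sum>i\<in>?I. acounit A (?e i) * \<phi> (?e' i)) = \<phi> (p 1 (SH \<Lambda>))"
      unfolding sum[OF counit_form[OF \<phi>]] by (simp add: augmentation_one)
  next
    fix h \<beta> assume h: "h \<in> range (p 1)" and \<beta>: "bilinear_form A A \<beta>"
    then obtain k where k: "h = p 1 k" by blast
    have \<beta>1: "linear_functional A (\<lambda>v. \<beta> v w)" if "w \<in> car A" for w
      using bilinear_formD(1)[OF \<beta> that] .
    have \<beta>2: "linear_functional A (\<lambda>w. \<beta> v w)" if "v \<in> car A" for v
      using bilinear_formD(2)[OF \<beta> that] .
    have "bilinear_form HV HV (\<lambda>x y. \<beta> (p 1 x) (p 1 y))"
      by (rule bilinear_formI, rule functional_p(2)[OF \<beta>1[OF p_closed]],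
          rule functional_p(2)[OF \<beta>2[OF p_closed]])
    note central = H.integral_central[OF \<Lambda>(1) this, of k]
    have hA: "h \<in> car A" by (simp add: k)
    have "bilinear_form A A (\<lambda>v w. \<beta> (h \<cdot> v) w)"
      by (rule bilinear_formI[OF mult_functional_right[OF \<beta>1 hA] \<beta>2[OF mult_closed[OF hA]]])
    moreover have "bilinear_form A A (\<lambda>v w. \<beta> v (w \<cdot> h))"
      by (rule bilinear_formI[OF \<beta>1[OF mult_closed[OF _ hA]] mult_functional_left[OF \<beta>2 hA]])
    ultimately show "(\<Sum>i\<in>?I. \<beta> (h \<cdot> ?e i) (?e' i)) = (\<Sum>i\<in>?I. \<beta> (?e i) (?e' i \<cdot> h))"
      using central sum[of "\<lambda>v w. \<beta> (h \<cdot> v) w"] sum[of "\<lambda>v w. \<beta> v (w \<cdot> h)"]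
      by (simp add: k p_mult_one_p)
  qed auto
qed

section \<open>Restriction and inflation\<close>

definition restriction :: "(('b \<times> 'h \<Rightarrow>\<^sub>0 'k) set list \<Rightarrow> 'k) \<Rightarrow> 'b list \<Rightarrow> 'k"
  where "restriction F = (\<lambda>bs. F (map (\<lambda>b. p b 1) bs))"

lemma map_p_tuples: "map (\<lambda>b. p b 1) bs \<in> tuples A n \<longleftrightarrow> bs \<in> tuples BAlg n"
  by (auto simp: tuples_def)

lemma restriction_Nil [simp]: "restriction F [] = F []"
  and restriction_Cons: "restriction F (b # bs) = restriction (\<lambda>Xs. F (p b 1 # Xs)) bs"
  by (simp_all add: restriction_def)

lemma restriction_multilinear: "multilinear A n F \<Longrightarrow> multilinear BAlg n (restriction F)"
proof (induction n arbitrary: F)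
  case (Suc n)
  have "linear_functional BV (\<lambda>b. F (p b 1 # map (\<lambda>b. p b 1) bs))" if "bs \<in> tuples BAlg n" for bs
    by (rule functional_p(1)[of "\<lambda>X. F (X # _)"]) (use Suc.prems that map_p_tuples in auto)
  with Suc show ?case
    by (simp add: restriction_Cons linear_functional_whole_alg) (simp add: restriction_def)
qed simp

lemma restriction_cochain: "F \<in> cochains A (*) n \<Longrightarrow> restriction F \<in> cochains BAlg (*) n"
  by (simp add: cochains_iff restriction_multilinear) (simp add: restriction_def map_p_tuples)

lemma inner_diff_restriction:
  "BA.inner_diff (restriction F) b bs = AA.inner_diff F (p b 1) (map (\<lambda>b. p b 1) bs)"
  by (induction bs arbitrary: F b)
     (simp_all add: restriction_Cons p_one_mult_p H.counit_one, simp add: restriction_def)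

lemma diff_restriction: "BA.diff n (restriction F) = restriction (AA.diff n F)"
proof
  fix xs
  show "BA.diff n (restriction F) xs = restriction (AA.diff n F) xs"
  proof (cases "xs \<in> tuples BAlg (Suc n)")
    case True
    then obtain b bs where "xs = b # bs" "bs \<in> tuples BAlg n" by (auto elim: tuples_Suc_cases)
    thus ?thesis
      using map_p_tuples[of bs n]
      by (simp add: BA.diff_Cons inner_diff_restriction)
         (simp add: AA.diff_Cons restriction_def H.counit_one)
  next
    case False
    hence "map (\<lambda>b. p b 1) xs \<notin> tuples A (Suc n)" by (simp only: map_p_tuples not_False_eq_True)
    thus ?thesis using False by (simp add: BA.diff_outside AA.diff_outside restriction_def)
  qed
qed

text \<open>
  The recursion pushes \<open>h\<close> from the first argument \<open>b # h\<close> to all of the following ones, where it acts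
  diagonally.
\<close>

primrec inflation :: "('b list \<Rightarrow> 'k) \<Rightarrow> ('b \<times> 'h \<Rightarrow>\<^sub>0 'k) set list \<Rightarrow> 'k" where
  "inflation f [] = f []"
| "inflation f (X # Xs) =
    sweedler (*) X (\<lambda>b h. inflation (ract (\<lambda>bs. f (b # bs)) h) Xs)"

lemma inflation_tuple_linear:
  "Xs \<in> tuples A n \<Longrightarrow> tuple_linear BAlg n (\<lambda>f. inflation f Xs)"
proof (induction Xs arbitrary: n)
  case Nil
  thus ?case by (simp add: tuple_linear_eval)
next
  case (Cons X Xs)
  then obtain m where m: "n = Suc m" "Xs \<in> tuples A m" by (auto elim: tuples_Cons_cases)
  have "tuple_linear BAlg m (\<lambda>f. inflation (ract f h) Xs)" for h
    by (rule tuple_linear_operatorI[OF Cons.IH[OF m(2)] ract_tuple_linear])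
  from tuple_linear_ConsI[OF this] show ?case
    by (simp add: m(1) tuple_linear_sweedlerI)
qed

lemma inflation_ract_tuple_linear:
  "Xs \<in> tuples A n \<Longrightarrow> tuple_linear BAlg n (\<lambda>f. inflation (ract f h) Xs)"
  by (rule tuple_linear_operatorI[OF inflation_tuple_linear ract_tuple_linear])

lemma inflation_bilinear:
  assumes f: "multilinear BAlg (Suc n) f" and Xs: "Xs \<in> tuples A n"
  shows "bilinear_form BV HV (\<lambda>b h. inflation (ract (\<lambda>bs. f (b # bs)) h) Xs)"
proof (rule bilinear_formI)
  show "linear_functional BV (\<lambda>b. inflation (ract (\<lambda>bs. f (b # bs)) h) Xs)" for h
    using linear_functional_slice[OF inflation_ract_tuple_linear[OF Xs] f]
    by (simp add: linear_functional_whole_alg)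
  show "linear_functional HV (\<lambda>h. inflation (ract (\<lambda>bs. f (b # bs)) h) Xs)" for b
    by (rule linear_functional_operator[OF inflation_tuple_linear[OF Xs] ract_linear])
       (use f in simp_all)
qed

lemma inflation_p:
  "multilinear BAlg (Suc n) f \<Longrightarrow> Xs \<in> tuples A n \<Longrightarrow>
    inflation f (p b h # Xs) = inflation (ract (\<lambda>bs. f (b # bs)) h) Xs"
  by (simp add: sweedler_pure_tensor[OF inflation_bilinear])

lemma inflation_multilinear: "multilinear BAlg n f \<Longrightarrow> multilinear A n (inflation f)"
proof (induction n arbitrary: f)
  case (Suc n)
  have "multilinear A n (inflation (ract (\<lambda>bs. f (b # bs)) h))" for b h
    using Suc.prems by (intro Suc.IH ract_multilinear) simp
  moreover have "linear_functional A (\<lambda>X. inflation f (X # Xs))" if "Xs \<in> tuples A n" for Xs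
    unfolding functional_A inflation.simps
    by (rule linear_functional_sweedler_tensor[OF inflation_bilinear[OF Suc.prems that]])
  ultimately show ?case by (simp add: multilinear_sweedler)
qed simp

lemma restriction_inflation:
  "multilinear BAlg n f \<Longrightarrow> bs \<in> tuples BAlg n \<Longrightarrow> inflation f (map (\<lambda>b. p b 1) bs) = f bs"
proof (induction bs arbitrary: f n)
  case Nil
  thus ?case by simp
next
  case (Cons b bs)
  then obtain m where m: "n = Suc m" "bs \<in> tuples BAlg m" by (auto elim: tuples_Cons_cases)
  note f = Cons.prems(1)[unfolded m(1)]
  have fb: "multilinear BAlg m (\<lambda>ys. f (b # ys))" using f by simp
  have Xs: "map (\<lambda>b. p b 1) bs \<in> tuples A m" using m(2) map_p_tuples by blast
  have "inflation f (map (\<lambda>b. p b 1) (b # bs)) = inflation (\<lambda>ys. f (b # ys)) (map (\<lambda>b. p b 1) bs)"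
    using inflation_p[OF f Xs, of b 1]
      tuple_linear_cong[OF inflation_tuple_linear[OF Xs] ract_one[OF fb]]
    by simp
  thus ?case using Cons.IH[OF fb m(2)] by simp
qed

text \<open>
  The product \<open>(b # h) (b' # h') = b (h\<^sub>1 b') # h\<^sub>2 h'\<close> in the first slot, once inflated, is the product in
  \<open>B\<close> of \<open>b\<close> with the first entry of the diagonal action of \<open>h\<close>; the other terms are handled by the
  equivariance of \<open>inner_diff\<close>.
\<close>

lemma inner_diff_inflation:
  "multilinear BAlg n f \<Longrightarrow> Xs \<in> tuples A n \<Longrightarrow>
    AA.inner_diff (inflation f) (p b h) Xs = inflation (ract (BA.inner_diff f b) h) Xs"
proof (induction Xs arbitrary: f b h n)
  case Nil
  thus ?case by simp
next
  case (Cons Y Xs)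
  then obtain m where m: "n = Suc m" "Y \<in> car A" "Xs \<in> tuples A m"
    by (auto elim: tuples_Cons_cases)
  note f = Cons.prems(1)[unfolded m(1)]
  have ml: "multilinear BAlg m (\<lambda>ys. f (c # ys))" for c using f by simp
  have E: "multilinear BAlg (Suc m) (BA.inner_diff f b)"
    by (rule BA.inner_diff_multilinear[OF f]) simp
  have lin1: "linear_functional A (\<lambda>Y. AA.inner_diff (inflation f) (p b h) (Y # Xs))"
    using AA.inner_diff_multilinear[OF inflation_multilinear[OF f] p_closed[of b h]] m(3) by simp
  have lin2: "linear_functional A (\<lambda>Y. inflation (ract (BA.inner_diff f b) h) (Y # Xs))"
    using inflation_multilinear[OF ract_multilinear[OF E, of h]] m(3) by simp
  have lin3: "linear_functional A (\<lambda>Y. inflation f (Y # Xs))"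
    using inflation_multilinear[OF f] m(3) by simp
  have "AA.inner_diff (inflation f) (p b h) (p b' h' # Xs) =
      inflation (ract (BA.inner_diff f b) h) (p b' h' # Xs)" for b' h'
  proof -
    let ?L = "\<lambda>g. inflation (ract g h') Xs"
    note L = inflation_ract_tuple_linear[OF m(3), of h']
    let ?f = "\<lambda>c ys. f (c # ys)"
    have infl: "AA.inner_diff (\<lambda>Ys. inflation f (p b h # Ys)) (p b' h') Xs =
        AA.inner_diff (inflation (ract (?f b) h)) (p b' h') Xs"
      by (rule tuple_linear_cong[OF AA.inner_diff_tuple_linear[OF p_closed m(3)]])
         (rule inflation_p[OF f])
    have first: "inflation f (p b h \<cdot> p b' h' # Xs) = sw h (\<lambda>h1 h2. ?L (ract (?f (b * act h1 b')) h2))"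
      by (simp only: functional_mult_p[OF lin3] inflation_p[OF f m(3)]
          tuple_linear_cong[OF inflation_tuple_linear[OF m(3)] ract_ract[OF ml]])
    have second: "AA.inner_diff (inflation (ract (?f b) h)) (p b' h') Xs =
        sw h (\<lambda>h1 h2. ?L (ract (BA.inner_diff (?f b) (act h1 b')) h2))"
      unfolding Cons.IH[OF ract_multilinear[OF ml] m(3)] tuple_linear_sweedler[OF L, symmetric]
      by (rule tuple_linear_cong[OF L]) (rule inner_diff_ract[OF ml])
    have "inflation (ract (BA.inner_diff f b) h) (p b' h' # Xs) =
        ?L (\<lambda>ys. ract (BA.inner_diff f b) h (b' # ys))"
      by (rule inflation_p[OF ract_multilinear[OF E] m(3)])
    also have "\<dots> = sw h (\<lambda>h1 h2. ?L (ract (\<lambda>ys. ?f (b * act h1 b') ys - BA.inner_diff (?f b) (act h1 b') ys) h2))"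
      by (simp add: tuple_linear_sweedler[OF L])
    also have "\<dots> = sw h (\<lambda>h1 h2. ?L (ract (?f (b * act h1 b')) h2) -
        ?L (ract (BA.inner_diff (?f b) (act h1 b')) h2))"
      by (simp only: tuple_linear_diff[OF tuple_linear_operatorI[OF L ract_tuple_linear]])
    finally show ?thesis
      by (simp only: AA.inner_diff.simps infl first second sweedler_diff)
  qed
  thus ?case by (rule functional_eq_on_p[OF lin1 lin2 _ m(2)])
qed

text \<open>
  Invariance enters through the one face in which the first argument acts on the coefficients:
  there \<open>b # h\<close> acts by \<open>\<epsilon>(b) \<epsilon>(h)\<close>, whereas inflation makes \<open>h\<close> act on \<open>f\<close>.
\<close>

lemma diff_inflation:
  assumes f: "multilinear BAlg n f" and inv: "\<And>h bs. bs \<in> tuples BAlg n \<Longrightarrow> ract f h bs = \<epsilon>H h * f bs"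
    and Xs: "Xs \<in> tuples A (Suc n)"
  shows "AA.diff n (inflation f) Xs = inflation (BA.diff n f) Xs"
proof -
  from Xs obtain Y Ys where Y: "Xs = Y # Ys" "Y \<in> car A" and Ys: "Ys \<in> tuples A n"
    by (rule tuples_Suc_cases)
  note ml = BA.diff_multilinear[OF f]
  have "AA.diff n (inflation f) (p b h # Ys) = inflation (BA.diff n f) (p b h # Ys)" for b h
  proof -
    note L = inflation_ract_tuple_linear[OF Ys, of h]
    have "inflation (BA.diff n f) (p b h # Ys) =
        inflation (ract (\<lambda>bs. \<epsilon>B b * f bs - BA.inner_diff f b bs) h) Ys"
      unfolding inflation_p[OF ml Ys]
      by (rule tuple_linear_cong[OF L]) (simp add: BA.diff_Cons)
    also have "\<dots> = \<epsilon>B b * inflation (ract f h) Ys - inflation (ract (BA.inner_diff f b) h) Ys"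
      by (simp only: tuple_linear_diff[OF L] tuple_linear_cmult[OF L])
    also have "inflation (ract f h) Ys = \<epsilon>H h * inflation f Ys"
      unfolding tuple_linear_cmult[OF inflation_tuple_linear[OF Ys], symmetric]
      by (rule tuple_linear_cong[OF inflation_tuple_linear[OF Ys]]) (rule inv)
    finally show ?thesis
      by (simp add: AA.diff_Cons Ys inner_diff_inflation[OF f Ys])
  qed
  thus ?thesis
    unfolding Y(1)
    by (rule functional_eq_on_p[OF _ _ _ Y(2), rotated 2])
       (use AA.diff_multilinear[OF inflation_multilinear[OF f]] inflation_multilinear[OF ml] Ys in simp_all)
qed

text \<open>
  In the induction step, \<open>b # g\<close> in the first slot is multiplied by \<open>h\<close> to \<open>(h\<^sub>1 b # 1) (1 # h\<^sub>2 g)\<close>, and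
  the second factor moves to the next slot because \<open>G\<close> is balanced.
\<close>

lemma inflation_restriction:
  "multilinear A n G \<Longrightarrow> AA.balanced (range (p 1)) n G \<Longrightarrow> Xs \<in> tuples A n \<Longrightarrow>
    inflation (ract (restriction G) h) Xs = AA.act_first (p 1 h) G Xs"
proof (induction Xs arbitrary: G h n)
  case Nil
  thus ?case by (simp add: augmentation_one)
next
  case (Cons X Xs)
  then obtain m where m: "n = Suc m" "X \<in> car A" "Xs \<in> tuples A m"
    by (auto elim: tuples_Cons_cases)
  note G = Cons.prems(1)[unfolded m(1)] and bal = Cons.prems(2)[unfolded m(1)]
  let ?G = "\<lambda>c Ys. G (p c 1 # Ys)"
  have ml: "multilinear A m (?G c)" and bal': "AA.balanced (range (p 1)) m (?G c)" for c
    using G bal by simp_all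
  have res: "multilinear BAlg (Suc m) (ract (restriction G) h)"
    by (intro ract_multilinear restriction_multilinear G)
  have linG: "linear_functional A (\<lambda>X. G (X # Xs))" using G m(3) by simp
  have "inflation (ract (restriction G) h) (p b g # Xs) = AA.act_first (p 1 h) G (p b g # Xs)" for b g
  proof -
    note L = inflation_ract_tuple_linear[OF m(3), of g]
    have "inflation (ract (restriction G) h) (p b g # Xs) =
        inflation (ract (\<lambda>ys. ract (restriction G) h (b # ys)) g) Xs"
      by (rule inflation_p[OF res m(3)])
    also have "\<dots> = sw h (\<lambda>h1 h2. inflation (ract (ract (restriction (?G (act h1 b))) h2) g) Xs)"
      by (simp add: restriction_Cons tuple_linear_sweedler[OF L])
    also have "\<dots> = sw h (\<lambda>h1 h2. inflation (ract (restriction (?G (act h1 b))) (h2 * g)) Xs)"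
      by (simp only: tuple_linear_cong[OF inflation_tuple_linear[OF m(3)]
            ract_ract[OF restriction_multilinear[OF ml]]])
    also have "\<dots> = sw h (\<lambda>h1 h2. AA.act_first (p 1 (h2 * g)) (?G (act h1 b)) Xs)"
      by (simp only: Cons.IH[OF ml bal' m(3)])
    also have "\<dots> = sw h (\<lambda>h1 h2. G (p (act h1 b) 1 \<cdot> p 1 (h2 * g) # Xs))"
      using bal m(3) by simp
    also have "\<dots> = G (p 1 h \<cdot> p b g # Xs)"
      by (simp add: functional_mult_p[OF linG] p_mult_one_p)
    finally show ?thesis by simp
  qed
  note on_p = this
  have lin1: "linear_functional A (\<lambda>X. inflation (ract (restriction G) h) (X # Xs))"
    using inflation_multilinear[OF res] m(3) by (simp del: inflation.simps)
  have lin2: "linear_functional A (\<lambda>X. AA.act_first (p 1 h) G (X # Xs))"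
    using mult_functional_right[OF linG p_closed] by simp
  show ?case by (rule functional_eq_on_p[OF lin1 lin2 on_p m(2)])
qed

end

section \<open>Comparison of the cohomology spaces\<close>

interpretation cfun: vector_space "cochain_scale (*) :: 'k::field \<Rightarrow> ('a list \<Rightarrow> 'k) \<Rightarrow> _"
  by unfold_locales (simp_all add: cochain_scale_def fun_eq_iff algebra_simps)

text \<open>
  The target is described by its carrier, so that it may be a subspace of a quotient, as spaces of
  invariants are.
\<close>

lemma isomorphic_quotientI:
  fixes \<phi> :: "'v::ab_group_add \<Rightarrow> 'w::ab_group_add"
  assumes V: "vector_space s" and W: "vector_space s'"
    and add: "\<And>x y. \<phi> (x + y) = \<phi> x + \<phi> y" and scale: "\<And>c x. \<phi> (s c x) = s' c (\<phi> x)"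
    and U: "module.subspace s U" and N: "module.subspace s N" and M: "module.subspace s' M"
    and into: "\<And>x. x \<in> N \<Longrightarrow> \<phi> x \<in> M" and inj: "\<And>x. x \<in> U \<Longrightarrow> \<phi> x \<in> M \<Longrightarrow> x \<in> N"
    and Q: "car Q = (\<lambda>x. coset M (\<phi> x)) ` U" "vadd Q = induced2 M (+)"
      "vscale Q = (\<lambda>c. induced M (s' c))"
  shows "isomorphic_spaces (quotient_space s U N) Q"
proof -
  interpret V: vector_space s by fact
  interpret W: vector_space s' by fact
  have N0: "0 \<in> N" and M0: "0 \<in> M" using N M by (simp_all add: V.subspace_0 W.subspace_0)
  have diff: "\<phi> x - \<phi> y = \<phi> (x - y)" for x y
    using add[of "x - y" y] by simp
  have \<phi>: "induced M \<phi> (coset N x) = coset M (\<phi> x)" for x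
    by (rule W.induced_coset[OF M refl N0]) (simp add: mem_coset diff into)
  have addV: "induced2 N (+) (coset N x) (coset N y) = coset N (x + y)" for x y
    by (rule V.induced2_coset[OF N refl N0 refl N0])
       (use V.subspace_add[OF N] in \<open>simp add: mem_coset add_diff_add\<close>)
  have addW: "induced2 M (+) (coset M x) (coset M y) = coset M (x + y)" for x y
    by (rule W.induced2_coset[OF M refl M0 refl M0])
       (use W.subspace_add[OF M] in \<open>simp add: mem_coset add_diff_add\<close>)
  have scaleV: "induced N (s c) (coset N x) = coset N (s c x)" for c x
    by (rule V.induced_coset[OF N refl N0])
       (use V.subspace_scale[OF N] in \<open>simp add: mem_coset V.scale_right_diff_distrib[symmetric]\<close>)
  have scaleW: "induced M (s' c) (coset M x) = coset M (s' c x)" for c x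
    by (rule W.induced_coset[OF M refl M0])
       (use W.subspace_scale[OF M] in \<open>simp add: mem_coset W.scale_right_diff_distrib[symmetric]\<close>)
  have "linear_between (quotient_space s U N) Q (induced M \<phi>)"
    by (auto simp: linear_between_def quotient_space_def Q addV scaleV \<phi> add scale addW scaleW)
  moreover have "bij_betw (induced M \<phi>) (coset N ` U) ((\<lambda>x. coset M (\<phi> x)) ` U)"
  proof (rule bij_betw_imageI)
    show "inj_on (induced M \<phi>) (coset N ` U)"
      by (auto simp: inj_on_def \<phi> V.coset_eq_iff[OF N] W.coset_eq_iff[OF M] diff
          intro!: inj V.subspace_diff[OF U])
    show "induced M \<phi> ` coset N ` U = (\<lambda>x. coset M (\<phi> x)) ` U"
      by (simp add: image_image \<phi>)
  qed
  ultimately show ?thesis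
    unfolding isomorphic_spaces_def by (auto simp: quotient_space_def Q)
qed

context augmented_algebra
begin

lemma diff_zero: "diff n 0 = 0"
  using diff_minus[of n 0 0] by simp

lemma cochains_subspace: "cfun.subspace (cochains A (*) n)"
proof -
  have "multilinear A n (\<lambda>xs. 0)" using multilinear_sum[of "{}" A n] by simp
  thus ?thesis
    by (simp add: cfun.subspace_def cochains_iff cochain_scale_def plus_fun_def zero_fun_def
        multilinear_plus multilinear_cmult)
qed

lemma cocycles_subspace: "cfun.subspace {F \<in> cochains A (*) n. diff n F = 0}"
  using cochains_subspace[of n]
  by (simp add: cfun.subspace_def diff_plus diff_scale diff_zero)

lemma coboundaries_subspace: "cfun.subspace (trivial_coboundaries A \<epsilon> n)"
proof (cases n)
  case 0
  thus ?thesis by (simp add: trivial_coboundaries_eq)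
next
  case (Suc m)
  note sub = cochains_subspace[of m]
  have "0 \<in> diff m ` cochains A (*) m"
    using imageI[OF cfun.subspace_0[OF sub], of "diff m"] by (simp add: diff_zero)
  thus ?thesis
    unfolding cfun.subspace_def trivial_coboundaries_eq Suc nat.case
    using cfun.subspace_add[OF sub] cfun.subspace_scale[OF sub]
    by (auto simp: diff_plus[symmetric] diff_scale[symmetric])
qed

lemma trivial_cohomology_eq:
  "trivial_cohomology A \<epsilon> n = quotient_space (cochain_scale (*))
    {F \<in> cochains A (*) n. diff n F = 0} (trivial_coboundaries A \<epsilon> n)"
  by (simp add: trivial_cohomology_def hochschild_cohomology_def cocycles_def trivial_diff_def
      trivial_coboundaries_def)

end

context smash_product
begin

abbreviation NB where "NB n \<equiv> trivial_coboundaries BAlg \<epsilon>B n"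
abbreviation NA where "NA n \<equiv> trivial_coboundaries A (acounit A) n"

lemma restriction_coboundary: "F \<in> NA n \<Longrightarrow> restriction F \<in> NB n"
  by (cases n)
     (auto simp: AA.trivial_coboundaries_eq BA.trivial_coboundaries_eq diff_restriction[symmetric]
       restriction_cochain, auto simp: restriction_def)

lemma ract_coboundary: "f \<in> NB n \<Longrightarrow> ract f h \<in> NB n"
proof (cases n)
  case 0
  assume "f \<in> NB n"
  hence "f = 0" by (simp add: 0 BA.trivial_coboundaries_eq)
  moreover have "ract 0 h = 0"
  proof
    fix bs
    have "bs \<in> tuples BAlg (length bs)" by (simp add: tuples_def)
    from tuple_linear_zero[OF ract_tuple_linear[OF this]] show "ract 0 h bs = 0 bs" by simp
  qed
  ultimately show ?thesis by (simp add: 0 BA.trivial_coboundaries_eq)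
next
  case (Suc m)
  assume "f \<in> NB n"
  thus ?thesis by (auto simp: Suc BA.trivial_coboundaries_eq diff_ract[symmetric] ract_cochain)
qed

lemma ract_minus:
  "ract (f - g) h = ract f h - ract g h"
proof
  fix bs
  have "bs \<in> tuples BAlg (length bs)" by (simp add: tuples_def)
  from tuple_linear_diff[OF ract_tuple_linear[OF this, of h], of f g]
  show "ract (f - g) h bs = (ract f h - ract g h) bs" by (simp add: fun_diff_def)
qed

lemma cohomology_left_coset:
  "cohomology_left BAlg \<epsilon>B n \<epsilon>H h (coset (NB n) f) = coset (NB n) (cochain_left \<epsilon>H h f)"
  unfolding cohomology_left_def
proof (rule cfun.induced_coset[OF BA.coboundaries_subspace refl])
  note sub = BA.coboundaries_subspace
  show "0 \<in> NB n" by (rule cfun.subspace_0[OF sub])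
  fix g assume "g \<in> coset (NB n) f"
  hence "cochain_scale (*) (\<epsilon>H h) (g - f) \<in> NB n"
    by (intro cfun.subspace_scale[OF sub]) (simp add: mem_coset)
  moreover have "cochain_scale (*) (\<epsilon>H h) (g - f) = cochain_left \<epsilon>H h g - cochain_left \<epsilon>H h f"
    by (simp add: fun_eq_iff cochain_scale_def cochain_left_def right_diff_distrib)
  ultimately show "cochain_left \<epsilon>H h g - cochain_left \<epsilon>H h f \<in> NB n" by simp
qed

lemma cohomology_right_coset:
  "cohomology_right BAlg \<epsilon>B n \<Delta>H \<epsilon>H act (coset (NB n) f) h = coset (NB n) (ract f h)"
  unfolding cohomology_right_def
proof (rule cfun.induced_coset[OF BA.coboundaries_subspace refl])
  show "0 \<in> NB n" by (rule cfun.subspace_0[OF BA.coboundaries_subspace])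
  fix g assume "g \<in> coset (NB n) f"
  thus "ract g h - ract f h \<in> NB n"
    using ract_coboundary[of "g - f" n h] by (simp add: mem_coset ract_minus)
qed

lemma invariant_class_iff:
  "(\<forall>h. cohomology_left BAlg \<epsilon>B n \<epsilon>H h (coset (NB n) f) =
      cohomology_right BAlg \<epsilon>B n \<Delta>H \<epsilon>H act (coset (NB n) f) h) \<longleftrightarrow>
   (\<forall>h. cochain_left \<epsilon>H h f - ract f h \<in> NB n)"
  by (simp add: cohomology_left_coset cohomology_right_coset
      cfun.coset_eq_iff[OF BA.coboundaries_subspace])

text \<open>Here \<open>(f t) h = f (t h) = \<epsilon>(h) f t\<close>, because \<open>t\<close> is a right integral.\<close>

lemma ract_integral:
  assumes t: "\<And>\<phi> h. linear_functional HV \<phi> \<Longrightarrow> \<phi> (t * h) = \<epsilon>H h * \<phi> t"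
    and f: "multilinear BAlg n f" and bs: "bs \<in> tuples BAlg n"
  shows "ract (ract f t) h bs = \<epsilon>H h * ract f t bs"
  using t[OF ract_linear[OF f bs], of h] by (simp add: ract_ract[OF f bs])

lemma cochain_eqI:
  assumes "f \<in> cochains V (*) n" "g \<in> cochains V (*) n" "\<And>xs. xs \<in> tuples V n \<Longrightarrow> f xs = g xs"
  shows "f = g"
  using assms by (fastforce simp: cochains_iff)

theorem cohomology_smash_product:
  assumes ss: "semisimple_ring TYPE('h)"
  shows "isomorphic_spaces (trivial_cohomology A (acounit A) n)
    (invariants (trivial_cohomology BAlg \<epsilon>B n) (cohomology_left BAlg \<epsilon>B n \<epsilon>H)
      (cohomology_right BAlg \<epsilon>B n \<Delta>H \<epsilon>H act))"
proof -
  obtain \<Lambda> where \<Lambda>: "\<And>h. h * \<Lambda> = sH (\<epsilon>H h) \<Lambda>" "\<epsilon>H \<Lambda> = 1"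
    using H.semisimple_integral[OF ss] by blast
  define t where "t = SH \<Lambda>"
  have t: "\<phi> (t * h) = \<epsilon>H h * \<phi> t" if "linear_functional HV \<phi>" for \<phi> h
    unfolding t_def by (rule H.antipode_integral_right[OF \<Lambda>(1) that])
  have \<epsilon>t: "\<epsilon>H t = 1" by (simp add: t_def H.counit_antipode \<Lambda>(2))
  interpret sep: separable_subalgebra A "acounit A"
    "Poly_Mapping.keys (SOME r. r \<in> \<Delta>H \<Lambda>)"
    "\<lambda>i. p 1 (sH (Poly_Mapping.lookup (SOME r. r \<in> \<Delta>H \<Lambda>) i) (fst i))"
    "\<lambda>i. p 1 (SH (snd i))" "p 1 (SH \<Lambda>)" "range (p 1)"
    by (rule integral_separable[OF \<Lambda>])
  note subN = BA.coboundaries_subspace[of n]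
  let ?ZA = "{F \<in> cochains A (*) n. AA.diff n F = 0}"
  let ?ZB = "{f \<in> cochains BAlg (*) n. BA.diff n f = 0}"

  \<comment> \<open>each cocycle is cohomologous to the inflation of an invariant cochain of \<open>B\<close>\<close>
  have relative: "\<exists>G\<in>?ZA. F - G \<in> NA n \<and>
      (\<forall>Xs\<in>tuples A n. inflation (restriction G) Xs = G Xs) \<and>
      (\<forall>h. ract (restriction G) h = cochain_left \<epsilon>H h (restriction G))"
    if F: "F \<in> ?ZA" for F
  proof -
    from F have "F \<in> cochains A (*) n" "AA.diff n F = 0" by simp_all
    then obtain G where G: "G \<in> cochains A (*) n" "AA.diff n G = 0"
        "AA.balanced (range (p 1)) n G" "F - G \<in> NA n"
        "\<And>h Xs. h \<in> range (p 1) \<Longrightarrow> Xs \<in> tuples A n \<Longrightarrow> AA.act_first h G Xs = acounit A h * G Xs"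
      using sep.relative_cocycle by metis
    have ml: "multilinear A n G" using G(1) by (simp add: cochains_iff)
    have infl: "inflation (ract (restriction G) h) Xs = \<epsilon>H h * G Xs" if "Xs \<in> tuples A n" for h Xs
      using inflation_restriction[OF ml G(3) that, of h] G(5)[OF _ that, of "p 1 h"]
      by (simp add: augmentation_one)
    have rml: "multilinear BAlg n (restriction G)" by (rule restriction_multilinear[OF ml])
    have "inflation (restriction G) Xs = G Xs" if "Xs \<in> tuples A n" for Xs
      using infl[OF that, of 1] tuple_linear_cong[OF inflation_tuple_linear[OF that] ract_one[OF rml]]
      by (simp add: H.counit_one)
    moreover have "ract (restriction G) h = cochain_left \<epsilon>H h (restriction G)" for h
    proof (rule cochain_eqI)
      show r: "ract (restriction G) h \<in> cochains BAlg (*) n"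
        by (rule ract_cochain[OF restriction_cochain[OF G(1)]])
      show "cochain_left \<epsilon>H h (restriction G) \<in> cochains BAlg (*) n"
        using cfun.subspace_scale[OF BA.cochains_subspace restriction_cochain[OF G(1)]]
        by (simp add: cochain_left_def cochain_scale_def)
      fix bs assume bs: "bs \<in> tuples BAlg n"
      hence "map (\<lambda>b. p b 1) bs \<in> tuples A n" by (simp only: map_p_tuples)
      from infl[OF this, of h] restriction_inflation[OF ract_multilinear[OF rml] bs, of h]
      show "ract (restriction G) h bs = cochain_left \<epsilon>H h (restriction G) bs"
        by (simp add: cochain_left_def restriction_def)
    qed
    ultimately show ?thesis using G by blast
  qed

  have res_minus: "restriction F - restriction G = restriction (F - G)" for F G
    by (simp add: fun_eq_iff restriction_def)

  \<comment> \<open>on invariant cochains, inflation is a chain map and a section of restriction\<close>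
  have extend: "\<exists>F\<in>cochains A (*) m. restriction F = f \<and>
      (\<forall>Xs\<in>tuples A m. F Xs = inflation f Xs) \<and>
      (\<forall>Xs\<in>tuples A (Suc m). AA.diff m F Xs = inflation (BA.diff m f) Xs)"
    if f: "f \<in> cochains BAlg (*) m"
      and inv: "\<And>h bs. bs \<in> tuples BAlg m \<Longrightarrow> ract f h bs = \<epsilon>H h * f bs" for f m
  proof -
    have ml: "multilinear BAlg m f" using f by (simp add: cochains_iff)
    let ?F = "AA.restrict_tuples m (inflation f)"
    have F: "?F \<in> cochains A (*) m"
      by (rule AA.restrict_tuples_cochain[OF inflation_multilinear[OF ml]])
    have "restriction ?F = f"
    proof (rule cochain_eqI[OF restriction_cochain[OF F] f])
      fix bs assume "bs \<in> tuples BAlg m"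
      thus "restriction ?F bs = f bs"
        using restriction_inflation[OF ml, of bs] map_p_tuples[of bs m]
        by (simp add: restriction_def AA.restrict_tuples_def)
    qed
    with F show ?thesis
      using diff_inflation[OF ml inv]
      by (intro bexI[of _ ?F]) (simp_all add: AA.diff_restrict_tuples, simp add: AA.restrict_tuples_def)
  qed

  have inj: "F \<in> NA n" if F: "F \<in> ?ZA" and res: "restriction F \<in> NB n" for F
  proof -
    obtain G where G: "G \<in> ?ZA" "F - G \<in> NA n"
        "\<And>Xs. Xs \<in> tuples A n \<Longrightarrow> inflation (restriction G) Xs = G Xs"
        "\<And>h. ract (restriction G) h = cochain_left \<epsilon>H h (restriction G)"
      using relative[OF F] by blast
    have "restriction F - restriction (F - G) \<in> NB n"
      by (rule cfun.subspace_diff[OF subN res restriction_coboundary[OF G(2)]])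
    hence resG: "restriction G \<in> NB n" by (simp add: res_minus)
    have "G \<in> NA n"
    proof (cases n)
      case 0
      with resG have "restriction G = 0" by (simp add: BA.trivial_coboundaries_eq)
      hence "G [] = 0" by (metis restriction_Nil zero_fun_apply)
      moreover have "0 \<in> cochains A (*) n" by (rule cfun.subspace_0[OF AA.cochains_subspace])
      ultimately have "G = 0" using G(1) 0 by (intro cochain_eqI[of G A n 0]) auto
      thus ?thesis by (simp add: 0 AA.trivial_coboundaries_eq)
    next
      case (Suc m)
      with resG obtain g where g: "g \<in> cochains BAlg (*) m" "restriction G = BA.diff m g"
        by (auto simp: BA.trivial_coboundaries_eq)
      have gml: "multilinear BAlg m g" using g(1) by (simp add: cochains_iff)
      \<comment> \<open>averaging over \<open>t\<close> makes \<open>g\<close> invariant and leaves its coboundary unchanged\<close>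
      have "BA.diff m (ract g t) = ract (restriction G) t"
        by (simp add: diff_ract[OF g(1)] g(2))
      hence diff: "BA.diff m (ract g t) = restriction G"
        by (simp add: G(4) cochain_left_def \<epsilon>t)
      obtain K where K: "K \<in> cochains A (*) m"
          "\<And>Xs. Xs \<in> tuples A (Suc m) \<Longrightarrow> AA.diff m K Xs = inflation (restriction G) Xs"
        using extend[OF ract_cochain[OF g(1)] ract_integral[OF t gml]] diff by metis
      have "G = AA.diff m K"
        by (rule cochain_eqI[OF _ AA.diff_cochain[OF K(1)]]) (use G K(2) Suc in auto)
      thus ?thesis using K(1) by (simp add: Suc AA.trivial_coboundaries_eq)
    qed
    from cfun.subspace_add[OF AA.coboundaries_subspace G(2) this] show ?thesis by simp
  qed

  have invariant: "cochain_left \<epsilon>H h (restriction F) - ract (restriction F) h \<in> NB n"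
    if F: "F \<in> ?ZA" for F h
  proof -
    obtain G where G: "F - G \<in> NA n" "\<And>h. ract (restriction G) h = cochain_left \<epsilon>H h (restriction G)"
      using relative[OF F] by blast
    let ?d = "restriction F - restriction G"
    have d: "?d \<in> NB n" using restriction_coboundary[OF G(1)] by (simp add: res_minus)
    have "cochain_left \<epsilon>H h (restriction F) - ract (restriction F) h =
        cochain_scale (*) (\<epsilon>H h) ?d - ract ?d h"
      by (simp add: ract_minus G(2) fun_eq_iff cochain_scale_def cochain_left_def algebra_simps)
    thus ?thesis
      using cfun.subspace_diff[OF subN cfun.subspace_scale[OF subN d] ract_coboundary[OF d]]
      by simp
  qed

  have surj: "\<exists>F\<in>?ZA. coset (NB n) f = coset (NB n) (restriction F)"
    if f: "f \<in> ?ZB" and inv: "\<And>h. cochain_left \<epsilon>H h f - ract f h \<in> NB n" for f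
  proof -
    have fc: "f \<in> cochains BAlg (*) n" and ml: "multilinear BAlg n f"
      using f by (simp_all add: cochains_iff)
    obtain F where F: "F \<in> cochains A (*) n" "restriction F = ract f t"
        "\<And>Xs. Xs \<in> tuples A (Suc n) \<Longrightarrow> AA.diff n F Xs = inflation (BA.diff n (ract f t)) Xs"
      using extend[OF ract_cochain[OF fc] ract_integral[OF t ml]] by metis
    have "BA.diff n (ract f t) = ract 0 t"
      using f by (simp add: diff_ract[OF fc])
    also have "\<dots> = 0" using ract_minus[of 0 0 t] by simp
    finally have "AA.diff n F Xs = 0" if "Xs \<in> tuples A (Suc n)" for Xs
      using F(3)[OF that] tuple_linear_zero[OF inflation_tuple_linear[OF that]] by simp
    hence "AA.diff n F = 0" using AA.diff_outside by fastforce
    moreover have "coset (NB n) f = coset (NB n) (restriction F)"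
      using inv[of t] by (simp add: F(2) cfun.coset_eq_iff[OF subN] cochain_left_def \<epsilon>t)
    ultimately show ?thesis using F(1) by blast
  qed

  show ?thesis
    unfolding AA.trivial_cohomology_eq
  proof (rule isomorphic_quotientI[of _ "cochain_scale (*)" restriction _ _ "NB n"])
    show "vector_space (cochain_scale (*) :: 'k \<Rightarrow> ('b list \<Rightarrow> 'k) \<Rightarrow> _)"
      "vector_space (cochain_scale (*) :: 'k \<Rightarrow> (('b \<times> 'h \<Rightarrow>\<^sub>0 'k) set list \<Rightarrow> 'k) \<Rightarrow> _)"
      by (rule cfun.vector_space_axioms)+
    have "restriction F \<in> ?ZB" if "F \<in> ?ZA" for F
      using that restriction_cochain[of F n] diff_restriction[of n F]
      by (simp add: restriction_def zero_fun_def)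
    with invariant surj
    show "car (invariants (trivial_cohomology BAlg \<epsilon>B n) (cohomology_left BAlg \<epsilon>B n \<epsilon>H)
        (cohomology_right BAlg \<epsilon>B n \<Delta>H \<epsilon>H act)) = (\<lambda>F. coset (NB n) (restriction F)) ` ?ZA"
      unfolding invariants_def BA.trivial_cohomology_eq quotient_space_def
      by (auto simp: invariant_class_iff image_iff) (metis invariant_class_iff)+
    show "restriction (F + G) = restriction F + restriction G"
      "restriction (cochain_scale (*) c F) = cochain_scale (*) c (restriction F)" for F G c
      by (simp_all add: restriction_def cochain_scale_def fun_eq_iff)
  qed (use restriction_coboundary inj in \<open>auto simp: invariants_def BA.trivial_cohomology_eq
      quotient_space_def AA.cocycles_subspace AA.coboundaries_subspace subN\<close>)
qed

theorem differential_bimodule_hom: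
  "bimodule_hom (cochain_space BAlg (*) n) (cochain_left \<epsilon>H) (cochain_right \<Delta>H \<epsilon>H act)
    (cochain_space BAlg (*) (Suc n)) (cochain_left \<epsilon>H) (cochain_right \<Delta>H \<epsilon>H act)
    (trivial_diff BAlg \<epsilon>B n)"
proof -
  have "cochain_left \<epsilon>H h f = cochain_scale (*) (\<epsilon>H h) f" for h and f :: "'b list \<Rightarrow> 'k"
    by (simp add: fun_eq_iff cochain_left_def cochain_scale_def)
  thus ?thesis
    by (simp add: bimodule_hom_def linear_between_def cochain_space_def BA.diff_cochain
        BA.diff_plus BA.diff_scale diff_ract)
qed

end

section \<open>Bosonizations\<close>

theorem corollary4p3:
  fixes sH :: "'k::field \<Rightarrow> 'h::ring_1 \<Rightarrow> 'h"
    and \<Delta>H :: "'h \<Rightarrow> ('h \<times> 'h \<Rightarrow>\<^sub>0 'k) set"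
    and \<epsilon>H :: "'h \<Rightarrow> 'k"
    and SH :: "'h \<Rightarrow> 'h"
    and sB :: "'k \<Rightarrow> 'b::ring_1 \<Rightarrow> 'b"
    and act :: "'h \<Rightarrow> 'b \<Rightarrow> 'b"
    and coact :: "'b \<Rightarrow> ('h \<times> 'b \<Rightarrow>\<^sub>0 'k) set"
    and \<Delta>B :: "'b \<Rightarrow> ('b \<times> 'b \<Rightarrow>\<^sub>0 'k) set"
    and \<epsilon>B :: "'b \<Rightarrow> 'k"
  assumes "hopf_algebra sH \<Delta>H \<epsilon>H SH"
    and "semisimple_ring TYPE('h)"
    and "yetter_drinfeld_bialgebra sH \<Delta>H \<epsilon>H SH sB act coact \<Delta>B \<epsilon>B"
  shows "(\<forall>n. isomorphic_spaces
            (trivial_cohomology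
               (bosonization sH \<Delta>H \<epsilon>H sB act coact \<Delta>B \<epsilon>B)
               (acounit (bosonization sH \<Delta>H \<epsilon>H sB act coact \<Delta>B \<epsilon>B)) n)
            (invariants
               (trivial_cohomology (whole_alg sB) \<epsilon>B n)
               (cohomology_left (whole_alg sB) \<epsilon>B n \<epsilon>H)
               (cohomology_right (whole_alg sB) \<epsilon>B n \<Delta>H \<epsilon>H act))) \<and>
         (\<forall>n. bimodule_hom
            (cochain_space (whole_alg sB) (*) n)
            (cochain_left \<epsilon>H) (cochain_right \<Delta>H \<epsilon>H act)
            (cochain_space (whole_alg sB) (*) (Suc n))
            (cochain_left \<epsilon>H) (cochain_right \<Delta>H \<epsilon>H act)
            (trivial_diff (whole_alg sB) \<epsilon>B n))"
proof -
  interpret D: yetter_drinfeld_bialgebra sH \<Delta>H \<epsilon>H SH sB act coact \<Delta>B \<epsilon>B by fact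
  interpret smash_product sH \<Delta>H \<epsilon>H SH sB act \<epsilon>B coact \<Delta>B
    by unfold_locales
      (simp_all add: D.act_linear_left D.act_linear_right D.act_one D.act_mult D.mult_act D.one_act
        D.B.counit_linear D.counit_act D.braided_counit_one D.braided_counit_mult)
  show ?thesis
    using cohomology_smash_product[OF assms(2)] differential_bimodule_hom
    unfolding A_def by blast
qed

end
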